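(* Let $Z$ be a complex four-fold fibred over $\mathbb{P}^1$ with patching over the total space of $\mathcal O(1)\oplus\mathcal O(1)$ given by $$\hat T=T+\epsilon f(\Omega^A,\lambda),\qquad \hat\Omega^A=\lambda^{-1}\Omega^A\quad(A=0,1),$$ where $\epsilon$ is a deformation parameter, whose five-parameter family of global sections $X_x$ have normal bundle $N_x=\mathcal O\oplus\mathcal O(1)\oplus\mathcal O(1)$. The moduli space $M$ of those sections is a complex five-dimensional manifold equipped with a Galilean structure with torsion (induced by the frame section as in the context) whose clock admits a representative with $$d\theta=\epsilon\left\{\frac{1}{2\pi i}\oint\frac{\partial^2f}{\partial\omega^A\partial\omega^B}\Big|\,\frac{\pi_{B'}}{\pi_{0'}}\,\pi\cdot d\pi\right\}dx^{BB'}\wedge dx^{A1'}.$$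
   Context: Notation. Cover $\mathbb{P}^1$ by $U,\hat U$ with coordinates $\lambda$ and $\hat\lambda=\lambda^{-1}$; homogeneous coordinates are $[\pi_{A'}]=[\pi_{0'},\pi_{1'}]$ with $\lambda=\pi_{0'}/\pi_{1'}$. $f(\Omega^A,\lambda)$ is holomorphic on the part of $\mathcal O(1)\oplus\mathcal O(1)$ over $U\cap\hat U$; $\omega^A=\pi_{1'}\Omega^A$ are the homogeneous (weight one) versions of $\Omega^A$, and $f$ is regarded as a function of weight zero of $(\omega^A,\pi_{A'})$. Convention: $\pi\cdot d\pi=\pi_{1'}d\pi_{0'}-\pi_{0'}d\pi_{1'}=\pi_{1'}^2d\lambda$; the contour lies in $U\cap\hat U$ and circles $\lambda=0$ once. Repeated spinor indices are summed over. The global sections have $\omega^A|=x^{AA'}\pi_{A'}$, i.e. $\Omega^A|=x^{A1'}+x^{A0'}\lambda$, and, writing $f|=\sum_n\gamma_n\lambda^n$, $T|=t-\epsilon\sum_{n\ge1}\gamma_n\lambda^n$; so $(t,x^{AA'})$ are coordinates on $M$. All objects are holomorphic, and a vertical slash denotes restriction to $X_x$. Put $w=(T,\Omega^A)$, $\hat w=(\hat T,\hat\Omega^A)$. The normal bundle $N_x$ has patching $\mathcal F^\mu_{\ \nu}=\frac{\partial\hat w^\mu}{\partial w^\nu}|$. The frame section is $v=H^{-1}dw|$ ($d$ is the exterior derivative on $M$ at fixed $\lambda$), where $\mathcal F=\hat H\,\mathrm{diag}(1,\lambda^{-1},\lambda^{-1})H^{-1}$ with $H$, $\hat H$ holomorphic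 maps from $U$, $\hat U$ to $\mathrm{GL}(3,\mathbb{C})$ for each $x$, $H$ being determined only up to right multiplication by an invertible global section of the trivialised endomorphism bundle $N_x\otimes N_x^*$ varying arbitrarily (holomorphically) with $x$; different choices give the different representatives. Its components are $v=(\theta,\ e^{A1'}+e^{A0'}\lambda)$, defining the clock $\theta$ and one-forms $e^{AA'}$. The covariant degenerate metric is $h^{-1}=\epsilon_{AB}\epsilon_{A'B'}e^{AA'}\otimes e^{BB'}$ ($\epsilon_{AB},\epsilon_{A'B'}$ the skew $2\times2$ symbols), and $h$ is its projective inverse: with $U$ the unique vector field with $\theta(U)=1$, $h^{-1}(U,\cdot)=0$, $h$ is the unique solution of $h^{ab}h_{bc}=\delta^a_c-U^a\theta_c$, $h(\theta,\cdot)=0$. A (complex) Galilean structure with torsion on a five-manifold is a pair $(h,\theta)$ of a symmetric contravariant 2-tensor field $h$ of rank four and a one-form $\theta$ spanning its kernel (the clock), where $\theta$ is not required to be closed; the torsion is exhibited by $d\theta$. *)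

theory Defs
  imports "HOL-Complex_Analysis.Complex_Analysis"
begin

section \<open>Several complex variables\<close>

text \<open>Holomorphic means complex Frechet differentiable: the derivative on the real normed space
  \<open>complex ^ 'n\<close> is required to be complex linear.\<close>

definition holomorphic_vec_on :: "(complex ^ 'n \<Rightarrow> complex) \<Rightarrow> (complex ^ 'n) set \<Rightarrow> bool" where
  "holomorphic_vec_on F S \<longleftrightarrow>
     (\<forall>x\<in>S. \<exists>D. (F has_derivative D) (at x) \<and> (\<forall>c v. D (c *s v) = c * D v))"

definition jointly_holomorphic_on ::
    "(complex ^ 'n \<Rightarrow> complex \<Rightarrow> complex) \<Rightarrow> ((complex ^ 'n) \<times> complex) set \<Rightarrow> bool" where
  "jointly_holomorphic_on F S \<longleftrightarrow>
     (\<forall>p\<in>S. \<exists>D. ((\<lambda>(x, l). F x l) has_derivative D) (at p) \<and>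
        (\<forall>c v m. D (c *s v, c * m) = c * D (v, m)))"

definition cpartial :: "'n \<Rightarrow> (complex ^ 'n \<Rightarrow> complex) \<Rightarrow> complex ^ 'n \<Rightarrow> complex" where
  "cpartial a F x = deriv (\<lambda>s. F (x + axis a s)) 0"

text \<open>\<open>M\<close> is a complex manifold of dimension \<open>CARD('n)\<close>, its topology and complex structure being
  those given by the atlas \<open>A\<close> (Hausdorff and second countable).\<close>

definition complex_manifold :: "'m set \<Rightarrow> ('m set \<times> ('m \<Rightarrow> complex ^ 'n)) set \<Rightarrow> bool" where
  "complex_manifold M A \<longleftrightarrow>
     (\<forall>(D, \<phi>)\<in>A. D \<subseteq> M \<and> inj_on \<phi> D \<and> open (\<phi> ` D)) \<and>
     (\<exists>B\<subseteq>A. countable B \<and> (\<Union>(D, \<phi>)\<in>B. D) = M) \<and>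
     (\<forall>(D, \<phi>)\<in>A. \<forall>(E, \<psi>)\<in>A. open (\<phi> ` (D \<inter> E)) \<and>
        (\<forall>i. holomorphic_vec_on (\<lambda>y. \<psi> (inv_into D \<phi> y) $ i) (\<phi> ` (D \<inter> E)))) \<and>
     (\<forall>p\<in>M. \<forall>q\<in>M. p \<noteq> q \<longrightarrow>
        (\<exists>(D, \<phi>)\<in>A. \<exists>(E, \<psi>)\<in>A. \<exists>P Q. open P \<and> open Q \<and> p \<in> D \<and> \<phi> p \<in> P \<and> q \<in> E \<and> \<psi> q \<in> Q \<and>
           {z\<in>D. \<phi> z \<in> P} \<inter> {z\<in>E. \<psi> z \<in> Q} = {}))"


section \<open>The patched four-fold and its global sections\<close>

text \<open>Spinor indices, primed and unprimed, are elements of the type \<open>2\<close>, with values \<open>0\<close> and \<open>1\<close>.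
  Fibre coordinates \<open>w = (T, \<Omega>\<^sup>A)\<close> have \<open>w $ None = T\<close> and \<open>w $ Some A = \<Omega>\<^sup>A\<close>. Moduli
  \<open>x = (t, x\<^bsup>AA'\<^esup>)\<close> have \<open>x $ None = t\<close> and \<open>x $ Some (A, A') = x\<^bsup>AA'\<^esup>\<close>.\<close>

type_synonym fibre_pt = "complex ^ (2 option)"
type_synonym moduli_ix = "(2 \<times> 2) option"
type_synonym moduli_pt = "complex ^ moduli_ix"

text \<open>\<open>U\<close> is described in the coordinate \<open>\<lambda>\<close> and \<open>Uh\<close> in the coordinate \<open>1/\<lambda>\<close>, so that
  \<open>0 \<in> Uh\<close> is the point at infinity. Both are discs about their origin, or the whole coordinate
  plane; the overlap (in the coordinate \<open>\<lambda>\<close>) is then an annulus, on which functions have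
  Laurent expansions.\<close>

definition origin_disc :: "complex set \<Rightarrow> bool" where
  "origin_disc U \<longleftrightarrow> U = UNIV \<or> (\<exists>R>0. U = ball 0 R)"

definition covers_P1 :: "complex set \<Rightarrow> complex set \<Rightarrow> bool" where
  "covers_P1 U Uh \<longleftrightarrow> origin_disc U \<and> origin_disc Uh \<and> (\<forall>l. l \<in> U \<or> (l \<noteq> 0 \<and> inverse l \<in> Uh))"

definition overlap :: "complex set \<Rightarrow> complex set \<Rightarrow> complex set" where
  "overlap U Uh = {l \<in> U. l \<noteq> 0 \<and> inverse l \<in> Uh}"

definition patch :: "complex \<Rightarrow> (complex ^ 2 \<Rightarrow> complex \<Rightarrow> complex) \<Rightarrow> complex \<Rightarrow> fibre_pt \<Rightarrow> fibre_pt" where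
  "patch \<epsilon> f l w = (\<chi> \<mu>. case \<mu> of
       None \<Rightarrow> w $ None + \<epsilon> * f (\<chi> A. w $ Some A) l
     | Some A \<Rightarrow> inverse l * w $ Some A)"

text \<open>The four-fold is the union of \<open>\<complex>\<^sup>3 \<times> U\<close> and \<open>\<complex>\<^sup>3 \<times> Uh\<close> with \<open>(w, l)\<close> identified with
  \<open>(patch \<epsilon> f l w, inverse l)\<close> for \<open>l\<close> in the overlap. A global section of its projection to
  \<open>\<P>\<^sup>1\<close> is accordingly a pair \<open>(s, sh)\<close> of compatible holomorphic functions; each is taken to be
  \<open>undefined\<close> off its domain so that sections are equal only if their representing pairs are.\<close>

definition global_sections ::
    "complex set \<Rightarrow> complex set \<Rightarrow> complex \<Rightarrow> (complex ^ 2 \<Rightarrow> complex \<Rightarrow> complex) \<Rightarrow>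
     ((complex \<Rightarrow> fibre_pt) \<times> (complex \<Rightarrow> fibre_pt)) set" where
  "global_sections U Uh \<epsilon> f = {(s, sh).
     s \<in> extensional U \<and> sh \<in> extensional Uh \<and>
     (\<forall>\<mu>. (\<lambda>l. s l $ \<mu>) holomorphic_on U) \<and> (\<forall>\<mu>. (\<lambda>m. sh m $ \<mu>) holomorphic_on Uh) \<and>
     (\<forall>l\<in>overlap U Uh. sh (inverse l) = patch \<epsilon> f l (s l))}"

text \<open>The coordinates read off from \<open>\<Omega>\<^sup>A| = x\<^bsup>A1'\<^esup> + x\<^bsup>A0'\<^esup> \<lambda>\<close> and
  \<open>T| = t - \<epsilon> (\<Sum>n\<ge>1. \<gamma>\<^sub>n \<lambda>^n)\<close>.\<close>

definition moduli_coords :: "(complex \<Rightarrow> fibre_pt) \<times> (complex \<Rightarrow> fibre_pt) \<Rightarrow> moduli_pt" where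
  "moduli_coords = (\<lambda>(s, sh). \<chi> i. case i of
       None \<Rightarrow> s 0 $ None
     | Some (A, A') \<Rightarrow> if A' = 1 then s 0 $ Some A else deriv (\<lambda>l. s l $ Some A) 0)"

definition section_at ::
    "complex set \<Rightarrow> complex set \<Rightarrow> complex \<Rightarrow> (complex ^ 2 \<Rightarrow> complex \<Rightarrow> complex) \<Rightarrow> moduli_pt \<Rightarrow>
     (complex \<Rightarrow> fibre_pt) \<times> (complex \<Rightarrow> fibre_pt)" where
  "section_at U Uh \<epsilon> f x = inv_into (global_sections U Uh \<epsilon> f) moduli_coords x"

text \<open>The restrictions \<open>w|\<close> and \<open>\<hat>w|\<close> to the section \<open>X\<^sub>x\<close>; the last argument is \<open>\<lambda>\<close>,
  respectively \<open>1/\<lambda>\<close>.\<close>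

definition w_res ::
    "complex set \<Rightarrow> complex set \<Rightarrow> complex \<Rightarrow> (complex ^ 2 \<Rightarrow> complex \<Rightarrow> complex) \<Rightarrow> moduli_pt \<Rightarrow>
     complex \<Rightarrow> fibre_pt" where
  "w_res U Uh \<epsilon> f x l = fst (section_at U Uh \<epsilon> f x) l"

definition wh_res ::
    "complex set \<Rightarrow> complex set \<Rightarrow> complex \<Rightarrow> (complex ^ 2 \<Rightarrow> complex \<Rightarrow> complex) \<Rightarrow> moduli_pt \<Rightarrow>
     complex \<Rightarrow> fibre_pt" where
  "wh_res U Uh \<epsilon> f x m = snd (section_at U Uh \<epsilon> f x) m"

definition dw_res ::
    "complex set \<Rightarrow> complex set \<Rightarrow> complex \<Rightarrow> (complex ^ 2 \<Rightarrow> complex \<Rightarrow> complex) \<Rightarrow> moduli_pt \<Rightarrow>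
     complex \<Rightarrow> complex ^ moduli_ix ^ (2 option)" where
  "dw_res U Uh \<epsilon> f x l = (\<chi> \<mu> a. cpartial a (\<lambda>y. w_res U Uh \<epsilon> f y l $ \<mu>) x)"


section \<open>The normal bundle\<close>

definition normal_patching ::
    "complex set \<Rightarrow> complex set \<Rightarrow> complex \<Rightarrow> (complex ^ 2 \<Rightarrow> complex \<Rightarrow> complex) \<Rightarrow> moduli_pt \<Rightarrow>
     complex \<Rightarrow> complex ^ (2 option) ^ (2 option)" where
  "normal_patching U Uh \<epsilon> f x l =
     (\<chi> \<mu> \<nu>. cpartial \<nu> (\<lambda>w. patch \<epsilon> f l w $ \<mu>) (w_res U Uh \<epsilon> f x l))"

definition normal_sections ::
    "complex set \<Rightarrow> complex set \<Rightarrow> complex \<Rightarrow> (complex ^ 2 \<Rightarrow> complex \<Rightarrow> complex) \<Rightarrow> moduli_pt \<Rightarrow>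
     ((complex \<Rightarrow> fibre_pt) \<times> (complex \<Rightarrow> fibre_pt)) set" where
  "normal_sections U Uh \<epsilon> f x = {(s, sh).
     s \<in> extensional U \<and> sh \<in> extensional Uh \<and>
     (\<forall>\<mu>. (\<lambda>l. s l $ \<mu>) holomorphic_on U) \<and> (\<forall>\<mu>. (\<lambda>m. sh m $ \<mu>) holomorphic_on Uh) \<and>
     (\<forall>l\<in>overlap U Uh. sh (inverse l) = normal_patching U Uh \<epsilon> f x l *v s l)}"

text \<open>The tangent space of the moduli space at \<open>x\<close> is the space of sections of the normal bundle,
  as in Kodaira's theorem.\<close>

definition kodaira_iso_at ::
    "complex set \<Rightarrow> complex set \<Rightarrow> complex \<Rightarrow> (complex ^ 2 \<Rightarrow> complex \<Rightarrow> complex) \<Rightarrow> moduli_pt \<Rightarrow> bool" where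
  "kodaira_iso_at U Uh \<epsilon> f x \<longleftrightarrow>
     bij_betw (\<lambda>v. restrict (\<lambda>l. dw_res U Uh \<epsilon> f x l *v v) U) UNIV
       (fst ` normal_sections U Uh \<epsilon> f x)"

definition model_patching :: "complex \<Rightarrow> complex ^ (2 option) ^ (2 option)" where
  "model_patching l =
     (\<chi> \<mu> \<nu>. if \<mu> = \<nu> then (case \<mu> of None \<Rightarrow> 1 | Some A \<Rightarrow> inverse l) else 0)"

text \<open>\<open>(H, Hh)\<close> trivialises the normal bundles of all the sections as \<open>\<O> \<oplus> \<O>(1) \<oplus> \<O>(1)\<close>,
  holomorphically in the moduli.\<close>

definition normal_splitting ::
    "complex set \<Rightarrow> complex set \<Rightarrow> complex \<Rightarrow> (complex ^ 2 \<Rightarrow> complex \<Rightarrow> complex) \<Rightarrow>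
     (moduli_pt \<Rightarrow> complex \<Rightarrow> complex ^ (2 option) ^ (2 option)) \<Rightarrow>
     (moduli_pt \<Rightarrow> complex \<Rightarrow> complex ^ (2 option) ^ (2 option)) \<Rightarrow> bool" where
  "normal_splitting U Uh \<epsilon> f H Hh \<longleftrightarrow>
     (\<forall>\<mu> \<nu>. jointly_holomorphic_on (\<lambda>x l. H x l $ \<mu> $ \<nu>) (UNIV \<times> U)) \<and>
     (\<forall>\<mu> \<nu>. jointly_holomorphic_on (\<lambda>x m. Hh x m $ \<mu> $ \<nu>) (UNIV \<times> Uh)) \<and>
     (\<forall>x. \<forall>l\<in>U. invertible (H x l)) \<and> (\<forall>x. \<forall>m\<in>Uh. invertible (Hh x m)) \<and>
     (\<forall>x. \<forall>l\<in>overlap U Uh. normal_patching U Uh \<epsilon> f x l =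
         Hh x (inverse l) ** model_patching l ** matrix_inv (H x l))"


section \<open>Galilean structures\<close>

text \<open>The moduli space is identified with \<open>\<complex>\<^sup>5\<close> by \<open>moduli_coords\<close>. One-forms and vector
  fields on it are given by their components in these coordinates, two-forms and two-tensors by
  their matrices of components.\<close>

definition galilean_structure ::
    "(moduli_pt \<Rightarrow> complex ^ moduli_ix ^ moduli_ix) \<Rightarrow> (moduli_pt \<Rightarrow> moduli_pt) \<Rightarrow> bool" where
  "galilean_structure h \<theta> \<longleftrightarrow>
     (\<forall>a b. holomorphic_vec_on (\<lambda>x. h x $ a $ b) UNIV) \<and>
     (\<forall>a. holomorphic_vec_on (\<lambda>x. \<theta> x $ a) UNIV) \<and>
     (\<forall>x. transpose (h x) = h x \<and> rank (h x) = 4 \<and> {\<alpha>. h x *v \<alpha> = 0} = range (\<lambda>c. c *s \<theta> x))"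

definition skew :: "2 \<Rightarrow> 2 \<Rightarrow> complex" where
  "skew A B = (if A = B then 0 else if A = 0 then 1 else -1)"

text \<open>\<open>e A A'\<close> is the one-form \<open>e\<^bsup>AA'\<^esup>\<close>; the row \<open>None\<close> of \<open>v = H\<^sup>-\<^sup>1 dw|\<close> is the clock and the
  row \<open>Some A\<close> is \<open>e\<^bsup>A1'\<^esup> + e\<^bsup>A0'\<^esup> \<lambda>\<close>.\<close>

definition frame_components ::
    "complex set \<Rightarrow> complex set \<Rightarrow> complex \<Rightarrow> (complex ^ 2 \<Rightarrow> complex \<Rightarrow> complex) \<Rightarrow>
     (moduli_pt \<Rightarrow> complex \<Rightarrow> complex ^ (2 option) ^ (2 option)) \<Rightarrow>
     (moduli_pt \<Rightarrow> moduli_pt) \<Rightarrow> (2 \<Rightarrow> 2 \<Rightarrow> moduli_pt \<Rightarrow> moduli_pt) \<Rightarrow> bool" where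
  "frame_components U Uh \<epsilon> f H \<theta> e \<longleftrightarrow>
     (\<forall>x. \<forall>l\<in>U. let v = matrix_inv (H x l) ** dw_res U Uh \<epsilon> f x l in
        v $ None = \<theta> x \<and> (\<forall>A. v $ Some A = e A 1 x + l *s e A 0 x))"

definition covariant_metric :: "(2 \<Rightarrow> 2 \<Rightarrow> moduli_pt \<Rightarrow> moduli_pt) \<Rightarrow> moduli_pt \<Rightarrow> complex ^ moduli_ix ^ moduli_ix" where
  "covariant_metric e x = (\<chi> a b. \<Sum>A\<in>UNIV. \<Sum>B\<in>UNIV. \<Sum>A'\<in>UNIV. \<Sum>B'\<in>UNIV.
      skew A B * skew A' B' * e A A' x $ a * e B B' x $ b)"

definition rest_field ::
    "(moduli_pt \<Rightarrow> moduli_pt) \<Rightarrow> (moduli_pt \<Rightarrow> complex ^ moduli_ix ^ moduli_ix) \<Rightarrow> (moduli_pt \<Rightarrow> moduli_pt) \<Rightarrow> bool" where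
  "rest_field \<theta> g u \<longleftrightarrow> (\<forall>x. (\<Sum>a\<in>UNIV. \<theta> x $ a * u x $ a) = 1 \<and> g x *v u x = 0)"

definition projective_inverse ::
    "(moduli_pt \<Rightarrow> moduli_pt) \<Rightarrow> (moduli_pt \<Rightarrow> moduli_pt) \<Rightarrow> (moduli_pt \<Rightarrow> complex ^ moduli_ix ^ moduli_ix) \<Rightarrow>
     (moduli_pt \<Rightarrow> complex ^ moduli_ix ^ moduli_ix) \<Rightarrow> bool" where
  "projective_inverse \<theta> u g h \<longleftrightarrow>
     (\<forall>x. h x ** g x = mat 1 - (\<chi> a c. u x $ a * \<theta> x $ c) \<and> h x *v \<theta> x = 0)"

definition frame_induces ::
    "complex set \<Rightarrow> complex set \<Rightarrow> complex \<Rightarrow> (complex ^ 2 \<Rightarrow> complex \<Rightarrow> complex) \<Rightarrow>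
     (moduli_pt \<Rightarrow> complex \<Rightarrow> complex ^ (2 option) ^ (2 option)) \<Rightarrow>
     (moduli_pt \<Rightarrow> complex ^ moduli_ix ^ moduli_ix) \<Rightarrow> (moduli_pt \<Rightarrow> moduli_pt) \<Rightarrow> bool" where
  "frame_induces U Uh \<epsilon> f H h \<theta> \<longleftrightarrow>
     (\<exists>e u. frame_components U Uh \<epsilon> f H \<theta> e \<and>
        rest_field \<theta> (covariant_metric e) u \<and> projective_inverse \<theta> u (covariant_metric e) h)"


section \<open>The torsion of the clock\<close>

definition ext_deriv :: "(complex ^ 'n \<Rightarrow> complex ^ 'n) \<Rightarrow> complex ^ 'n \<Rightarrow> complex ^ 'n ^ 'n" where
  "ext_deriv \<theta> x = (\<chi> a b. cpartial a (\<lambda>y. \<theta> y $ b) x - cpartial b (\<lambda>y. \<theta> y $ a) x)"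

definition wedge :: "complex ^ 'n \<Rightarrow> complex ^ 'n \<Rightarrow> complex ^ 'n ^ 'n" where
  "wedge \<alpha> \<beta> = (\<chi> a b. \<alpha> $ a * \<beta> $ b - \<alpha> $ b * \<beta> $ a)"

definition dx :: "2 \<Rightarrow> 2 \<Rightarrow> moduli_pt" where
  "dx A A' = axis (Some (A, A')) 1"

text \<open>\<open>f\<close> as a function of weight zero of the homogeneous coordinates \<open>(\<omega>\<^sup>A, \<pi>\<^sub>A\<^sub>')\<close>.\<close>

definition homog :: "(complex ^ 2 \<Rightarrow> complex \<Rightarrow> complex) \<Rightarrow> complex ^ 2 \<Rightarrow> complex ^ 2 \<Rightarrow> complex" where
  "homog f \<omega> \<pi> = f (\<chi> A. \<omega> $ A / \<pi> $ 1) (\<pi> $ 0 / \<pi> $ 1)"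

definition omega_res :: "moduli_pt \<Rightarrow> complex ^ 2 \<Rightarrow> complex ^ 2" where
  "omega_res x \<pi> = (\<chi> A. \<Sum>A'\<in>UNIV. x $ Some (A, A') * \<pi> $ A')"

text \<open>Homogeneous coordinates \<open>\<pi> l\<close> for the points of a subset of \<open>\<P>\<^sup>1\<close>.\<close>

definition homogeneous_lift :: "complex set \<Rightarrow> (complex \<Rightarrow> complex ^ 2) \<Rightarrow> bool" where
  "homogeneous_lift S \<pi> \<longleftrightarrow> (\<forall>l\<in>S. \<pi> l $ 1 \<noteq> 0 \<and> \<pi> l $ 0 / \<pi> l $ 1 = l)"

text \<open>The factor \<open>(\<pi> l $ 1)\<^sup>2\<close> comes from \<open>\<pi>\<cdot>d\<pi> = \<pi>\<^sub>1\<^sub>'\<^sup>2 d\<lambda>\<close>.\<close>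

definition torsion_coeff ::
    "(complex ^ 2 \<Rightarrow> complex \<Rightarrow> complex) \<Rightarrow> (real \<Rightarrow> complex) \<Rightarrow> (complex \<Rightarrow> complex ^ 2) \<Rightarrow> moduli_pt \<Rightarrow>
     2 \<Rightarrow> 2 \<Rightarrow> 2 \<Rightarrow> complex" where
  "torsion_coeff f c \<pi> x A B B' = 1 / (2 * of_real pi * \<i>) *
     contour_integral c (\<lambda>l.
       cpartial A (cpartial B (\<lambda>\<omega>. homog f \<omega> (\<pi> l))) (omega_res x (\<pi> l)) *
       (\<pi> l $ B' / \<pi> l $ 0) * (\<pi> l $ 1)\<^sup>2)"

definition encircles_zero_once :: "complex set \<Rightarrow> (real \<Rightarrow> complex) \<Rightarrow> bool" where
  "encircles_zero_once S c \<longleftrightarrow> valid_path c \<and> pathfinish c = pathstart c \<and> path_image c \<subseteq> S \<and>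
     winding_number c 0 = 1"

end

theory Submission
  imports Defs
begin

text \<open>
  Restricted to the curves \<open>\<Omega>\<^sup>A = x\<^bsup>A1'\<^esup> + x\<^bsup>A0'\<^esup> \<lambda>\<close>, both \<open>f\<close> and its derivatives
  \<open>\<partial>\<^sub>A f\<close> split as \<open>P(x, \<lambda>) + \<lambda>\<^sup>-\<^sup>1 Q(x, \<lambda>\<^sup>-\<^sup>1)\<close>, jointly holomorphically in all variables.
  By Liouville's theorem on \<open>\<P>\<^sup>1\<close> the splitting of \<open>f\<close> yields all global sections, with
  \<open>T = t - \<epsilon> (P(x, \<lambda>) - P(x, 0))\<close>, and its \<open>x\<close>-derivatives all sections of the normal bundle. The
  splitting \<open>(P'\<^sub>A, Q'\<^sub>A)\<close> of \<open>\<partial>\<^sub>A f\<close> is exactly what trivialises the normal bundle: \<open>H\<close> and its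
  counterpart on the other patch are shears with entries \<open>-\<epsilon> P'\<^sub>A\<close> and \<open>\<epsilon> Q'\<^sub>A\<close>. At \<open>\<lambda> = 0\<close> the
  clock is therefore \<open>dt + \<epsilon> (\<Sum>A. P'\<^sub>A(x, 0) dx\<^bsup>A1'\<^esup>)\<close>, and since \<open>2\<pi>\<i> P'\<^sub>A(x, 0)\<close> is the contour
  integral of \<open>\<partial>\<^sub>A f / \<lambda>\<close>, differentiating it gives the torsion. For an arbitrary \<open>H\<close> Liouville's
  theorem makes \<open>H\<^sup>-\<^sup>1 dw\<close> constant, respectively linear, in \<open>\<lambda>\<close>; its coefficients form an invertible
  \<open>5 \<times> 5\<close> matrix \<open>E\<close>, the covariant metric is \<open>E\<^sup>T S E\<close> for a constant symmetric \<open>S\<close> with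
  \<open>S\<^sup>2 = 1 - e e\<^sup>T\<close>, where \<open>e\<close> is the time axis, and hence \<open>h = E\<^sup>-\<^sup>1 S E\<^sup>-\<^sup>T\<close>.
\<close>

section \<open>Holomorphic functions of several variables\<close>

text \<open>The scalings \<open>sA\<close> and \<open>sB\<close> stand for multiplication by complex scalars, so that the same
  notion serves for vectors and for pairs of a vector and a number, whose types carry only a real
  structure.\<close>

definition holo ::
    "(complex \<Rightarrow> 'a::real_normed_vector \<Rightarrow> 'a) \<Rightarrow> (complex \<Rightarrow> 'b::real_normed_vector \<Rightarrow> 'b) \<Rightarrow>
     ('a \<Rightarrow> 'b) \<Rightarrow> 'a set \<Rightarrow> bool" where
  "holo sA sB F S \<longleftrightarrow>
     (\<forall>p\<in>S. \<exists>D. (F has_derivative D) (at p) \<and> (\<forall>c v. D (sA c v) = sB c (D v)))"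

abbreviation "holoc sA \<equiv> holo sA ((*) :: complex \<Rightarrow> complex \<Rightarrow> complex)"

lemma holoE:
  assumes "holo sA sB F S" "p \<in> S"
  obtains D where "(F has_derivative D) (at p)" "\<And>c v. D (sA c v) = sB c (D v)"
  using assms unfolding holo_def by blast

lemma holo_transform_open:
  assumes "holo sA sB F S" "open S" "\<And>p. p \<in> S \<Longrightarrow> F p = G p"
  shows "holo sA sB G S"
  unfolding holo_def
proof
  fix p assume p: "p \<in> S"
  obtain D where D: "(F has_derivative D) (at p)" "\<And>c v. D (sA c v) = sB c (D v)"
    using holoE[OF assms(1) p] by blast
  have "(G has_derivative D) (at p)"
    by (rule has_derivative_transform_within_open[OF D(1) assms(2) p assms(3)])
  then show "\<exists>D. (G has_derivative D) (at p) \<and> (\<forall>c v. D (sA c v) = sB c (D v))"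
    using D(2) by blast
qed

lemma holo_Un: "holo sA sB F S \<Longrightarrow> holo sA sB F T \<Longrightarrow> holo sA sB F (S \<union> T)"
  unfolding holo_def by blast

lemma holo_compose:
  assumes "holo sA sB F S" "holo sB sC G T" "F ` S \<subseteq> T"
  shows "holo sA sC (\<lambda>x. G (F x)) S"
  unfolding holo_def
proof
  fix p assume p: "p \<in> S"
  obtain D where D: "(F has_derivative D) (at p)" "\<And>c v. D (sA c v) = sB c (D v)"
    using holoE[OF assms(1) p] by blast
  have "F p \<in> T" using p assms(3) by blast
  then obtain E where E: "(G has_derivative E) (at (F p))" "\<And>c v. E (sB c v) = sC c (E v)"
    using holoE[OF assms(2)] by blast
  have "((\<lambda>x. G (F x)) has_derivative (\<lambda>v. E (D v))) (at p)"
    by (rule has_derivative_compose[OF D(1) E(1)])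
  then show "\<exists>D. ((\<lambda>x. G (F x)) has_derivative D) (at p) \<and> (\<forall>c v. D (sA c v) = sC c (D v))"
    using D(2) E(2) by (intro exI[of _ "\<lambda>v. E (D v)"]) simp
qed

lemma holo_imp_continuous_on: "holo sA sB F S \<Longrightarrow> continuous_on S F"
  unfolding holo_def
  by (meson continuous_at_imp_continuous_on has_derivative_continuous)

lemma holoc_const: "holoc sA (\<lambda>_. k) S"
  unfolding holo_def by (intro ballI exI[of _ "\<lambda>_. 0"]) auto

lemma holoc_add:
  assumes "holoc sA F S" "holoc sA G S"
  shows "holoc sA (\<lambda>x. F x + G x) S"
  unfolding holo_def
proof
  fix p assume p: "p \<in> S"
  obtain D where D: "(F has_derivative D) (at p)" "\<And>c v. D (sA c v) = c * D v"
    using holoE[OF assms(1) p] by blast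
  obtain E where E: "(G has_derivative E) (at p)" "\<And>c v. E (sA c v) = c * E v"
    using holoE[OF assms(2) p] by blast
  show "\<exists>D. ((\<lambda>x. F x + G x) has_derivative D) (at p) \<and> (\<forall>c v. D (sA c v) = c * D v)"
    using has_derivative_add[OF D(1) E(1)] D(2) E(2)
    by (intro exI[of _ "\<lambda>v. D v + E v"]) (simp add: algebra_simps)
qed

lemma holoc_mult:
  assumes "holoc sA F S" "holoc sA G S"
  shows "holoc sA (\<lambda>x. F x * G x) S"
  unfolding holo_def
proof
  fix p assume p: "p \<in> S"
  obtain D where D: "(F has_derivative D) (at p)" "\<And>c v. D (sA c v) = c * D v"
    using holoE[OF assms(1) p] by blast
  obtain E where E: "(G has_derivative E) (at p)" "\<And>c v. E (sA c v) = c * E v"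
    using holoE[OF assms(2) p] by blast
  show "\<exists>D. ((\<lambda>x. F x * G x) has_derivative D) (at p) \<and> (\<forall>c v. D (sA c v) = c * D v)"
    using has_derivative_mult[OF D(1) E(1)] D(2) E(2)
    by (intro exI[of _ "\<lambda>v. F p * E v + D v * G p"]) (simp add: algebra_simps)
qed

lemma holoc_cmult: "holoc sA F S \<Longrightarrow> holoc sA (\<lambda>x. k * F x) S"
  by (rule holoc_mult[OF holoc_const])

lemma holoc_diff:
  assumes "holoc sA F S" "holoc sA G S"
  shows "holoc sA (\<lambda>x. F x - G x) S"
  using holoc_add[OF assms(1) holoc_cmult[OF assms(2), of "-1"]] by simp

lemma holoc_sum:
  "(\<And>i. i \<in> I \<Longrightarrow> holoc sA (F i) S) \<Longrightarrow> holoc sA (\<lambda>x. \<Sum>i\<in>I. F i x) S"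
  by (induction I rule: infinite_finite_induct) (auto intro: holoc_const holoc_add)

lemma holoc_prod:
  "(\<And>i. i \<in> I \<Longrightarrow> holoc sA (F i) S) \<Longrightarrow> holoc sA (\<lambda>x. \<Prod>i\<in>I. F i x) S"
  by (induction I rule: infinite_finite_induct) (auto intro: holoc_const holoc_mult)

lemma holoc_holomorphic_iff:
  assumes "open S"
  shows "holoc (*) F S \<longleftrightarrow> F holomorphic_on S"
proof
  assume F: "holoc (*) F S"
  show "F holomorphic_on S"
    unfolding holomorphic_on_def field_differentiable_def
  proof
    fix p assume p: "p \<in> S"
    obtain D where D: "(F has_derivative D) (at p)" "\<And>c v. D (c * v) = c * D v"
      by (rule holoE[OF F p]) (rule that)
    have "D = (*) (D 1)"
    proof
      fix c show "D c = D 1 * c" using D(2)[of c 1] by (metis mult.commute mult_1_right)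
    qed
    then have "(F has_field_derivative D 1) (at p)"
      using D(1) unfolding has_field_derivative_def by simp
    then show "\<exists>f'. (F has_field_derivative f') (at p within S)"
      using has_field_derivative_at_within by blast
  qed
next
  assume F: "F holomorphic_on S"
  show "holoc (*) F S"
    unfolding holo_def
  proof
    fix p assume "p \<in> S"
    then have "(F has_field_derivative deriv F p) (at p)"
      using F assms holomorphic_derivI by blast
    then show "\<exists>D. (F has_derivative D) (at p) \<and> (\<forall>c v. D (c * v) = c * D v)"
      unfolding has_field_derivative_def by (intro exI[of _ "(*) (deriv F p)"]) simp
  qed
qed

lemma holoc_inverse:
  assumes "holoc sA F S" "\<And>p. p \<in> S \<Longrightarrow> F p \<noteq> 0"
  shows "holoc sA (\<lambda>x. inverse (F x)) S"
proof (rule holo_compose[OF assms(1)])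
  show "holoc (*) inverse (-{0::complex})"
    by (subst holoc_holomorphic_iff) (auto intro!: holomorphic_intros)
  show "F ` S \<subseteq> - {0}" using assms(2) by auto
qed

lemma holoc_divide:
  assumes "holoc sA F S" "holoc sA G S" "\<And>p. p \<in> S \<Longrightarrow> G p \<noteq> 0"
  shows "holoc sA (\<lambda>x. F x / G x) S"
  using holoc_mult[OF assms(1) holoc_inverse[OF assms(2,3)]] by (simp add: divide_inverse)

lemma has_contour_integral_circlepath_exp:
  assumes "(h has_contour_integral I) (circlepath 0 d)"
  shows "((\<lambda>t. h (d * exp (2 * pi * \<i> * of_real t)) * (d * exp (2 * pi * \<i> * of_real t)))
     has_integral I / (2 * pi * \<i>)) (cbox 0 1)"
proof -
  from assms have "((\<lambda>t. h (circlepath 0 d t) * vector_derivative (circlepath 0 d) (at t within {0..1}))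
      has_integral I) {0..1}"
    by (simp add: has_contour_integral_def)
  then have "((\<lambda>t. h (circlepath 0 d t) * (2 * pi * \<i> * d * exp (2 * of_real pi * \<i> * of_real t)))
      has_integral I) {0..1}"
    by (rule has_integral_eq[rotated]) (simp add: vector_derivative_circlepath01)
  then have "((\<lambda>t. (2 * pi * \<i>) * (h (circlepath 0 d t) * (circlepath 0 d t)))
      has_integral (2 * pi * \<i>) * (I / (2 * pi * \<i>))) {0..1}"
    by (rule has_integral_eq[rotated, OF has_integral_eq_rhs]) (simp_all add: circlepath)
  then have "((\<lambda>t. h (circlepath 0 d t) * circlepath 0 d t) has_integral I / (2 * pi * \<i>)) {0..1}"
    by (subst (asm) has_integral_mult_right_iff) auto
  then show ?thesis
    by (simp add: circlepath)
qed

locale complex_scaling =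
  fixes sc :: "complex \<Rightarrow> 'a::euclidean_space \<Rightarrow> 'a"
  assumes bilinear: "bounded_bilinear sc"
    and scale_of_real: "sc (of_real r) v = r *\<^sub>R v"
begin

definition dird :: "('a \<Rightarrow> complex) \<Rightarrow> 'a \<Rightarrow> 'a \<Rightarrow> complex" where
  "dird F v p = deriv (\<lambda>s. F (p + sc s v)) 0"

lemma line_has_derivative:
  assumes "(F has_derivative D) (at (p + sc s0 v))" "\<And>c v. D (sc c v) = c * D v"
  shows "((\<lambda>s. F (p + sc s v)) has_field_derivative D v) (at s0)"
proof -
  have "((\<lambda>s. p + sc s v) has_derivative (\<lambda>s. sc s v)) (at s0)"
    using bounded_linear_imp_has_derivative[OF bounded_bilinear.bounded_linear_left[OF bilinear]]
    by (auto intro!: derivative_eq_intros)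
  from has_derivative_compose[OF this assms(1)]
  show ?thesis
    unfolding has_field_derivative_def assms(2)
    by (rule has_derivative_eq_rhs) (simp add: fun_eq_iff mult.commute)
qed

lemma sc_zero: "sc 0 v = 0"
  using scale_of_real[of 0] by simp

lemma dird_eq:
  assumes "(F has_derivative D) (at p)" "\<And>c v. D (sc c v) = c * D v"
  shows "dird F v p = D v"
  unfolding dird_def
  by (rule DERIV_imp_deriv[OF line_has_derivative]) (use assms in \<open>simp_all add: sc_zero\<close>)

lemma holoc_has_dird:
  assumes "holoc sc F S" "p \<in> S"
  shows "(F has_derivative (\<lambda>v. dird F v p)) (at p)" "\<And>c v. dird F (sc c v) p = c * dird F v p"
proof -
  obtain D where D: "(F has_derivative D) (at p)" "\<And>c v. D (sc c v) = c * D v"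
    using holoE[OF assms] by blast
  have "(\<lambda>v. dird F v p) = D"
    using dird_eq[OF D] by auto
  then show "(F has_derivative (\<lambda>v. dird F v p)) (at p)" "\<And>c v. dird F (sc c v) p = c * dird F v p"
    using D dird_eq[OF D] by auto
qed

lemma sc_continuous_on [continuous_intros]:
  "continuous_on S f \<Longrightarrow> continuous_on S g \<Longrightarrow> continuous_on S (\<lambda>x. sc (f x) (g x))"
  by (rule bounded_bilinear.continuous_on[OF bilinear])

lemma line_holomorphic:
  assumes "holoc sc F S" "\<And>s. s \<in> T \<Longrightarrow> p + sc s v \<in> S"
  shows "(\<lambda>s. F (p + sc s v)) holomorphic_on T"
  unfolding holomorphic_on_def field_differentiable_def
proof
  fix s assume "s \<in> T"
  then have "p + sc s v \<in> S" by (rule assms(2))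
  from line_has_derivative[OF holoc_has_dird[OF assms(1) this]]
  show "\<exists>f'. ((\<lambda>s. F (p + sc s v)) has_field_derivative f') (at s within T)"
    using has_field_derivative_at_within by blast
qed

lemma dird_eq_integral:
  assumes F: "holoc sc F S" and d: "d > 0" and S: "\<And>s. norm s \<le> d \<Longrightarrow> p + sc s v \<in> S" "open S"
  shows "dird F v p =
    integral (cbox 0 1) (\<lambda>t. F (p + sc (d * exp (2 * pi * \<i> * of_real t)) v) / (d * exp (2 * pi * \<i> * of_real t)))"
proof -
  let ?g = "\<lambda>s. F (p + sc s v)"
  have cont: "continuous_on (cball 0 d) ?g"
    by (intro holomorphic_on_imp_continuous_on line_holomorphic[OF F]) (auto intro: S)
  have hol: "?g holomorphic_on ball 0 d"
    by (rule line_holomorphic[OF F]) (auto intro: S)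
  have "((\<lambda>u. ?g u / (u - 0)^(Suc 1)) has_contour_integral ((2 * pi * \<i>) / fact 1) * (deriv ^^ 1) ?g 0)
      (circlepath 0 d)"
    by (rule Cauchy_has_contour_integral_higher_derivative_circlepath[OF cont hol]) (use d in simp)
  then have "((\<lambda>u. ?g u / u^2) has_contour_integral (2 * pi * \<i>) * dird F v p) (circlepath 0 d)"
    by (simp add: dird_def power2_eq_square)
  from has_contour_integral_circlepath_exp[OF this]
  have "((\<lambda>t. ?g (d * exp (2 * pi * \<i> * of_real t)) / (d * exp (2 * pi * \<i> * of_real t)))
      has_integral dird F v p) (cbox 0 1)"
    by (rule has_integral_eq[rotated, OF has_integral_eq_rhs])
       (use d in \<open>simp_all add: power2_eq_square field_simps\<close>)
  then show ?thesis
    by (rule integral_unique[symmetric])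
qed

lemma scaling_room:
  assumes "open S" "p0 \<in> S"
  obtains B where "open B" "convex B" "p0 \<in> B" "B \<subseteq> S"
    "\<And>v. \<exists>d>0. \<forall>p\<in>B. \<forall>s. norm s \<le> d \<longrightarrow> p + sc s v \<in> S"
proof -
  from assms obtain r where r: "r > 0" "ball p0 (2 * r) \<subseteq> S"
    by (metis field_sum_of_halves mult_2 open_contains_ball half_gt_zero)
  obtain K where K: "K > 0" "\<And>c v. norm (sc c v) \<le> norm c * norm v * K"
    using bounded_bilinear.pos_bounded[OF bilinear] by blast
  show thesis
  proof
    show "p0 \<in> ball p0 r" "ball p0 r \<subseteq> S" using r by auto
    fix v :: 'a
    define d where "d = r / (K * (norm v + 1))"
    have "p + sc s v \<in> S" if "p \<in> ball p0 r" "norm s \<le> d" for p s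
    proof -
      have "norm (sc s v) \<le> norm s * (norm v * K)" using K(2)[of s v] by (simp add: mult.assoc)
      also have "\<dots> \<le> d * ((norm v + 1) * K)"
        using that(2) K(1) by (intro mult_mono) (auto intro: order_trans[OF norm_ge_zero])
      also have "\<dots> = r"
        using K(1) by (simp add: d_def add_nonneg_eq_0_iff)
      finally have "norm (sc s v) \<le> r" .
      moreover have "norm (p - p0) < r" using that(1) by (simp add: dist_norm norm_minus_commute)
      ultimately have "norm (p + sc s v - p0) < 2 * r"
        using norm_triangle_ineq[of "p - p0" "sc s v"] by (simp add: algebra_simps)
      then show ?thesis using r by (auto simp: dist_norm norm_minus_commute)
    qed
    moreover have "d > 0" using r K by (simp add: d_def add_nonneg_pos)
    ultimately show "\<exists>d>0. \<forall>p\<in>ball p0 r. \<forall>s. norm s \<le> d \<longrightarrow> p + sc s v \<in> S" by blast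
  qed auto
qed

text \<open>Cauchy's formula in the complex lines makes the derivatives continuous, so that
  differentiation under the integral sign is legitimate.\<close>

lemma has_derivative_integral:
  fixes F :: "'a \<Rightarrow> real \<Rightarrow> complex"
  assumes S: "open S"
    and cont: "continuous_on (S \<times> cbox 0 1) (\<lambda>(p, t). F p t)"
    and hol: "\<And>t. t \<in> cbox 0 1 \<Longrightarrow> holoc sc (\<lambda>p. F p t) S"
    and p0: "p0 \<in> S"
  shows "((\<lambda>p. integral (cbox 0 1) (F p)) has_derivative
    (\<lambda>v. integral (cbox 0 1) (\<lambda>t. dird (\<lambda>p. F p t) v p0))) (at p0)"
proof -
  from scaling_room[OF S p0] obtain B where B: "open B" "convex B" and pB: "p0 \<in> B" and BS: "B \<subseteq> S"
    and room: "\<And>v. \<exists>d>0. \<forall>p\<in>B. \<forall>s. norm s \<le> d \<longrightarrow> p + sc s v \<in> S" by blast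
  have contD: "continuous_on (B \<times> cbox 0 1) (\<lambda>(p, t). dird (\<lambda>p. F p t) v p)" for v
  proof -
    obtain d where d: "d > 0" and near: "\<And>p s. p \<in> B \<Longrightarrow> norm s \<le> d \<Longrightarrow> p + sc s v \<in> S"
      using room[of v] by blast
    let ?e = "\<lambda>\<tau>::real. d * exp (2 * pi * \<i> * of_real \<tau>)"
    have ne: "norm (?e \<tau>) \<le> d" for \<tau>
      using d by (simp add: norm_mult)
    have "continuous_on ((B \<times> cbox 0 1) \<times> cbox 0 1)
        (\<lambda>q. (\<lambda>(p, t). F p t) (fst (fst q) + sc (?e (snd q)) v, snd (fst q)) / ?e (snd q))"
    proof (intro continuous_on_divide)
      show "continuous_on ((B \<times> cbox 0 1) \<times> cbox 0 1)
        (\<lambda>q. (\<lambda>(p, t). F p t) (fst (fst q) + sc (?e (snd q)) v, snd (fst q)))"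
      proof (rule continuous_on_compose2[OF cont])
        show "continuous_on ((B \<times> cbox 0 1) \<times> cbox 0 1) (\<lambda>q. (fst (fst q) + sc (?e (snd q)) v, snd (fst q)))"
          by (intro continuous_intros)
        show "(\<lambda>q. (fst (fst q) + sc (?e (snd q)) v, snd (fst q))) ` ((B \<times> cbox 0 1) \<times> cbox 0 1) \<subseteq> S \<times> cbox 0 1"
          using near ne by auto
      qed
    qed (use d in \<open>auto intro!: continuous_intros\<close>)
    then have "continuous_on (B \<times> cbox 0 1)
        (\<lambda>pt. integral (cbox 0 1) (\<lambda>\<tau>. F (fst pt + sc (?e \<tau>) v) (snd pt) / ?e \<tau>))"
      by (intro integral_continuous_on_param) (simp add: split_beta)
    then show ?thesis
    proof (rule continuous_on_eq)
      fix pt assume "pt \<in> B \<times> cbox 0 (1::real)"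
      then have "fst pt \<in> B" "snd pt \<in> cbox 0 1" by auto
      with dird_eq_integral[OF hol d _ S, of "snd pt" "fst pt" v] near[of "fst pt"]
      show "integral (cbox 0 1) (\<lambda>\<tau>. F (fst pt + sc (?e \<tau>) v) (snd pt) / ?e \<tau>) =
          (\<lambda>(p, t). dird (\<lambda>p. F p t) v p) pt"
        by (simp add: split_beta)
    qed
  qed
  define fx where "fx p t = Blinfun (\<lambda>v. dird (\<lambda>p. F p t) v p)" for p t
  have fx: "blinfun_apply (fx p t) = (\<lambda>v. dird (\<lambda>p. F p t) v p)" if "p \<in> B" "t \<in> cbox 0 1" for p t
    unfolding fx_def
    by (rule bounded_linear_Blinfun_apply)
       (use holoc_has_dird(1)[OF hol[OF that(2)]] BS that in \<open>auto dest: has_derivative_bounded_linear\<close>)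
  have contfx: "continuous_on (B \<times> cbox 0 1) (\<lambda>(p, t). fx p t)"
  proof (rule continuous_on_blinfun_componentwise)
    fix i :: 'a
    show "continuous_on (B \<times> cbox 0 1) (\<lambda>x. blinfun_apply (case x of (p, t) \<Rightarrow> fx p t) i)"
      by (rule continuous_on_eq[OF contD[of i]]) (auto simp: fx)
  qed
  have leib: "((\<lambda>p. integral (cbox 0 1) (F p)) has_derivative blinfun_apply (integral (cbox 0 1) (fx p0)))
      (at p0 within B)"
  proof (rule leibniz_rule[OF _ _ contfx pB])
    show "((\<lambda>p. F p t) has_derivative blinfun_apply (fx p t)) (at p within B)"
      if "p \<in> B" "t \<in> cbox 0 1" for p t
      using holoc_has_dird(1)[OF hol[OF that(2)]] BS that fx[OF that]
      by (auto intro: has_derivative_at_withinI)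
    show "F p integrable_on cbox 0 1" if "p \<in> B" for p
    proof -
      have "continuous_on (cbox 0 1) (\<lambda>t. (\<lambda>(p, t). F p t) (p, t))"
        by (rule continuous_on_compose2[OF cont]) (use that BS in \<open>auto intro!: continuous_intros\<close>)
      then show ?thesis by (intro integrable_continuous) simp
    qed
  qed (use B in auto)
  have "at p0 within B = at p0"
    by (rule at_within_open[OF pB B(1)])
  with leib have der: "((\<lambda>p. integral (cbox 0 1) (F p)) has_derivative blinfun_apply (integral (cbox 0 1) (fx p0))) (at p0)"
    by simp
  have "continuous_on (cbox 0 1) (\<lambda>t. (\<lambda>(p, t). fx p t) (p0, t))"
    by (rule continuous_on_compose2[OF contfx]) (use pB in \<open>auto intro!: continuous_intros\<close>)
  then have "fx p0 integrable_on cbox 0 1"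
    by (intro integrable_continuous) simp
  then have app: "blinfun_apply (integral (cbox 0 1) (fx p0)) v = integral (cbox 0 1) (\<lambda>t. blinfun_apply (fx p0 t) v)" for v
    by (rule blinfun_apply_integral)
  have "blinfun_apply (integral (cbox 0 1) (fx p0)) = (\<lambda>v. integral (cbox 0 1) (\<lambda>t. dird (\<lambda>p. F p t) v p0))"
    unfolding app[abs_def] by (intro ext integral_cong) (simp add: fx pB)
  with der show ?thesis by simp
qed

lemma holoc_integral:
  fixes F :: "'a \<Rightarrow> real \<Rightarrow> complex"
  assumes S: "open S"
    and cont: "continuous_on (S \<times> cbox 0 1) (\<lambda>(p, t). F p t)"
    and hol: "\<And>t. t \<in> cbox 0 1 \<Longrightarrow> holoc sc (\<lambda>p. F p t) S"
  shows "holoc sc (\<lambda>p. integral (cbox 0 1) (F p)) S"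
    and "p0 \<in> S \<Longrightarrow> dird (\<lambda>p. integral (cbox 0 1) (F p)) v p0 = integral (cbox 0 1) (\<lambda>t. dird (\<lambda>p. F p t) v p0)"
proof -
  have lin: "integral (cbox 0 1) (\<lambda>t. dird (\<lambda>p. F p t) (sc c v) p) =
      c * integral (cbox 0 1) (\<lambda>t. dird (\<lambda>p. F p t) v p)" if "p \<in> S" for p c v
  proof -
    have "integral (cbox 0 1) (\<lambda>t. dird (\<lambda>p. F p t) (sc c v) p) =
        integral (cbox 0 1) (\<lambda>t. c * dird (\<lambda>p. F p t) v p)"
      by (rule integral_cong) (rule holoc_has_dird(2)[OF hol that])
    then show ?thesis by (simp only: integral_mult_right)
  qed
  note der = has_derivative_integral[OF S cont hol]
  show "holoc sc (\<lambda>p. integral (cbox 0 1) (F p)) S"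
    unfolding holo_def using der lin by blast
  show "p0 \<in> S \<Longrightarrow> dird (\<lambda>p. integral (cbox 0 1) (F p)) v p0 = integral (cbox 0 1) (\<lambda>t. dird (\<lambda>p. F p t) v p0)"
    by (rule dird_eq[OF der]) (use lin in auto)
qed

lemma holo_translate: 
  assumes "holoc sc F S" "\<And>p. p \<in> T \<Longrightarrow> p + w \<in> S"
  shows "holoc sc (\<lambda>p. F (p + w)) T"
proof (rule holo_compose[OF _ assms(1)])
  have "((\<lambda>p. p + w) has_derivative (\<lambda>v. v)) (at p)" for p
    by (auto intro!: derivative_eq_intros)
  then show "holo sc sc (\<lambda>p. p + w) T"
    unfolding holo_def by (intro ballI exI[of _ "\<lambda>v. v"]) auto
qed (use assms in auto)

lemma dird_translate: "dird (\<lambda>p. F (p + w)) v p = dird F v (p + w)"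
  by (simp add: dird_def add_ac)

lemma dird_divide:
  assumes "holoc sc F S" "p \<in> S"
  shows "dird (\<lambda>p. F p / k) v p = dird F v p / k"
proof -
  have "((\<lambda>p. F p * inverse k) has_derivative (\<lambda>v. dird F v p * inverse k)) (at p)"
    by (rule has_derivative_mult_left[OF holoc_has_dird(1)[OF assms]])
  then show ?thesis
    unfolding divide_inverse by (rule dird_eq) (simp add: holoc_has_dird(2)[OF assms])
qed

lemma dird_circle_formula:
  assumes S: "open S" and p0: "p0 \<in> S"
  obtains B and e :: "real \<Rightarrow> complex" where "open B" "p0 \<in> B" "continuous_on UNIV e" "\<And>t. e t \<noteq> 0"
    "\<And>p t. p \<in> B \<Longrightarrow> p + sc (e t) v \<in> S"
    "\<And>G p. holoc sc G S \<Longrightarrow> p \<in> B \<Longrightarrow> dird G v p = integral (cbox 0 1) (\<lambda>t. G (p + sc (e t) v) / e t)"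
proof -
  from scaling_room[OF S p0] obtain B where B: "open B" "p0 \<in> B"
    and room: "\<And>v. \<exists>d>0. \<forall>p\<in>B. \<forall>s. norm s \<le> d \<longrightarrow> p + sc s v \<in> S" by metis
  obtain d where d: "d > 0" and near: "\<And>p s. p \<in> B \<Longrightarrow> norm s \<le> d \<Longrightarrow> p + sc s v \<in> S"
    using room[of v] by blast
  show thesis
  proof (rule that[OF B])
    let ?e = "\<lambda>\<tau>::real. d * exp (2 * pi * \<i> * of_real \<tau>)"
    show "continuous_on UNIV ?e" by (intro continuous_intros)
    show "?e t \<noteq> 0" for t using d by simp
    show "p + sc (?e t) v \<in> S" if "p \<in> B" for p t
      by (rule near[OF that]) (use d in \<open>simp add: norm_mult\<close>)
    show "dird G v p = integral (cbox 0 1) (\<lambda>t. G (p + sc (?e t) v) / ?e t)"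
      if "holoc sc G S" "p \<in> B" for G p
      by (rule dird_eq_integral[OF that(1) d _ S]) (rule near[OF that(2)])
  qed
qed

lemma circle_integrand:
  assumes F: "holoc sc F S" and e: "continuous_on UNIV e" "\<And>t. e t \<noteq> 0"
    and room: "\<And>p t. p \<in> B \<Longrightarrow> p + sc (e t) v \<in> S"
  shows "continuous_on (B \<times> cbox 0 (1::real)) (\<lambda>(p, t). F (p + sc (e t) v) / e t)"
    and "holoc sc (\<lambda>p. F (p + sc (e t) v)) B" "holoc sc (\<lambda>p. F (p + sc (e t) v) / e t) B"
proof -
  have e': "continuous_on A (\<lambda>q. e (snd q))" for A :: "('a \<times> real) set"
    by (rule continuous_on_compose2[OF e(1)]) (auto intro: continuous_intros)
  have "continuous_on (B \<times> cbox 0 1) (\<lambda>q. F (fst q + sc (e (snd q)) v))"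
    by (rule continuous_on_compose2[OF holo_imp_continuous_on[OF F]])
       (use room in \<open>auto intro!: continuous_intros e'\<close>)
  then have "continuous_on (B \<times> cbox 0 1) (\<lambda>q. F (fst q + sc (e (snd q)) v) / e (snd q))"
    by (rule continuous_on_divide[OF _ e']) (use e in auto)
  then show "continuous_on (B \<times> cbox 0 (1::real)) (\<lambda>(p, t). F (p + sc (e t) v) / e t)"
    by (simp add: split_beta)
  show tr: "holoc sc (\<lambda>p. F (p + sc (e t) v)) B"
    by (rule holo_translate[OF F room])
  show "holoc sc (\<lambda>p. F (p + sc (e t) v) / e t) B"
    by (rule holoc_divide[OF tr holoc_const]) (use e in auto)
qed

lemma holoc_dird:
  assumes F: "holoc sc F S" and S: "open S"
  shows "holoc sc (dird F v) S"
  unfolding holo_def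
proof
  fix p0 assume "p0 \<in> S"
  then obtain B and e :: "real \<Rightarrow> complex" where B: "open B" "p0 \<in> B"
    and e: "continuous_on UNIV e" "\<And>t. e t \<noteq> 0" and room: "\<And>p t. p \<in> B \<Longrightarrow> p + sc (e t) v \<in> S"
    and dird: "\<And>G p. holoc sc G S \<Longrightarrow> p \<in> B \<Longrightarrow> dird G v p = integral (cbox 0 1) (\<lambda>t. G (p + sc (e t) v) / e t)"
    by (rule dird_circle_formula[OF S, where v = v]) (rule that)
  note int = circle_integrand[OF F e room]
  have "holoc sc (dird F v) B"
    by (rule holo_transform_open[OF holoc_integral(1)[OF B(1) int(1,3)] B(1)])
       (simp_all only: dird[OF F])
  then show "\<exists>D. (dird F v has_derivative D) (at p0) \<and> (\<forall>c w. D (sc c w) = c * D w)"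
    using B(2) unfolding holo_def by blast
qed

lemma dird_commute:
  assumes F: "holoc sc F S" and S: "open S" and p0: "p0 \<in> S"
  shows "dird (dird F v) w p0 = dird (dird F w) v p0"
proof -
  obtain B and e :: "real \<Rightarrow> complex" where B: "open B" "p0 \<in> B"
    and e: "continuous_on UNIV e" "\<And>t. e t \<noteq> 0" and room: "\<And>p t. p \<in> B \<Longrightarrow> p + sc (e t) v \<in> S"
    and dird: "\<And>G p. holoc sc G S \<Longrightarrow> p \<in> B \<Longrightarrow> dird G v p = integral (cbox 0 1) (\<lambda>t. G (p + sc (e t) v) / e t)"
    by (rule dird_circle_formula[OF S p0, where v = v]) (rule that)
  note int = circle_integrand[OF F e room]
  let ?I = "\<lambda>p. integral (cbox 0 1) (\<lambda>t. F (p + sc (e t) v) / e t)"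
  have I: "holoc sc ?I B" by (rule holoc_integral(1)[OF B(1) int(1,3)])
  have "(dird F v has_derivative (\<lambda>u. dird ?I u p0)) (at p0)"
    by (rule has_derivative_transform_within_open[OF holoc_has_dird(1)[OF I B(2)] B])
       (simp only: dird[OF F])
  then have "dird (dird F v) w p0 = dird ?I w p0"
    by (rule dird_eq) (rule holoc_has_dird(2)[OF I B(2)])
  also have "\<dots> = integral (cbox 0 1) (\<lambda>t. dird (\<lambda>p. F (p + sc (e t) v) / e t) w p0)"
    by (rule holoc_integral(2)[OF B(1) int(1,3) B(2)])
  also have "\<dots> = integral (cbox 0 1) (\<lambda>t. dird F w (p0 + sc (e t) v) / e t)"
    by (simp only: dird_divide[OF int(2) B(2)] dird_translate)
  also have "\<dots> = dird (dird F w) v p0"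
    by (rule dird[OF holoc_dird[OF F S] B(2), symmetric])
  finally show ?thesis .
qed

end

lemma bounded_bilinear_vector_scalar_mult:
  "bounded_bilinear ((*s) :: complex \<Rightarrow> complex ^ 'n \<Rightarrow> complex ^ 'n)"
  unfolding bilinear_conv_bounded_bilinear[symmetric] bilinear_def
  by (auto intro!: linearI simp: vec_eq_iff algebra_simps)

definition pair_scale :: "complex \<Rightarrow> (complex ^ 'n) \<times> complex \<Rightarrow> (complex ^ 'n) \<times> complex" where
  "pair_scale c q = (c *s fst q, c * snd q)"

lemma complex_scaling_vec: "complex_scaling ((*s) :: complex \<Rightarrow> complex ^ 'n \<Rightarrow> complex ^ 'n)"
proof (rule complex_scaling.intro)
  show "of_real r *s v = r *\<^sub>R v" for r and v :: "complex ^ 'n"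
    by (simp add: vec_eq_iff scaleR_conv_of_real[where 'a = complex])
qed (rule bounded_bilinear_vector_scalar_mult)

lemma complex_scaling_pair:
  "complex_scaling (pair_scale :: complex \<Rightarrow> (complex ^ 'n) \<times> complex \<Rightarrow> (complex ^ 'n) \<times> complex)"
proof (rule complex_scaling.intro)
  show "bounded_bilinear (pair_scale :: complex \<Rightarrow> (complex ^ 'n) \<times> complex \<Rightarrow> (complex ^ 'n) \<times> complex)"
    unfolding bilinear_conv_bounded_bilinear[symmetric] bilinear_def pair_scale_def
    by (auto intro!: linearI simp: vec_eq_iff algebra_simps)
  show "pair_scale (of_real r) v = r *\<^sub>R v" for r and v :: "(complex ^ 'n) \<times> complex"
    by (cases v) (simp add: pair_scale_def vec_eq_iff scaleR_conv_of_real[where 'a = complex])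
qed

interpretation cvec: complex_scaling "(*s) :: complex \<Rightarrow> complex ^ 'n \<Rightarrow> complex ^ 'n"
  by (rule complex_scaling_vec)

interpretation pair: complex_scaling
  "pair_scale :: complex \<Rightarrow> (complex ^ 'n) \<times> complex \<Rightarrow> (complex ^ 'n) \<times> complex"
  by (rule complex_scaling_pair)

lemma holomorphic_vec_on_iff: "holomorphic_vec_on F S \<longleftrightarrow> holoc (*s) F S"
  unfolding holomorphic_vec_on_def holo_def ..

lemma jointly_holomorphic_on_iff:
  "jointly_holomorphic_on F S \<longleftrightarrow> holoc pair_scale (\<lambda>q. F (fst q) (snd q)) S"
  unfolding jointly_holomorphic_on_def holo_def pair_scale_def split_beta by simp

lemma holo_vec:
  fixes F :: "'a::real_normed_vector \<Rightarrow> complex ^ 'n"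
  assumes "\<And>i. holoc sA (\<lambda>x. F x $ i) S"
  shows "holo sA (*s) F S"
  unfolding holo_def
proof
  fix p assume p: "p \<in> S"
  have "\<exists>D. ((\<lambda>x. F x $ i) has_derivative D) (at p) \<and> (\<forall>c v. D (sA c v) = c * D v)" for i
    using assms[of i] p unfolding holo_def by blast
  then obtain D where D: "\<And>i. ((\<lambda>x. F x $ i) has_derivative D i) (at p)"
      "\<And>i c v. D i (sA c v) = c * D i v"
    by metis
  have "(F has_derivative (\<lambda>v. \<chi> i. D i v)) (at p)"
  proof (subst has_derivative_componentwise_within, intro ballI)
    fix b :: "complex ^ 'n" assume "b \<in> Basis"
    then obtain i k where b: "b = axis i k" unfolding Basis_vec_def by auto
    show "((\<lambda>x. F x \<bullet> b) has_derivative (\<lambda>x. (\<chi> i. D i x) \<bullet> b)) (at p)"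
      unfolding b inner_axis using has_derivative_inner_left[OF D(1)[of i], of k] by simp
  qed
  then show "\<exists>D. (F has_derivative D) (at p) \<and> (\<forall>c v. D (sA c v) = c *s D v)"
    using D(2) by (intro exI[of _ "\<lambda>v. \<chi> i. D i v"]) (simp add: vec_eq_iff)
qed

lemma holoc_bounded_linear:
  assumes "bounded_linear F" "\<And>c v. F (sA c v) = sB c (F v)"
  shows "holo sA sB F S"
  unfolding holo_def using assms bounded_linear_imp_has_derivative by blast

lemma holoc_nth: "holoc (*s) (\<lambda>x :: complex ^ 'n. x $ i) S"
  by (rule holoc_bounded_linear) (auto intro: bounded_linear_vec_nth)

lemma holoc_fst_nth: "holoc pair_scale (\<lambda>q :: (complex ^ 'n) \<times> complex. fst q $ i) S"
  by (rule holoc_bounded_linear)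
     (auto intro: bounded_linear_compose[OF bounded_linear_vec_nth bounded_linear_fst] simp: pair_scale_def)

lemma holo_fst: "holo pair_scale (*s) fst S"
  by (rule holoc_bounded_linear) (auto intro: bounded_linear_fst simp: pair_scale_def)

lemma holoc_snd: "holoc pair_scale snd S"
  by (rule holoc_bounded_linear) (auto intro: bounded_linear_snd simp: pair_scale_def)

lemma holo_Pair:
  assumes "holo sA (*s) F S" "holoc sA G S"
  shows "holo sA pair_scale (\<lambda>x. (F x, G x)) S"
  unfolding holo_def
proof
  fix p assume p: "p \<in> S"
  obtain D where D: "(F has_derivative D) (at p)" "\<And>c v. D (sA c v) = c *s D v"
    by (rule holoE[OF assms(1) p]) (rule that)
  obtain E where E: "(G has_derivative E) (at p)" "\<And>c v. E (sA c v) = c * E v"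
    by (rule holoE[OF assms(2) p]) (rule that)
  show "\<exists>D. ((\<lambda>x. (F x, G x)) has_derivative D) (at p) \<and> (\<forall>c v. D (sA c v) = pair_scale c (D v))"
    by (intro exI[of _ "\<lambda>v. (D v, E v)"] conjI has_derivative_Pair D(1) E(1))
       (simp add: D(2) E(2) pair_scale_def)
qed

lemma jointly_holomorphic_on_slice:
  assumes "jointly_holomorphic_on F (UNIV \<times> T)" "open T"
  shows "(\<lambda>l. F x l) holomorphic_on T"
proof -
  have "holoc (*) (\<lambda>l. (\<lambda>q. F (fst q) (snd q)) (x, l)) T"
  proof (rule holo_compose[where F = "\<lambda>l. (x, l)"])
    show "holo (*) pair_scale (\<lambda>l. (x, l)) T"
      by (intro holo_Pair holo_vec holoc_const holoc_bounded_linear) auto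
    show "holoc pair_scale (\<lambda>q. F (fst q) (snd q)) (UNIV \<times> T)"
      using assms(1) by (simp add: jointly_holomorphic_on_iff)
  qed auto
  then show ?thesis using assms(2) by (simp add: holoc_holomorphic_iff)
qed

lemma holoc_jointly_compose:
  assumes "jointly_holomorphic_on F (UNIV \<times> T)" "holo sA (*s) X S" "holoc sA L S" "L ` S \<subseteq> T"
  shows "holoc sA (\<lambda>p. F (X p) (L p)) S"
proof -
  have "holoc sA (\<lambda>p. (\<lambda>q. F (fst q) (snd q)) (X p, L p)) S"
  proof (rule holo_compose[where F = "\<lambda>p. (X p, L p)"])
    show "holo sA pair_scale (\<lambda>p. (X p, L p)) S" by (rule holo_Pair[OF assms(2,3)])
    show "holoc pair_scale (\<lambda>q. F (fst q) (snd q)) (UNIV \<times> T)"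
      using assms(1) by (simp add: jointly_holomorphic_on_iff)
  qed (use assms(4) in auto)
  then show ?thesis by simp
qed

lemma holo_vec_id: "holo (*s) (*s) (\<lambda>x :: complex ^ 'n. x) S"
  by (rule holoc_bounded_linear) auto

lemma jointly_holomorphic_on_vec:
  "jointly_holomorphic_on F (UNIV \<times> T) \<Longrightarrow> l \<in> T \<Longrightarrow> holomorphic_vec_on (\<lambda>x. F x l) UNIV"
  unfolding holomorphic_vec_on_iff
  by (rule holoc_jointly_compose[OF _ holo_vec_id holoc_const]) auto

lemma cpartial_eq_dird: "cpartial a F x = cvec.dird F (axis a 1) x"
proof -
  have "s *s axis a 1 = axis a s" for s :: complex
    by (simp add: vec_eq_iff axis_def)
  then show ?thesis by (simp add: cpartial_def cvec.dird_def)
qed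

lemma holomorphic_vec_on_cpartial:
  "holomorphic_vec_on F S \<Longrightarrow> open S \<Longrightarrow> holomorphic_vec_on (cpartial a F) S"
  unfolding holomorphic_vec_on_iff
  using cvec.holoc_dird[of F S "axis a 1"] by (simp add: cpartial_eq_dird[abs_def])

lemma cpartial_commute:
  assumes "holomorphic_vec_on F S" "open S" "x \<in> S"
  shows "cpartial a (cpartial b F) x = cpartial b (cpartial a F) x"
  using cvec.dird_commute[of F S x] assms
  unfolding holomorphic_vec_on_iff cpartial_eq_dird[abs_def] by blast

lemma jointly_holomorphic_on_cpartial:
  assumes "jointly_holomorphic_on F (UNIV \<times> T)" "open T"
  shows "jointly_holomorphic_on (\<lambda>x l. cpartial a (\<lambda>y. F y l) x) (UNIV \<times> T)"
proof -
  have "holoc pair_scale (pair.dird (\<lambda>q. F (fst q) (snd q)) (axis a 1, 0)) (UNIV \<times> T)"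
    using assms by (intro pair.holoc_dird open_Times) (auto simp: jointly_holomorphic_on_iff)
  moreover have "pair.dird (\<lambda>q. F (fst q) (snd q)) (axis a 1, 0) = (\<lambda>q. cpartial a (\<lambda>y. F y (snd q)) (fst q))"
    by (rule ext) (simp add: pair.dird_def cpartial_eq_dird cvec.dird_def pair_scale_def)
  ultimately show ?thesis
    by (simp add: jointly_holomorphic_on_iff)
qed

lemma has_derivative_cpartial:
  assumes "holomorphic_vec_on F S" "x \<in> S"
  shows "(F has_derivative (\<lambda>v. \<Sum>a\<in>UNIV. cpartial a F x * v $ a)) (at x)"
proof -
  obtain D where D: "(F has_derivative D) (at x)" "\<And>c v. D (c *s v) = c * D v"
    using assms unfolding holomorphic_vec_on_def by blast
  have lin: "linear D" using D(1) has_derivative_linear by blast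
  have "D v = (\<Sum>a\<in>UNIV. cpartial a F x * v $ a)" for v
  proof -
    have "D v = D (\<Sum>a\<in>UNIV. v $ a *s axis a 1)"
      by (simp add: basis_expansion)
    also have "\<dots> = (\<Sum>a\<in>UNIV. v $ a * D (axis a 1))"
      by (simp add: linear_sum[OF lin] D(2))
    also have "\<dots> = (\<Sum>a\<in>UNIV. cpartial a F x * v $ a)"
      using cvec.dird_eq[OF D] by (simp add: cpartial_eq_dird mult.commute)
    finally show ?thesis .
  qed
  then have "D = (\<lambda>v. \<Sum>a\<in>UNIV. cpartial a F x * v $ a)" by auto
  with D show ?thesis by simp
qed

lemma cpartial_eqI:
  assumes "(F has_derivative D) (at x)" "\<And>c v. D (c *s v) = c * D v"
  shows "cpartial a F x = D (axis a 1)"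
  using cvec.dird_eq[OF assms] by (simp add: cpartial_eq_dird)

lemma cpartial_chain:
  fixes F :: "complex ^ 'm \<Rightarrow> complex" and G :: "complex ^ 'n \<Rightarrow> complex ^ 'm"
  assumes F: "holomorphic_vec_on F T" and G: "\<And>i. holomorphic_vec_on (\<lambda>x. G x $ i) S"
    and x: "x \<in> S" "G x \<in> T"
  shows "cpartial a (\<lambda>x. F (G x)) x = (\<Sum>i\<in>UNIV. cpartial i F (G x) * cpartial a (\<lambda>x. G x $ i) x)"
proof -
  have "holo (*s) (*s) G S"
    using G by (intro holo_vec) (simp add: holomorphic_vec_on_iff)
  then obtain E where E: "(G has_derivative E) (at x)" "\<And>c v. E (c *s v) = c *s E v"
    using x unfolding holo_def by blast
  have Ei: "cpartial a (\<lambda>x. G x $ i) x = E (axis a 1) $ i" for i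
    by (rule cpartial_eqI[OF bounded_linear.has_derivative[OF bounded_linear_vec_nth E(1)]]) (simp add: E(2))
  from has_derivative_compose[OF E(1) has_derivative_cpartial[OF F x(2)]]
  show ?thesis
    unfolding Ei by (rule cpartial_eqI) (simp add: E(2) sum_distrib_left mult_ac)
qed

lemma cpartial_const [simp]: "cpartial a (\<lambda>_. k) x = 0"
  by (simp add: cpartial_def)

lemma cpartial_nth: "cpartial a (\<lambda>x. x $ i) x = (if i = a then 1 else 0)"
  by (subst cpartial_eqI[OF bounded_linear_imp_has_derivative[OF bounded_linear_vec_nth]])
     (auto simp: axis_def)

lemma cpartial_add:
  assumes "holomorphic_vec_on F S" "holomorphic_vec_on G S" "x \<in> S"
  shows "cpartial a (\<lambda>x. F x + G x) x = cpartial a F x + cpartial a G x"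
proof -
  obtain D E where D: "(F has_derivative D) (at x)" "\<And>c v. D (c *s v) = c * D v"
    and E: "(G has_derivative E) (at x)" "\<And>c v. E (c *s v) = c * E v"
    using assms unfolding holomorphic_vec_on_def by meson
  show ?thesis
    unfolding cpartial_eqI[OF D] cpartial_eqI[OF E]
    by (rule cpartial_eqI[OF has_derivative_add[OF D(1) E(1)]]) (simp add: D(2) E(2) algebra_simps)
qed

lemma cpartial_mult_left:
  assumes "holomorphic_vec_on F S" "x \<in> S"
  shows "cpartial a (\<lambda>x. k * F x) x = k * cpartial a F x"
proof -
  obtain D where D: "(F has_derivative D) (at x)" "\<And>c v. D (c *s v) = c * D v"
    using assms unfolding holomorphic_vec_on_def by meson
  show ?thesis
    unfolding cpartial_eqI[OF D]
    by (rule cpartial_eqI[OF has_derivative_mult_right[OF D(1)]]) (simp add: D(2))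
qed

section \<open>Splitting on the projective line\<close>

lemma origin_disc_props:
  assumes "origin_disc U"
  shows "open U" "convex U" "0 \<in> U"
  using assms unfolding origin_disc_def by auto

lemma covers_P1_swap: "covers_P1 U Uh \<Longrightarrow> covers_P1 Uh U"
  unfolding covers_P1_def origin_disc_def by (metis centre_in_ball inverse_inverse_eq inverse_nonzero_iff_nonzero UNIV_I)

lemma covers_P1_radii:
  assumes "covers_P1 U Uh"
  obtains r s where "0 < r" "r < s" "cball 0 s \<subseteq> U" "cball 0 (inverse r) \<subseteq> Uh"
proof -
  from assms have U: "U = UNIV \<or> (\<exists>R>0. U = ball 0 R)" and Uh: "Uh = UNIV \<or> (\<exists>R>0. Uh = ball 0 R)"
    and cov: "\<And>l. l \<in> U \<or> inverse l \<in> Uh"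
    unfolding covers_P1_def origin_disc_def by auto
  show ?thesis
  proof (cases "Uh = UNIV")
    case Uh_UNIV: True
    show ?thesis
    proof (cases "U = UNIV")
      case True
      then show ?thesis using that[of 1 2] Uh_UNIV by simp
    next
      case False
      with U obtain R where "R > 0" "U = ball 0 R" by blast
      then show ?thesis using that[of "R/4" "R/2"] Uh_UNIV by (simp add: cball_subset_ball_iff)
    qed
  next
    case False
    with Uh obtain Q where Q: "Q > 0" "Uh = ball 0 Q" by blast
    show ?thesis
    proof (cases "U = UNIV")
      case True
      then show ?thesis using that[of "2 / Q" "3 / Q"] Q by (simp add: cball_subset_ball_iff divide_strict_right_mono)
    next
      case False
      with U obtain R where R: "R > 0" "U = ball 0 R" by blast
      have "inverse R < Q"
        using cov[of "of_real R"] R Q by (simp add: norm_inverse)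
      then have "inverse Q < R"
        using R Q by (simp add: field_simps)
      then obtain r where r: "inverse Q < r" "r < R" using dense by blast
      then obtain s where s: "r < s" "s < R" using dense by blast
      have "inverse Q > 0" using Q by simp
      then have "0 < r" using r by linarith
      moreover from this have "inverse r < Q" using r Q by (simp add: field_simps)
      ultimately show ?thesis
        using that[of r s] R Q r s by (simp add: cball_subset_ball_iff)
    qed
  qed
qed

lemma open_inverse_vimage: "open V \<Longrightarrow> open {l. l \<noteq> 0 \<and> inverse l \<in> (V :: complex set)}"
proof -
  assume "open V"
  then have "open (- {0} \<inter> inverse -` V)"
    by (intro continuous_open_preimage continuous_intros) auto
  also have "- {0} \<inter> inverse -` V = {l. l \<noteq> 0 \<and> inverse l \<in> V}"
    by auto
  finally show ?thesis .
qed

lemma open_overlap: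
  assumes "covers_P1 U Uh"
  shows "open (overlap U Uh)"
proof -
  have "open U" "open Uh" using assms origin_disc_props unfolding covers_P1_def by auto
  then have "open (U \<inter> {l. l \<noteq> 0 \<and> inverse l \<in> Uh})"
    by (intro open_Int open_inverse_vimage)
  also have "U \<inter> {l. l \<noteq> 0 \<and> inverse l \<in> Uh} = overlap U Uh"
    unfolding overlap_def by auto
  finally show ?thesis .
qed

lemma glue_constant_left:
  assumes cov: "covers_P1 U Uh" and P: "P holomorphic_on U" and Q: "Q holomorphic_on Uh"
    and eq: "\<And>l. l \<in> overlap U Uh \<Longrightarrow> P l = Q (inverse l)"
  shows "\<exists>c. \<forall>l\<in>U. P l = c"
proof -
  have o: "open U" "open Uh" using cov origin_disc_props unfolding covers_P1_def by auto
  obtain r s where rs: "0 < r" "r < s" "cball 0 s \<subseteq> U" "cball 0 (inverse r) \<subseteq> Uh"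
    using covers_P1_radii[OF cov] by blast
  define V where "V = {l. l \<noteq> 0 \<and> inverse l \<in> Uh}"
  have V: "open V" unfolding V_def by (rule open_inverse_vimage[OF o(2)])
  have UV: "U \<union> V = UNIV" using cov unfolding covers_P1_def V_def by blast
  define F where "F l = (if l \<in> U then P l else Q (inverse l))" for l
  have F_V: "F l = Q (inverse l)" if "l \<in> V" for l
    using that eq[of l] unfolding F_def V_def overlap_def by auto
  have "F holomorphic_on U"
    by (rule holomorphic_transform[OF P]) (simp add: F_def)
  moreover have "F holomorphic_on V"
  proof (rule holomorphic_transform)
    show "(Q \<circ> inverse) holomorphic_on V"
      by (rule holomorphic_on_compose_gen[OF _ Q]) (auto simp: V_def intro!: holomorphic_intros)
  qed (simp add: F_V)
  ultimately have hol: "F holomorphic_on UNIV"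
    using holomorphic_on_Un[OF _ _ o(1) V] UV by metis
  have "F ` UNIV \<subseteq> P ` cball 0 s \<union> Q ` cball 0 (inverse r)"
  proof
    fix y assume "y \<in> F ` UNIV"
    then obtain l where l: "y = F l" by blast
    show "y \<in> P ` cball 0 s \<union> Q ` cball 0 (inverse r)"
    proof (cases "norm l \<le> s")
      case True
      then have "l \<in> cball 0 s" by simp
      with rs l show ?thesis unfolding F_def by (metis UnI1 image_eqI subsetD)
    next
      case False
      then have "norm (inverse l) \<le> inverse r" "l \<noteq> 0"
        using rs by (auto simp: norm_inverse intro!: le_imp_inverse_le)
      then have "inverse l \<in> cball 0 (inverse r)" "l \<in> V" using rs unfolding V_def by auto
      then show ?thesis using F_V l by blast
    qed
  qed
  moreover have "compact (P ` cball 0 s \<union> Q ` cball 0 (inverse r))"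
    by (intro compact_Un compact_continuous_image compact_cball)
       (use P Q rs holomorphic_on_imp_continuous_on continuous_on_subset in blast)+
  ultimately have "bounded (range F)"
    using bounded_subset compact_imp_bounded by blast
  then obtain c where "\<And>l. F l = c"
    using Liouville_theorem[OF hol] unfolding constant_on_def by blast
  then show ?thesis unfolding F_def by metis
qed

lemma glue_constant:
  assumes cov: "covers_P1 U Uh" and P: "P holomorphic_on U" and Q: "Q holomorphic_on Uh"
    and eq: "\<And>l. l \<in> overlap U Uh \<Longrightarrow> P l = Q (inverse l)"
  shows "\<And>l. l \<in> U \<Longrightarrow> P l = P 0" "\<And>m. m \<in> Uh \<Longrightarrow> Q m = P 0"
proof -
  obtain r s where rs: "0 < r" "r < s" "cball 0 s \<subseteq> U" "cball 0 (inverse r) \<subseteq> Uh"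
    using covers_P1_radii[OF cov] by blast
  obtain c where c: "\<And>l. l \<in> U \<Longrightarrow> P l = c"
    using glue_constant_left[OF cov P Q eq] by blast
  have "Q m = P (inverse m)" if "m \<in> overlap Uh U" for m
    using eq[of "inverse m"] that unfolding overlap_def by auto
  then obtain d where d: "\<And>m. m \<in> Uh \<Longrightarrow> Q m = d"
    using glue_constant_left[OF covers_P1_swap[OF cov] Q P] by blast
  have 0: "0 \<in> U" using rs by (auto simp: subset_iff)
  have s: "of_real s \<in> U" "inverse (of_real s) \<in> Uh" "of_real s \<noteq> (0::complex)"
    using rs by (auto simp: subset_iff norm_inverse intro!: le_imp_inverse_le)
  then have "P (of_real s) = Q (inverse (of_real s))"
    by (intro eq) (auto simp: overlap_def)
  then have "c = d" using c d s by metis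
  then show "\<And>l. l \<in> U \<Longrightarrow> P l = P 0" "\<And>m. m \<in> Uh \<Longrightarrow> Q m = P 0"
    using c d 0 by auto
qed

lemma glue_linear:
  assumes cov: "covers_P1 U Uh" and P: "P holomorphic_on U" and Q: "Q holomorphic_on Uh"
    and eq: "\<And>l. l \<in> overlap U Uh \<Longrightarrow> inverse l * P l = Q (inverse l)"
  shows "\<And>l. l \<in> U \<Longrightarrow> P l = P 0 + deriv P 0 * l" "\<And>m. m \<in> Uh \<Longrightarrow> Q m = P 0 * m + deriv P 0"
proof -
  have o: "open U" "open Uh" "0 \<in> U" using cov origin_disc_props unfolding covers_P1_def by auto
  define R where "R l = (if l = 0 then deriv P 0 else (P l - P 0) / (l - 0))" for l
  have R: "R holomorphic_on U"
    unfolding R_def by (rule pole_lemma_open[OF P o(1)])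
  have Q': "(\<lambda>m. Q m - P 0 * m) holomorphic_on Uh"
    using Q by (intro holomorphic_intros)
  have RQ: "R l = Q (inverse l) - P 0 * inverse l" if "l \<in> overlap U Uh" for l
    using eq[OF that] that unfolding R_def overlap_def by (auto simp: field_simps)
  have R0: "R l = R 0" if "l \<in> U" for l
    by (rule glue_constant(1)[OF cov R Q' _ that]) (rule RQ)
  show "P l = P 0 + deriv P 0 * l" if "l \<in> U" for l
  proof (cases "l = 0")
    case False
    then have "(P l - P 0) / l = deriv P 0" using R0[OF that] by (simp add: R_def)
    with False show ?thesis by (simp add: field_simps)
  qed simp
  have "Q m - P 0 * m = R 0" if "m \<in> Uh" for m
    by (rule glue_constant(2)[OF cov R Q' _ that]) (rule RQ)
  then show "Q m = P 0 * m + deriv P 0" if "m \<in> Uh" for m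
    using that by (auto simp: R_def algebra_simps)
qed

lemma Cauchy_annulus:
  assumes A: "open A" and g: "g holomorphic_on A" and rs: "0 < r" "r < norm l" "norm l < s"
    and sub: "\<And>z. r \<le> norm z \<Longrightarrow> norm z \<le> s \<Longrightarrow> z \<in> A"
  shows "contour_integral (circlepath 0 s) (\<lambda>z. g z / (z - l)) -
    contour_integral (circlepath 0 r) (\<lambda>z. g z / (z - l)) = 2 * pi * \<i> * g l"
proof -
  define h where "h z = (if z = l then deriv g l else (g z - g l) / (z - l))" for z
  have h: "h holomorphic_on A"
    unfolding h_def by (rule pole_lemma_open[OF g A])
  have hl: "homotopic_loops A (circlepath 0 s) (circlepath 0 r)"
  proof (rule homotopic_loops_linear)
    fix t :: real
    let ?e = "exp (2 * of_real pi * \<i> * of_real t)"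
    show "closed_segment (circlepath 0 s t) (circlepath 0 r t) \<subseteq> A"
    proof
      fix z assume "z \<in> closed_segment (circlepath 0 s t) (circlepath 0 r t)"
      then obtain u where u: "0 \<le> u" "u \<le> 1" "z = (1 - u) *\<^sub>R (s * ?e) + u *\<^sub>R (r * ?e)"
        unfolding closed_segment_def circlepath by auto
      then have z: "z = of_real ((1 - u) * s + u * r) * ?e"
        by (simp add: scaleR_conv_of_real algebra_simps)
      have ge: "(1 - u) * s + u * r \<ge> 0" using u rs by simp
      have nz: "norm z = (1 - u) * s + u * r"
        unfolding z norm_mult using ge by (simp del: of_real_add of_real_mult of_real_diff)
      have "(1 - u) * s + u * r \<le> s" "r \<le> (1 - u) * s + u * r"
        using convex_bound_le[of s s r "1 - u" u] convex_bound_le[of "- s" "- r" "- r" "1 - u" u] u rs by auto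
      then show "z \<in> A" using nz by (intro sub) auto
    qed
  qed auto
  have eq: "contour_integral (circlepath 0 s) h = contour_integral (circlepath 0 r) h"
    by (rule Cauchy_theorem_homotopic_loops[OF hl A h]) auto
  have cg: "continuous_on (sphere 0 d) g" if "r \<le> d" "d \<le> s" for d
    by (rule continuous_on_subset[OF holomorphic_on_imp_continuous_on[OF g]]) (use that in \<open>auto intro: sub\<close>)
  have int: "(\<lambda>z. k z / (z - l)) contour_integrable_on circlepath 0 d"
    if "r \<le> d" "d \<le> s" "d \<noteq> norm l" "continuous_on (sphere 0 d) k" for d k
    by (rule contour_integrable_continuous_circlepath)
       (use that rs in \<open>auto intro!: continuous_intros simp: sphere_def\<close>)
  have main: "contour_integral (circlepath 0 d) h = contour_integral (circlepath 0 d) (\<lambda>z. g z / (z - l)) -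
      g l * contour_integral (circlepath 0 d) (\<lambda>z. 1 / (z - l))" if "r \<le> d" "d \<le> s" "d \<noteq> norm l" for d
  proof -
    have "contour_integral (circlepath 0 d) h =
        contour_integral (circlepath 0 d) (\<lambda>z. g z / (z - l) - g l * (1 / (z - l)))"
      by (rule contour_integral_cong) (use that rs in \<open>auto simp: h_def diff_divide_distrib\<close>)
    also have "\<dots> = contour_integral (circlepath 0 d) (\<lambda>z. g z / (z - l)) -
        contour_integral (circlepath 0 d) (\<lambda>z. g l * (1 / (z - l)))"
      by (intro contour_integral_diff int contour_integrable_lmul cg that) auto
    also have "contour_integral (circlepath 0 d) (\<lambda>z. g l * (1 / (z - l))) =
        g l * contour_integral (circlepath 0 d) (\<lambda>z. 1 / (z - l))"
      by (intro contour_integral_lmul int that) auto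
    finally show ?thesis .
  qed
  have "((\<lambda>z. 1 / (z - l)) has_contour_integral 2 * pi * \<i> * 1) (circlepath 0 s)"
    using Cauchy_integral_circlepath_simple[of "\<lambda>_. 1" 0 s l] rs by simp
  then have s1: "contour_integral (circlepath 0 s) (\<lambda>z. 1 / (z - l)) = 2 * pi * \<i>"
    using contour_integral_unique by fastforce
  have "((\<lambda>z. 1 / (z - l)) has_contour_integral 0) (circlepath 0 r)"
    by (rule Cauchy_theorem_convex_simple[of _ "ball 0 (norm l)"])
       (use rs in \<open>auto intro!: holomorphic_intros\<close>)
  then have "contour_integral (circlepath 0 r) (\<lambda>z. 1 / (z - l)) = 0"
    by (rule contour_integral_unique)
  with eq main[of s] main[of r] s1 rs show ?thesis
    by (simp add: algebra_simps)
qed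

text \<open>The Cauchy kernel on two circles inside the annulus gives the two parts of the Laurent
  expansion on a disc each; the identity of \<open>Cauchy_annulus\<close> extends them to \<open>U\<close> and \<open>Uh\<close>.\<close>

lemma Laurent_splitting:
  fixes G :: "complex ^ 'n \<Rightarrow> complex \<Rightarrow> complex"
  assumes cov: "covers_P1 U Uh" and G: "jointly_holomorphic_on G (UNIV \<times> overlap U Uh)"
  obtains P Q where "jointly_holomorphic_on P (UNIV \<times> U)" "jointly_holomorphic_on Q (UNIV \<times> Uh)"
    "\<And>x l. l \<in> overlap U Uh \<Longrightarrow> G x l = P x l + Q x (inverse l) * inverse l"
proof -
  obtain r s where rs: "0 < r" "r < s" "cball 0 s \<subseteq> U" "cball 0 (inverse r) \<subseteq> Uh"
    using covers_P1_radii[OF cov] by blast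
  have s0: "0 < s" using rs by linarith
  have oA: "open (overlap U Uh)" and oU: "open U" "open Uh"
    using cov origin_disc_props open_overlap[OF cov] unfolding covers_P1_def by auto
  have inU: "l \<in> U" if "norm l \<le> s" for l using that rs by auto
  have inUh: "m \<in> Uh" if "norm m \<le> inverse r" for m using that rs by auto
  have inv_le: "norm (inverse l) \<le> inverse r" if "r \<le> norm l" for l :: complex
    using that rs by (auto simp: norm_inverse intro!: le_imp_inverse_le)
  have inA: "l \<in> overlap U Uh" if "l \<in> U" "r \<le> norm l" for l
    using that rs inUh inv_le[OF that(2)] unfolding overlap_def by auto
  define e where "e t = exp (2 * pi * \<i> * of_real t)" for t :: real
  have ne: "norm (e t) = 1" for t unfolding e_def by simp
  have ce: "continuous_on S (\<lambda>p. e (f p))" if "continuous_on S f" for S :: "'z::topological_space set" and f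
    unfolding e_def by (intro continuous_intros that)
  have cG: "continuous_on (UNIV \<times> overlap U Uh) (\<lambda>q. G (fst q) (snd q))"
    using G unfolding jointly_holomorphic_on_iff by (rule holo_imp_continuous_on)
  have ring: "d * e t \<in> overlap U Uh" if "r \<le> d" "d \<le> s" for d t
    using that rs by (intro inA inU) (auto simp: norm_mult ne)
  have hG: "holoc pair_scale (\<lambda>q. G (fst q) l) S" if "l \<in> overlap U Uh" for l S
    by (rule holoc_jointly_compose[OF G holo_fst holoc_const]) (use that in auto)
  define P1 where "P1 x l = integral (cbox 0 1) (\<lambda>t. G x (s * e t) * (s * e t) / (s * e t - l))" for x l
  define Q1 where "Q1 x m = integral (cbox 0 1) (\<lambda>t. G x (r * e t) * (r * e t) / (1 - r * e t * m))" for x m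
  have P1: "jointly_holomorphic_on P1 (UNIV \<times> ball 0 s)"
    unfolding jointly_holomorphic_on_iff P1_def
  proof (rule pair.holoc_integral)
    have nz: "s * e t - l \<noteq> 0" if "l \<in> ball 0 s" for t l
    proof
      assume "s * e t - l = 0"
      then have "norm (s * e t) = norm l" by simp
      then show False using that s0 by (simp add: norm_mult ne)
    qed
    show "open (UNIV \<times> ball (0::complex) s)" by (intro open_Times) auto
    show "holoc pair_scale (\<lambda>q. G (fst q) (s * e t) * (s * e t) / (s * e t - snd q)) (UNIV \<times> ball 0 s)"
      for t
      by (intro holoc_divide holoc_mult holoc_diff holoc_const holoc_snd hG ring)
         (use rs nz in auto)
    show "continuous_on ((UNIV \<times> ball 0 s) \<times> cbox 0 1)
        (\<lambda>(q, t). G (fst q) (s * e t) * (s * e t) / (s * e t - snd q))"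
      unfolding split_beta
    proof (intro continuous_on_divide continuous_on_mult)
      show "continuous_on ((UNIV \<times> ball 0 s) \<times> cbox 0 1) (\<lambda>p. G (fst (fst p)) (s * e (snd p)))"
        by (rule continuous_on_compose2[OF cG, of _ "\<lambda>p. (fst (fst p), s * e (snd p))", simplified])
           (use ring rs in \<open>auto intro!: continuous_intros ce\<close>)
    qed (use nz in \<open>auto intro!: continuous_intros ce\<close>)
  qed
  have Q1: "jointly_holomorphic_on Q1 (UNIV \<times> ball 0 (inverse r))"
    unfolding jointly_holomorphic_on_iff Q1_def
  proof (rule pair.holoc_integral)
    have nz: "1 - r * e t * m \<noteq> 0" if "m \<in> ball 0 (inverse r)" for t m
    proof
      assume "1 - r * e t * m = 0"
      then have "norm (r * e t * m) = 1" by simp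
      then show False using that rs by (auto simp: norm_mult ne field_simps)
    qed
    show "open (UNIV \<times> ball (0::complex) (inverse r))" by (intro open_Times) auto
    show "holoc pair_scale (\<lambda>q. G (fst q) (r * e t) * (r * e t) / (1 - r * e t * snd q)) (UNIV \<times> ball 0 (inverse r))"
      for t
      by (intro holoc_divide holoc_mult holoc_diff holoc_const holoc_snd hG ring)
         (use rs nz in auto)
    show "continuous_on ((UNIV \<times> ball 0 (inverse r)) \<times> cbox 0 1)
        (\<lambda>(q, t). G (fst q) (r * e t) * (r * e t) / (1 - r * e t * snd q))"
      unfolding split_beta
    proof (intro continuous_on_divide continuous_on_mult)
      show "continuous_on ((UNIV \<times> ball 0 (inverse r)) \<times> cbox 0 1) (\<lambda>p. G (fst (fst p)) (r * e (snd p)))"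
        by (rule continuous_on_compose2[OF cG, of _ "\<lambda>p. (fst (fst p), r * e (snd p))", simplified])
           (use ring rs in \<open>auto intro!: continuous_intros ce\<close>)
    qed (use nz in \<open>auto intro!: continuous_intros ce\<close>)
  qed
  have split: "G x l = P1 x l + Q1 x (inverse l) * inverse l" if l: "r < norm l" "norm l < s" for x l
  proof -
    have Gx: "G x holomorphic_on overlap U Uh"
      by (rule jointly_holomorphic_on_slice[OF G oA])
    have int: "((\<lambda>t. G x (d * e t) / (d * e t - l) * (d * e t)) has_integral
        contour_integral (circlepath 0 d) (\<lambda>z. G x z / (z - l)) / (2 * pi * \<i>)) (cbox 0 1)"
      if d: "r \<le> d" "d \<le> s" "d \<noteq> norm l" for d
      unfolding e_def
    proof (rule has_contour_integral_circlepath_exp[OF has_contour_integral_integral],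
           rule contour_integrable_continuous_circlepath)
      have "continuous_on (sphere 0 d) (G x)"
        by (rule continuous_on_subset[OF holomorphic_on_imp_continuous_on[OF Gx]])
           (use d inA inU in auto)
      then show "continuous_on (path_image (circlepath 0 d)) (\<lambda>z. G x z / (z - l))"
        using d rs by (auto intro!: continuous_intros)
    qed
    have "P1 x l = contour_integral (circlepath 0 s) (\<lambda>z. G x z / (z - l)) / (2 * pi * \<i>)"
      unfolding P1_def using integral_unique[OF int[of s]] rs l by (simp add: mult_ac)
    moreover have "Q1 x (inverse l) * inverse l = - contour_integral (circlepath 0 r) (\<lambda>z. G x z / (z - l)) / (2 * pi * \<i>)"
    proof -
      have l0: "l \<noteq> 0" using l rs by auto
      have "((\<lambda>t. - l * (G x (r * e t) / (r * e t - l) * (r * e t))) has_integral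
        - l * (contour_integral (circlepath 0 r) (\<lambda>z. G x z / (z - l)) / (2 * pi * \<i>))) (cbox 0 1)"
        by (rule has_integral_mult_right[OF int]) (use rs l in auto)
      moreover have "- l * (G x (r * e t) / (r * e t - l) * (r * e t)) =
          G x (r * e t) * (r * e t) / (1 - r * e t * inverse l)" for t
      proof -
        have "r * e t - l \<noteq> 0"
        proof
          assume "r * e t - l = 0"
          then have "norm (r * e t) = norm l" by simp
          then show False using l rs by (simp add: norm_mult ne)
        qed
        moreover have "1 - r * e t * inverse l = - (r * e t - l) / l"
          using l0 by (simp add: field_simps)
        ultimately show ?thesis using l0 by (simp add: field_simps)
      qed
      ultimately have "Q1 x (inverse l) = - l * (contour_integral (circlepath 0 r) (\<lambda>z. G x z / (z - l)) / (2 * pi * \<i>))"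
        unfolding Q1_def by (simp only: integral_unique)
      then show ?thesis using l0 by (simp add: field_simps)
    qed
    ultimately have "P1 x l + Q1 x (inverse l) * inverse l =
      (contour_integral (circlepath 0 s) (\<lambda>z. G x z / (z - l)) -
        contour_integral (circlepath 0 r) (\<lambda>z. G x z / (z - l))) / (2 * pi * \<i>)"
      by (simp add: diff_divide_distrib)
    also have "\<dots> = G x l"
      by (subst Cauchy_annulus[OF oA Gx rs(1) l]) (use inA inU in auto)
    finally show ?thesis by simp
  qed
  define P where "P x l = (if norm l < s then P1 x l else G x l - Q1 x (inverse l) * inverse l)" for x l
  define Q where "Q x m = (if norm m < inverse r then Q1 x m else (G x (inverse m) - P1 x (inverse m)) * inverse m)" for x m
  have P2: "P x l = G x l - Q1 x (inverse l) * inverse l" if "r < norm l" for x l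
    using split[of l x] that by (auto simp: P_def)
  have Q2: "Q x m = (G x (inverse m) - P1 x (inverse m)) * inverse m" if "inverse s < norm m" for x m
  proof (cases "norm m < inverse r")
    case True
    have m0: "m \<noteq> 0" using that s0 by auto
    have "inverse (norm m) < s" "r < inverse (norm m)"
      using True that rs s0 m0 by (simp_all add: field_simps)
    then have "G x (inverse m) = P1 x (inverse m) + Q1 x m * m"
      using split[of "inverse m" x] by (simp add: norm_inverse)
    then show ?thesis using m0 True by (simp add: Q_def)
  qed (simp add: Q_def)
  show thesis
  proof
    have o1: "open (U \<inter> {l. r < norm l})" 
      by (intro open_Int oU open_Collect_less continuous_intros)
    have "jointly_holomorphic_on P (UNIV \<times> ball 0 s)"
      using P1 unfolding jointly_holomorphic_on_iff
      by (rule holo_transform_open) (auto intro: open_Times simp: P_def)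
    moreover have "jointly_holomorphic_on P (UNIV \<times> (U \<inter> {l. r < norm l}))"
    proof -
      have "holoc pair_scale (\<lambda>q. G (fst q) (snd q) - Q1 (fst q) (inverse (snd q)) * inverse (snd q))
          (UNIV \<times> (U \<inter> {l. r < norm l}))"
      proof (intro holoc_diff holoc_mult)
        show inv: "holoc pair_scale (\<lambda>q. inverse (snd q)) (UNIV \<times> (U \<inter> {l. r < norm l}))"
          by (rule holoc_inverse[OF holoc_snd]) (use rs in auto)
        show "holoc pair_scale (\<lambda>q. Q1 (fst q) (inverse (snd q))) (UNIV \<times> (U \<inter> {l. r < norm l}))"
          by (rule holoc_jointly_compose[OF Q1 holo_fst inv])
             (use rs in \<open>auto simp: norm_inverse intro!: less_imp_inverse_less\<close>)
        show "holoc pair_scale (\<lambda>q. G (fst q) (snd q)) (UNIV \<times> (U \<inter> {l. r < norm l}))"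
          by (rule holoc_jointly_compose[OF G holo_fst holoc_snd]) (auto intro!: inA)
      qed
      then show ?thesis
        unfolding jointly_holomorphic_on_iff
        by (rule holo_transform_open) (auto intro!: open_Times o1 simp: P2)
    qed
    ultimately have "jointly_holomorphic_on P (UNIV \<times> ball 0 s \<union> UNIV \<times> (U \<inter> {l. r < norm l}))"
      unfolding jointly_holomorphic_on_iff by (rule holo_Un)
    moreover have "UNIV \<times> ball 0 s \<union> UNIV \<times> (U \<inter> {l. r < norm l}) = UNIV \<times> U"
      using rs inU by fastforce
    ultimately show "jointly_holomorphic_on P (UNIV \<times> U)" by metis
  next
    have o1: "open (Uh \<inter> {m. inverse s < norm m})" 
      by (intro open_Int oU open_Collect_less continuous_intros)
    have nz: "m \<noteq> 0" "norm (inverse m) < s" "inverse m \<in> U" if "inverse s < norm m" for m :: complex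
    proof -
      show "m \<noteq> 0" using that s0 by auto
      then have "norm m > 0" by simp
      with that s0 show "norm (inverse m) < s" unfolding norm_inverse by (simp add: field_simps)
      then show "inverse m \<in> U" by (intro inU) simp
    qed
    have "jointly_holomorphic_on Q (UNIV \<times> ball 0 (inverse r))"
      using Q1 unfolding jointly_holomorphic_on_iff
      by (rule holo_transform_open) (auto intro: open_Times simp: Q_def)
    moreover have "jointly_holomorphic_on Q (UNIV \<times> (Uh \<inter> {m. inverse s < norm m}))"
    proof -
      have "holoc pair_scale (\<lambda>q. (G (fst q) (inverse (snd q)) - P1 (fst q) (inverse (snd q))) * inverse (snd q))
          (UNIV \<times> (Uh \<inter> {m. inverse s < norm m}))"
      proof (intro holoc_diff holoc_mult)
        show inv: "holoc pair_scale (\<lambda>q. inverse (snd q)) (UNIV \<times> (Uh \<inter> {m. inverse s < norm m}))"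
          by (rule holoc_inverse[OF holoc_snd]) (use nz in auto)
        show "holoc pair_scale (\<lambda>q. P1 (fst q) (inverse (snd q))) (UNIV \<times> (Uh \<inter> {m. inverse s < norm m}))"
          by (rule holoc_jointly_compose[OF P1 holo_fst inv]) (use nz in auto)
        show "holoc pair_scale (\<lambda>q. G (fst q) (inverse (snd q))) (UNIV \<times> (Uh \<inter> {m. inverse s < norm m}))"
          by (rule holoc_jointly_compose[OF G holo_fst inv]) (use nz in \<open>auto simp: overlap_def\<close>)
      qed
      then show ?thesis
        unfolding jointly_holomorphic_on_iff
        by (rule holo_transform_open) (auto intro!: open_Times o1 simp: Q2)
    qed
    ultimately have "jointly_holomorphic_on Q (UNIV \<times> ball 0 (inverse r) \<union> UNIV \<times> (Uh \<inter> {m. inverse s < norm m}))"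
      unfolding jointly_holomorphic_on_iff by (rule holo_Un)
    moreover have "UNIV \<times> ball 0 (inverse r) \<union> UNIV \<times> (Uh \<inter> {m. inverse s < norm m}) = UNIV \<times> Uh"
    proof -
      have "inverse s < inverse r" using rs by simp
      then show ?thesis using inUh by fastforce
    qed
    ultimately show "jointly_holomorphic_on Q (UNIV \<times> Uh)" by metis
  next
    fix x l assume l: "l \<in> overlap U Uh"
    then have l0: "l \<noteq> 0" by (auto simp: overlap_def)
    show "G x l = P x l + Q x (inverse l) * inverse l"
    proof (cases "norm l < s")
      case True
      then have "inverse s < norm (inverse l)" using s0 l0 by (simp add: norm_inverse)
      from Q2[OF this, of x] True l0 show ?thesis by (simp add: P_def mult.assoc)
    next
      case False
      then have "r < norm l" using rs by simp
      then have "norm (inverse l) < inverse r" using rs by (simp add: norm_inverse less_imp_inverse_less)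
      then show ?thesis using P2[OF \<open>r < norm l\<close>, of x] by (simp add: Q_def)
    qed
  qed
qed

lemma has_contour_integral_Laurent:
  assumes cov: "covers_P1 U Uh" and P: "P holomorphic_on U" and Q: "Q holomorphic_on Uh"
    and c: "encircles_zero_once (overlap U Uh) c"
    and h: "\<And>l. l \<in> overlap U Uh \<Longrightarrow> h l = P l * inverse l + Q (inverse l) * (inverse l)\<^sup>2"
  shows "(h has_contour_integral 2 * pi * \<i> * P 0) c"
proof -
  have o: "open U" "open Uh" "0 \<in> U" "convex U" "convex Uh"
    using cov origin_disc_props unfolding covers_P1_def by auto
  have c': "valid_path c" "pathfinish c = pathstart c" "path_image c \<subseteq> overlap U Uh" "winding_number c 0 = 1"
    using c unfolding encircles_zero_once_def by auto
  have nz: "l \<noteq> 0" "l \<in> U" "inverse l \<in> Uh" if "l \<in> overlap U Uh" for l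
    using that by (auto simp: overlap_def)
  define R where "R l = (if l = 0 then deriv P 0 else (P l - P 0) / (l - 0))" for l
  have "R holomorphic_on U"
    unfolding R_def by (rule pole_lemma_open[OF P o(1)])
  then have i1: "(R has_contour_integral 0) c"
    by (rule Cauchy_theorem_convex_simple) (use o c' nz in auto)
  have "((\<lambda>l. 1 / (l - 0)) has_contour_integral (2 * pi * \<i> * winding_number c 0)) c"
    by (rule has_contour_integral_winding_number) (use c' nz in auto)
  then have "((\<lambda>l. P 0 * (1 / (l - 0))) has_contour_integral P 0 * (2 * pi * \<i> * winding_number c 0)) c"
    by (rule has_contour_integral_lmul)
  then have i2: "((\<lambda>l. P 0 * inverse l) has_contour_integral 2 * pi * \<i> * P 0) c"
    by (simp add: c' mult_ac inverse_eq_divide)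
  obtain q where q: "\<And>m. m \<in> Uh \<Longrightarrow> (q has_field_derivative Q m) (at m within Uh)"
    using holomorphic_convex_primitive'[OF o(5,2) Q] by blast
  have "((\<lambda>l. - q (inverse l)) has_field_derivative Q (inverse l) * (inverse l)\<^sup>2) (at l within overlap U Uh)"
    if l: "l \<in> overlap U Uh" for l
  proof -
    have "(q has_field_derivative Q (inverse l)) (at (inverse l))"
      using q[OF nz(3)[OF l]] at_within_open[OF nz(3)[OF l] o(2)] by simp
    moreover have "(inverse has_field_derivative - ((inverse l)\<^sup>2)) (at l)"
      using DERIV_inverse[OF nz(1)[OF l], of UNIV] by (simp add: numeral_2_eq_2)
    ultimately have "((\<lambda>l. q (inverse l)) has_field_derivative Q (inverse l) * - ((inverse l)\<^sup>2)) (at l)"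
      by (rule DERIV_chain2)
    from DERIV_minus[OF this] show ?thesis
      using has_field_derivative_at_within by fastforce
  qed
  from contour_integral_primitive[OF this c'(1,3)]
  have i3: "((\<lambda>l. Q (inverse l) * (inverse l)\<^sup>2) has_contour_integral 0) c"
    using c' by simp
  have "((\<lambda>l. R l + P 0 * inverse l + Q (inverse l) * (inverse l)\<^sup>2) has_contour_integral
      0 + 2 * pi * \<i> * P 0 + 0) c"
    by (intro has_contour_integral_add i1 i2 i3)
  then have "((\<lambda>l. R l + P 0 * inverse l + Q (inverse l) * (inverse l)\<^sup>2) has_contour_integral
      2 * pi * \<i> * P 0) c"
    by simp
  then show ?thesis
  proof (rule has_contour_integral_eq)
    fix l assume "l \<in> path_image c"
    then have l: "l \<in> overlap U Uh" using c' by blast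
    then show "R l + P 0 * inverse l + Q (inverse l) * (inverse l)\<^sup>2 = h l"
      using h[OF l] nz[OF l] by (simp add: R_def field_simps)
  qed
qed

lemma origin_disc_power_series:
  assumes U: "origin_disc U" and P: "P holomorphic_on U"
  obtains a where "\<And>l. l \<in> U \<Longrightarrow> ((\<lambda>n. a n * l ^ n) has_sum P l) UNIV"
proof
  fix l assume l: "l \<in> U"
  let ?a = "\<lambda>n. (deriv ^^ n) P 0 / fact n"
  obtain R where R: "norm l < R" "ball 0 R \<subseteq> U"
    using U l unfolding origin_disc_def by (metis gt_ex mem_ball_0 order_refl subset_UNIV)
  have hol: "P holomorphic_on ball 0 R" using P R holomorphic_on_subset by blast
  obtain s where s: "norm l < s" "s < R" using R dense by blast
  then have s0: "s > 0" by (meson norm_ge_zero le_less_trans)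
  have "(\<lambda>n. ?a n * (of_real s - 0) ^ n) sums P (of_real s)"
    by (rule holomorphic_power_series[OF hol]) (use s s0 in auto)
  then have "summable (\<lambda>n. ?a n * of_real s ^ n)"
    by (simp add: sums_iff)
  then have "summable (\<lambda>n. norm (?a n * l ^ n))"
    by (rule powser_insidea) (use s s0 in simp)
  moreover have "(\<lambda>n. ?a n * (l - 0) ^ n) sums P l"
    by (rule holomorphic_power_series[OF hol]) (use R in auto)
  ultimately show "((\<lambda>n. ?a n * l ^ n) has_sum P l) UNIV"
    by (intro norm_summable_imp_has_sum) auto
qed

lemma Laurent_series:
  assumes cov: "covers_P1 U Uh" and P: "P holomorphic_on U" and Q: "Q holomorphic_on Uh"
  obtains \<gamma> :: "int \<Rightarrow> complex" where
    "\<And>l. l \<in> overlap U Uh \<Longrightarrow> ((\<lambda>n. \<gamma> n * l powi n) has_sum P l + Q (inverse l) * inverse l) UNIV"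
    "\<And>l. l \<in> U \<Longrightarrow> ((\<lambda>n. \<gamma> n * l powi n) has_sum P l - P 0) {1..}"
proof -
  have d: "origin_disc U" "origin_disc Uh" using cov unfolding covers_P1_def by auto
  obtain a where a: "\<And>l. l \<in> U \<Longrightarrow> ((\<lambda>n. a n * l ^ n) has_sum P l) UNIV"
    using origin_disc_power_series[OF d(1) P] by blast
  obtain b where b: "\<And>m. m \<in> Uh \<Longrightarrow> ((\<lambda>n. b n * m ^ n) has_sum Q m) UNIV"
    using origin_disc_power_series[OF d(2) Q] by blast
  define \<gamma> where "\<gamma> n = (if n \<ge> 0 then a (nat n) else b (nat (- n - 1)))" for n :: int
  have nonneg: "((\<lambda>n. \<gamma> n * l powi n) has_sum P l) {0..}" if "l \<in> U" for l
  proof -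
    have "((\<lambda>n. \<gamma> n * l powi n) \<circ> int has_sum P l) UNIV"
      using a[OF that] by (simp add: \<gamma>_def o_def power_int_def)
    then have "((\<lambda>n. \<gamma> n * l powi n) has_sum P l) (range int)"
      by (subst has_sum_reindex) auto
    moreover have "range int = {0..}"
      by (auto simp: image_iff intro: zero_le_imp_eq_int)
    ultimately show ?thesis by simp
  qed
  show thesis
  proof
    fix l assume "l \<in> overlap U Uh"
    then have l: "l \<in> U" "l \<noteq> 0" "inverse l \<in> Uh" by (auto simp: overlap_def)
    have "((\<lambda>n. b n * inverse l ^ n * inverse l) has_sum Q (inverse l) * inverse l) UNIV"
      by (rule has_sum_cmult_left[OF b[OF l(3)]])
    then have "((\<lambda>n. \<gamma> n * l powi n) \<circ> (\<lambda>n. - int n - 1) has_sum Q (inverse l) * inverse l) UNIV"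
    proof (rule has_sum_cong[THEN iffD1, rotated])
      fix n :: nat
      have "- int n - 1 = - int (Suc n)" by simp
      then have "l powi (- int n - 1) = inverse l ^ Suc n"
        by (simp only: power_int_minus power_int_of_nat power_inverse)
      then show "b n * inverse l ^ n * inverse l = ((\<lambda>n. \<gamma> n * l powi n) \<circ> (\<lambda>n. - int n - 1)) n"
        by (simp add: \<gamma>_def)
    qed
    then have "((\<lambda>n. \<gamma> n * l powi n) has_sum Q (inverse l) * inverse l) (range (\<lambda>n. - int n - 1))"
      by (subst has_sum_reindex) (auto intro: injI)
    moreover have "range (\<lambda>n. - int n - 1) = {..<0}"
    proof -
      have "k \<in> range (\<lambda>n. - int n - 1)" if "k < 0" for k
        by (rule range_eqI[of _ _ "nat (- k - 1)"]) (use that in auto)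
      then show ?thesis by auto
    qed
    ultimately have "((\<lambda>n. \<gamma> n * l powi n) has_sum P l + Q (inverse l) * inverse l) ({0..} \<union> {..<0})"
      by (intro has_sum_Un_disjoint nonneg l) auto
    moreover have "{0..} \<union> {..<0::int} = UNIV" by auto
    ultimately show "((\<lambda>n. \<gamma> n * l powi n) has_sum P l + Q (inverse l) * inverse l) UNIV" by simp
  next
    fix l assume l: "l \<in> U"
    have "((\<lambda>n. a n * 0 ^ n) has_sum P 0) UNIV"
      using a origin_disc_props(3)[OF d(1)] by blast
    moreover have "((\<lambda>n. a n * 0 ^ n) has_sum a 0) UNIV"
      by (rule has_sum_finite_neutralI[of "{0}"]) (auto simp: power_0_left)
    ultimately have "P 0 = a 0" by (rule infsumI[symmetric, THEN trans, OF _ infsumI])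
    moreover have "((\<lambda>n. \<gamma> n * l powi n) has_sum \<gamma> 0) {0}"
      by (rule has_sum_finiteI) auto
    ultimately have "((\<lambda>n. \<gamma> n * l powi n) has_sum P l - P 0) ({0..} - {0})"
      by (intro has_sum_Diff nonneg l) (auto simp: \<gamma>_def)
    moreover have "{0..} - {0} = {1::int..}" by auto
    ultimately show "((\<lambda>n. \<gamma> n * l powi n) has_sum P l - P 0) {1..}" by simp
  qed
qed

section \<open>The moduli space\<close>

lemma spinor_cases: "(A :: 2) = 0 \<or> A = 1"
  using exhaust_2[of A] by auto

lemma sum_spinor: "(\<Sum>A\<in>UNIV. F A) = F (0 :: 2) + F 1"
proof -
  have U: "UNIV = {0, 1 :: 2}" using spinor_cases by auto
  show ?thesis unfolding U by simp
qed

lemma sum_option: "(\<Sum>i\<in>UNIV. F i) = F None + (\<Sum>j\<in>UNIV. F (Some (j :: 'n::finite)))"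
proof -
  have "(\<Sum>i\<in>UNIV. F i) = F None + sum F (range Some)"
    by (simp add: UNIV_option_conv)
  also have "sum F (range Some) = (\<Sum>j\<in>UNIV. F (Some j))"
    by (simp add: sum.reindex)
  finally show ?thesis .
qed

lemma sum_moduli_ix:
  "(\<Sum>i\<in>UNIV. F i) = F None + F (Some (0, 0)) + F (Some (0, 1)) + F (Some (1, 0)) + F (Some (1 :: 2, 1 :: 2))"
proof -
  have "(\<Sum>j\<in>UNIV. F (Some j)) = (\<Sum>A\<in>UNIV. \<Sum>A'\<in>UNIV. F (Some (A, A')))"
    by (simp add: sum.cartesian_product)
  then show ?thesis by (simp add: sum_option sum_spinor add.assoc)
qed

definition Omega :: "moduli_pt \<Rightarrow> complex \<Rightarrow> complex ^ 2" where
  "Omega x l = (\<chi> A. x $ Some (A, 1) + x $ Some (A, 0) * l)"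

lemma holo_Omega:
  assumes "holo sA (*s) X S" "holoc sA L S"
  shows "holo sA (*s) (\<lambda>p. Omega (X p) (L p)) S"
proof (rule holo_vec)
  have "holoc sA (\<lambda>p. X p $ i) S" for i
    by (rule holo_compose[OF assms(1) holoc_nth[of i UNIV]]) simp
  then show "holoc sA (\<lambda>p. Omega (X p) (L p) $ A) S" for A
    by (simp add: Omega_def holoc_add holoc_mult assms(2))
qed

lemma holomorphic_vec_on_Omega: "holomorphic_vec_on (\<lambda>y. Omega y l $ A) S"
  unfolding holomorphic_vec_on_iff
  by (rule holo_compose[OF holo_Omega[OF holo_vec_id holoc_const] holoc_nth[of _ UNIV]]) simp

definition dOmega :: "2 \<Rightarrow> moduli_ix \<Rightarrow> complex \<Rightarrow> complex" where
  "dOmega A a l = (if a = Some (A, 1) then 1 else 0) + l * (if a = Some (A, 0) then 1 else 0)"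

lemma holomorphic_vec_on_nth: "holomorphic_vec_on (\<lambda>x. x $ i) S"
  by (simp add: holomorphic_vec_on_iff holoc_nth)

lemma holomorphic_vec_on_cmult: "holomorphic_vec_on F S \<Longrightarrow> holomorphic_vec_on (\<lambda>x. k * F x) S"
  by (simp add: holomorphic_vec_on_iff holoc_cmult)

lemma holomorphic_vec_on_add:
  "holomorphic_vec_on F S \<Longrightarrow> holomorphic_vec_on G S \<Longrightarrow> holomorphic_vec_on (\<lambda>x. F x + G x) S"
  by (simp add: holomorphic_vec_on_iff holoc_add)

lemma cpartial_Omega: "cpartial a (\<lambda>y. Omega y l $ A) x = dOmega A a l"
proof -
  have "cpartial a (\<lambda>y. Omega y l $ A) x = cpartial a (\<lambda>y. y $ Some (A, 1) + l * y $ Some (A, 0)) x"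
    by (simp add: Omega_def mult.commute)
  also have "\<dots> = cpartial a (\<lambda>y. y $ Some (A, 1)) x + cpartial a (\<lambda>y. l * y $ Some (A, 0)) x"
    by (rule cpartial_add[of _ UNIV]) (auto intro: holomorphic_vec_on_nth holomorphic_vec_on_cmult)
  also have "cpartial a (\<lambda>y. l * y $ Some (A, 0)) x = l * cpartial a (\<lambda>y. y $ Some (A, 0)) x"
    by (rule cpartial_mult_left[of _ UNIV]) (auto intro: holomorphic_vec_on_nth)
  finally show ?thesis by (auto simp: cpartial_nth dOmega_def)
qed

lemma dOmega_sum: "(\<Sum>a\<in>UNIV. dOmega A a l * v $ a) = v $ Some (A, 1) + l * v $ Some (A, 0)"
  using spinor_cases[of A] by (auto simp: sum_moduli_ix dOmega_def)

locale patched_fourfold =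
  fixes U Uh :: "complex set" and \<epsilon> :: complex and f :: "complex ^ 2 \<Rightarrow> complex \<Rightarrow> complex"
  assumes cover: "covers_P1 U Uh"
    and f_holomorphic: "jointly_holomorphic_on f (UNIV \<times> overlap U Uh)"
begin

definition df :: "2 \<Rightarrow> moduli_pt \<Rightarrow> complex \<Rightarrow> complex" where
  "df A x l = cpartial A (\<lambda>\<omega>. f \<omega> l) (Omega x l)"

lemma discs: "open U" "open Uh" "0 \<in> U" "0 \<in> Uh"
  using cover origin_disc_props unfolding covers_P1_def by auto

lemma overlapD: "l \<in> overlap U Uh \<Longrightarrow> l \<noteq> 0" "l \<in> overlap U Uh \<Longrightarrow> l \<in> U"
  "l \<in> overlap U Uh \<Longrightarrow> inverse l \<in> Uh"
  by (auto simp: overlap_def)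

lemma open_ov: "open (overlap U Uh)"
  by (rule open_overlap[OF cover])

lemma jointly_f_Omega: "jointly_holomorphic_on (\<lambda>x l. f (Omega x l) l) (UNIV \<times> overlap U Uh)"
  unfolding jointly_holomorphic_on_iff
  by (rule holoc_jointly_compose[OF f_holomorphic holo_Omega[OF holo_fst holoc_snd] holoc_snd]) auto

lemma jointly_df: "jointly_holomorphic_on (df A) (UNIV \<times> overlap U Uh)"
  unfolding jointly_holomorphic_on_iff df_def
  by (rule holoc_jointly_compose[OF jointly_holomorphic_on_cpartial[OF f_holomorphic open_ov]
        holo_Omega[OF holo_fst holoc_snd] holoc_snd]) auto

end

text \<open>\<open>P'\<close> and \<open>Q'\<close> are not derivatives of \<open>P\<close> and \<open>Q\<close>: they split the derivatives of \<open>f\<close>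
  along the fibres, which need not respect the splitting of \<open>f\<close>.\<close>

locale split_fourfold = patched_fourfold +
  fixes P Q :: "moduli_pt \<Rightarrow> complex \<Rightarrow> complex" and P' Q' :: "2 \<Rightarrow> moduli_pt \<Rightarrow> complex \<Rightarrow> complex"
  assumes P: "jointly_holomorphic_on P (UNIV \<times> U)" and Q: "jointly_holomorphic_on Q (UNIV \<times> Uh)"
    and split: "\<And>x l. l \<in> overlap U Uh \<Longrightarrow> f (Omega x l) l = P x l + Q x (inverse l) * inverse l"
    and P': "\<And>A. jointly_holomorphic_on (P' A) (UNIV \<times> U)"
    and Q': "\<And>A. jointly_holomorphic_on (Q' A) (UNIV \<times> Uh)"
    and split': "\<And>A x l. l \<in> overlap U Uh \<Longrightarrow> df A x l = P' A x l + Q' A x (inverse l) * inverse l"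
begin

abbreviation "GS \<equiv> global_sections U Uh \<epsilon> f"

definition sec :: "moduli_pt \<Rightarrow> complex \<Rightarrow> fibre_pt" where
  "sec x l = (\<chi> \<mu>. case \<mu> of None \<Rightarrow> x $ None - \<epsilon> * (P x l - P x 0) | Some A \<Rightarrow> Omega x l $ A)"

definition sech :: "moduli_pt \<Rightarrow> complex \<Rightarrow> fibre_pt" where
  "sech x m = (\<chi> \<mu>. case \<mu> of None \<Rightarrow> x $ None + \<epsilon> * (P x 0 + Q x m * m)
     | Some A \<Rightarrow> x $ Some (A, 1) * m + x $ Some (A, 0))"

lemma sec_simps: "sec x l $ None = x $ None - \<epsilon> * (P x l - P x 0)"
  "sec x l $ Some A = x $ Some (A, 1) + x $ Some (A, 0) * l"
  "(\<chi> A. sec x l $ Some A) = Omega x l"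
  by (simp_all add: sec_def Omega_def vec_eq_iff)

lemma sech_simps: "sech x m $ None = x $ None + \<epsilon> * (P x 0 + Q x m * m)"
  "sech x m $ Some A = x $ Some (A, 1) * m + x $ Some (A, 0)"
  by (simp_all add: sech_def)

lemma sec_jointly: "jointly_holomorphic_on (\<lambda>x l. sec x l $ \<mu>) (UNIV \<times> U)"
proof (cases \<mu>)
  case None
  have "holoc pair_scale (\<lambda>q. P (fst q) 0) (UNIV \<times> U)"
    by (rule holoc_jointly_compose[OF P holo_fst holoc_const]) (use discs in auto)
  then show ?thesis
    using P unfolding None sec_simps jointly_holomorphic_on_iff
    by (intro holoc_diff holoc_fst_nth holoc_cmult)
next
  case (Some A)
  show ?thesis
    unfolding Some sec_simps jointly_holomorphic_on_iff
    by (intro holoc_add holoc_fst_nth holoc_mult holoc_snd)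
qed

lemma sech_jointly: "jointly_holomorphic_on (\<lambda>x m. sech x m $ \<mu>) (UNIV \<times> Uh)"
proof (cases \<mu>)
  case None
  have "holoc pair_scale (\<lambda>q. P (fst q) 0) (UNIV \<times> Uh)"
    by (rule holoc_jointly_compose[OF P holo_fst holoc_const]) (use discs in auto)
  then show ?thesis
    using Q unfolding None sech_simps jointly_holomorphic_on_iff
    by (intro holoc_add holoc_fst_nth holoc_cmult holoc_mult holoc_snd)
next
  case (Some A)
  show ?thesis
    unfolding Some sech_simps jointly_holomorphic_on_iff
    by (intro holoc_add holoc_fst_nth holoc_mult holoc_snd)
qed

lemma sech_patch:
  assumes "l \<in> overlap U Uh"
  shows "sech x (inverse l) = patch \<epsilon> f l (sec x l)"
  unfolding vec_eq_iff
proof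
  fix \<mu> :: "2 option"
  show "sech x (inverse l) $ \<mu> = patch \<epsilon> f l (sec x l) $ \<mu>"
  proof (cases \<mu>)
    case None
    then show ?thesis
      by (simp add: patch_def sec_simps(1,3) sech_simps split[OF assms, of x] algebra_simps)
  next
    case (Some A)
    then show ?thesis
      using overlapD[OF assms] by (simp add: patch_def sec_simps(2) sech_simps field_simps)
  qed
qed

definition pair_at :: "moduli_pt \<Rightarrow> (complex \<Rightarrow> fibre_pt) \<times> (complex \<Rightarrow> fibre_pt)" where
  "pair_at x = (restrict (sec x) U, restrict (sech x) Uh)"

lemma pair_at_in: "pair_at x \<in> GS"
proof -
  have "(\<lambda>l. restrict (sec x) U l $ \<mu>) holomorphic_on U" for \<mu>
    by (rule holomorphic_transform[OF jointly_holomorphic_on_slice[OF sec_jointly discs(1)]]) simp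
  moreover have "(\<lambda>m. restrict (sech x) Uh m $ \<mu>) holomorphic_on Uh" for \<mu>
    by (rule holomorphic_transform[OF jointly_holomorphic_on_slice[OF sech_jointly discs(2)]]) simp
  ultimately show ?thesis
    unfolding global_sections_def pair_at_def by (auto simp: overlapD sech_patch)
qed

lemma moduli_coords_pair_at: "moduli_coords (pair_at x) = x"
proof -
  have "deriv (\<lambda>l. restrict (sec x) U l $ Some A) 0 = x $ Some (A, 0)" for A
  proof (rule DERIV_imp_deriv, rule has_field_derivative_transform_within_open)
    show "((\<lambda>l. x $ Some (A, 1) + x $ Some (A, 0) * l) has_field_derivative x $ Some (A, 0)) (at 0)"
      by (auto intro!: derivative_eq_intros)
  qed (use discs in \<open>auto simp: sec_simps\<close>)
  moreover have "A' = 0" if "A' \<noteq> 1" for A' :: 2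
    using that spinor_cases by blast
  ultimately show ?thesis
    using discs unfolding moduli_coords_def pair_at_def
    by (auto simp: vec_eq_iff sec_simps split: option.split)
qed

text \<open>By Liouville's theorem, applied first to \<open>\<Omega>\<^sup>A\<close> and then to \<open>T\<close> corrected by the
  splitting of \<open>f\<close>.\<close>

lemma pair_at_moduli_coords:
  assumes "p \<in> GS"
  shows "pair_at (moduli_coords p) = p"
proof -
  obtain s sh where p: "p = (s, sh)" by force
  from assms p have ext: "s \<in> extensional U" "sh \<in> extensional Uh"
    and hol: "\<And>\<mu>. (\<lambda>l. s l $ \<mu>) holomorphic_on U" "\<And>\<mu>. (\<lambda>m. sh m $ \<mu>) holomorphic_on Uh"
    and pt: "\<And>l. l \<in> overlap U Uh \<Longrightarrow> sh (inverse l) = patch \<epsilon> f l (s l)"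
    unfolding global_sections_def by auto
  define x where "x = moduli_coords p"
  have x: "x $ None = s 0 $ None" "x $ Some (A, 1) = s 0 $ Some A"
    "x $ Some (A, 0) = deriv (\<lambda>l. s l $ Some A) 0" for A
    by (simp_all add: x_def moduli_coords_def p)
  have ptS: "inverse l * s l $ Some A = sh (inverse l) $ Some A" if "l \<in> overlap U Uh" for l A
    using pt[OF that] by (simp add: patch_def)
  have SA: "s l $ Some A = sec x l $ Some A" if "l \<in> U" for l A
    using glue_linear(1)[OF cover hol(1) hol(2) ptS that] by (simp add: sec_simps x)
  have ShA: "sh m $ Some A = sech x m $ Some A" if "m \<in> Uh" for m A
    using glue_linear(2)[OF cover hol(1) hol(2) ptS that] by (simp add: sech_simps x)
  have Om: "(\<chi> A. s l $ Some A) = Omega x l" if "l \<in> U" for l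
    using SA[OF that] by (simp add: Omega_def sec_simps)
  let ?p = "\<lambda>l. s l $ None + \<epsilon> * P x l" and ?q = "\<lambda>m. sh m $ None - \<epsilon> * (Q x m * m)"
  have hp: "?p holomorphic_on U"
    by (intro holomorphic_intros hol jointly_holomorphic_on_slice[OF P discs(1)])
  have hq: "?q holomorphic_on Uh"
    by (intro holomorphic_intros hol jointly_holomorphic_on_slice[OF Q discs(2)])
  have pq: "?p l = ?q (inverse l)" if "l \<in> overlap U Uh" for l
    using pt[OF that] Om[OF overlapD(2)[OF that]] split[OF that, of x]
    by (simp add: patch_def algebra_simps)
  have SN: "s l $ None = sec x l $ None" if "l \<in> U" for l
    using glue_constant(1)[OF cover hp hq pq that] by (simp add: sec_simps x algebra_simps)
  have ShN: "sh m $ None = sech x m $ None" if "m \<in> Uh" for m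
    using glue_constant(2)[OF cover hp hq pq that] by (simp add: sech_simps x algebra_simps)
  have "s l = sec x l" if "l \<in> U" for l
    unfolding vec_eq_iff
  proof
    show "s l $ \<mu> = sec x l $ \<mu>" for \<mu> by (cases \<mu>) (simp_all add: SN SA that)
  qed
  then have "restrict (sec x) U = s"
    using ext by (intro extensionalityI[of _ U]) auto
  moreover have "sh m = sech x m" if "m \<in> Uh" for m
    unfolding vec_eq_iff
  proof
    show "sh m $ \<mu> = sech x m $ \<mu>" for \<mu> by (cases \<mu>) (simp_all add: ShN ShA that)
  qed
  then have "restrict (sech x) Uh = sh"
    using ext by (intro extensionalityI[of _ Uh]) auto
  ultimately show ?thesis unfolding x_def[symmetric] by (simp add: pair_at_def p)
qed

lemma bij_moduli_coords: "bij_betw moduli_coords GS UNIV"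
  by (rule bij_betw_byWitness[of _ pair_at])
     (auto simp: pair_at_moduli_coords moduli_coords_pair_at pair_at_in)

lemma section_at_eq: "section_at U Uh \<epsilon> f x = pair_at x"
  unfolding section_at_def
  using inv_into_f_f[OF bij_betw_imp_inj_on[OF bij_moduli_coords] pair_at_in]
  by (simp add: moduli_coords_pair_at)

lemma w_res_eq: "l \<in> U \<Longrightarrow> w_res U Uh \<epsilon> f x l = sec x l"
  by (simp add: w_res_def section_at_eq pair_at_def)

lemma wh_res_eq: "m \<in> Uh \<Longrightarrow> wh_res U Uh \<epsilon> f x m = sech x m"
  by (simp add: wh_res_def section_at_eq pair_at_def)

lemma complex_manifold_global_sections: "complex_manifold GS {(GS, moduli_coords)}"
proof -
  have im: "moduli_coords ` GS = UNIV" and inj: "inj_on moduli_coords GS"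
    using bij_moduli_coords by (auto simp: bij_betw_def)
  have tr: "holomorphic_vec_on (\<lambda>y. moduli_coords (inv_into GS moduli_coords y) $ i) UNIV" for i
    by (simp add: f_inv_into_f im holomorphic_vec_on_nth)
  have sep: "\<exists>V W. open V \<and> open W \<and> moduli_coords p \<in> V \<and> moduli_coords q \<in> W \<and>
      {z \<in> GS. moduli_coords z \<in> V} \<inter> {z \<in> GS. moduli_coords z \<in> W} = {}"
    if "p \<in> GS" "q \<in> GS" "p \<noteq> q" for p q
  proof -
    have "moduli_coords p \<noteq> moduli_coords q" using that inj by (auto dest: inj_onD)
    then obtain V W where "open V" "open W" "moduli_coords p \<in> V" "moduli_coords q \<in> W" "V \<inter> W = {}"
      by (rule hausdorff[THEN exE]) blast
    then show ?thesis by (intro exI[of _ V] exI[of _ W]) auto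
  qed
  show ?thesis
    unfolding complex_manifold_def
    using im inj tr sep by auto
qed

end

section \<open>The normal bundle\<close>

lemma cpartial_cong: "(\<And>y. F y = G y) \<Longrightarrow> cpartial a F x = cpartial a G x"
  by (simp add: cpartial_def)

context split_fourfold
begin

definition dP :: "moduli_ix \<Rightarrow> moduli_pt \<Rightarrow> complex \<Rightarrow> complex" where
  "dP a x l = cpartial a (\<lambda>y. P y l) x"

definition dQ :: "moduli_ix \<Rightarrow> moduli_pt \<Rightarrow> complex \<Rightarrow> complex" where
  "dQ a x m = cpartial a (\<lambda>y. Q y m) x"

definition dwh :: "moduli_pt \<Rightarrow> complex \<Rightarrow> complex ^ moduli_ix ^ (2 option)" where
  "dwh x m = (\<chi> \<mu> a. cpartial a (\<lambda>y. sech y m $ \<mu>) x)"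

abbreviation "dw \<equiv> dw_res U Uh \<epsilon> f"
abbreviation "NP \<equiv> normal_patching U Uh \<epsilon> f"

lemma dw_eq: "l \<in> U \<Longrightarrow> dw x l $ \<mu> $ a = cpartial a (\<lambda>y. sec y l $ \<mu>) x"
  by (simp add: dw_res_def w_res_eq)

lemma dP_jointly: "jointly_holomorphic_on (dP a) (UNIV \<times> U)"
  unfolding dP_def by (rule jointly_holomorphic_on_cpartial[OF P discs(1)])

lemma dQ_jointly: "jointly_holomorphic_on (dQ a) (UNIV \<times> Uh)"
  unfolding dQ_def by (rule jointly_holomorphic_on_cpartial[OF Q discs(2)])

lemma dw_None:
  assumes "l \<in> U"
  shows "dw x l $ None $ a = (if a = None then 1 else 0) - \<epsilon> * (dP a x l - dP a x 0)"
proof -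
  have h: "holomorphic_vec_on (\<lambda>y. P y l) UNIV" if "l \<in> U" for l
    by (rule jointly_holomorphic_on_vec[OF P that])
  note hs = h[OF assms] h[OF discs(3)]
  have "dw x l $ None $ a = cpartial a (\<lambda>y. y $ None + (- \<epsilon>) * (P y l + (-1) * P y 0)) x"
    unfolding dw_eq[OF assms] by (rule cpartial_cong) (simp add: sec_simps)
  also have "\<dots> = cpartial a (\<lambda>y. y $ None) x + cpartial a (\<lambda>y. (- \<epsilon>) * (P y l + (-1) * P y 0)) x"
    by (rule cpartial_add[of _ UNIV]) (intro holomorphic_vec_on_nth holomorphic_vec_on_cmult holomorphic_vec_on_add hs UNIV_I)+
  also have "cpartial a (\<lambda>y. (- \<epsilon>) * (P y l + (-1) * P y 0)) x = - \<epsilon> * cpartial a (\<lambda>y. P y l + (-1) * P y 0) x"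
    by (rule cpartial_mult_left[of _ UNIV]) (intro holomorphic_vec_on_cmult holomorphic_vec_on_add hs UNIV_I)+
  also have "cpartial a (\<lambda>y. P y l + (-1) * P y 0) x = dP a x l + cpartial a (\<lambda>y. (-1) * P y 0) x"
    unfolding dP_def
    by (rule cpartial_add[of _ UNIV]) (intro holomorphic_vec_on_cmult hs UNIV_I)+
  also have "cpartial a (\<lambda>y. (-1) * P y 0) x = - dP a x 0"
    unfolding dP_def by (subst cpartial_mult_left[of _ UNIV]) (use hs in auto)
  finally show ?thesis by (auto simp: cpartial_nth)
qed

lemma dw_Some: "l \<in> U \<Longrightarrow> dw x l $ Some A $ a = dOmega A a l"
  unfolding dw_eq by (simp add: sec_def cpartial_Omega)

lemma dwh_None:
  assumes "m \<in> Uh"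
  shows "dwh x m $ None $ a = (if a = None then 1 else 0) + \<epsilon> * (dP a x 0 + m * dQ a x m)"
proof -
  have h: "holomorphic_vec_on (\<lambda>y. P y 0) UNIV" "holomorphic_vec_on (\<lambda>y. Q y m) UNIV"
    by (rule jointly_holomorphic_on_vec[OF P discs(3)], rule jointly_holomorphic_on_vec[OF Q assms])
  have "dwh x m $ None $ a = cpartial a (\<lambda>y. y $ None + \<epsilon> * (P y 0 + m * Q y m)) x"
    unfolding dwh_def vec_lambda_beta by (rule cpartial_cong) (simp add: sech_simps mult.commute)
  also have "\<dots> = cpartial a (\<lambda>y. y $ None) x + cpartial a (\<lambda>y. \<epsilon> * (P y 0 + m * Q y m)) x"
    by (rule cpartial_add[of _ UNIV]) (intro holomorphic_vec_on_nth holomorphic_vec_on_cmult holomorphic_vec_on_add h UNIV_I)+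
  also have "cpartial a (\<lambda>y. \<epsilon> * (P y 0 + m * Q y m)) x = \<epsilon> * cpartial a (\<lambda>y. P y 0 + m * Q y m) x"
    by (rule cpartial_mult_left[of _ UNIV]) (intro holomorphic_vec_on_cmult holomorphic_vec_on_add h UNIV_I)+
  also have "cpartial a (\<lambda>y. P y 0 + m * Q y m) x = dP a x 0 + cpartial a (\<lambda>y. m * Q y m) x"
    unfolding dP_def
    by (rule cpartial_add[of _ UNIV]) (intro holomorphic_vec_on_cmult h UNIV_I)+
  also have "cpartial a (\<lambda>y. m * Q y m) x = m * dQ a x m"
    unfolding dQ_def by (rule cpartial_mult_left[OF h(2)]) simp
  finally show ?thesis by (auto simp: cpartial_nth)
qed

lemma dwh_Some:
  assumes "l \<noteq> 0"
  shows "dwh x (inverse l) $ Some A $ a = inverse l * dOmega A a l"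
proof -
  have "dwh x (inverse l) $ Some A $ a = cpartial a (\<lambda>y. inverse l * Omega y l $ A) x"
    unfolding dwh_def vec_lambda_beta
    by (rule cpartial_cong) (use assms in \<open>simp add: sech_simps Omega_def field_simps\<close>)
  also have "\<dots> = inverse l * cpartial a (\<lambda>y. Omega y l $ A) x"
    by (rule cpartial_mult_left[OF holomorphic_vec_on_Omega UNIV_I])
  finally show ?thesis by (simp add: cpartial_Omega)
qed

lemma cpartial_f_Omega:
  assumes "l \<in> overlap U Uh"
  shows "cpartial a (\<lambda>y. f (Omega y l) l) x = (\<Sum>A\<in>UNIV. df A x l * dOmega A a l)"
  using cpartial_chain[OF jointly_holomorphic_on_vec[OF f_holomorphic assms] holomorphic_vec_on_Omega,
      where x = x and a = a and S = UNIV]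
  by (simp add: df_def cpartial_Omega)

lemma split_d:
  assumes "l \<in> overlap U Uh"
  shows "(\<Sum>A\<in>UNIV. df A x l * dOmega A a l) = dP a x l + inverse l * dQ a x (inverse l)"
proof -
  have h: "holomorphic_vec_on (\<lambda>y. P y l) UNIV" "holomorphic_vec_on (\<lambda>y. Q y (inverse l)) UNIV"
    by (rule jointly_holomorphic_on_vec[OF P] jointly_holomorphic_on_vec[OF Q]; use overlapD[OF assms] in simp)+
  have "cpartial a (\<lambda>y. f (Omega y l) l) x = cpartial a (\<lambda>y. P y l + inverse l * Q y (inverse l)) x"
    by (rule cpartial_cong) (simp add: split[OF assms] mult.commute)
  also have "\<dots> = dP a x l + cpartial a (\<lambda>y. inverse l * Q y (inverse l)) x"
    unfolding dP_def by (rule cpartial_add[of _ UNIV]) (intro holomorphic_vec_on_cmult h UNIV_I)+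
  also have "cpartial a (\<lambda>y. inverse l * Q y (inverse l)) x = inverse l * dQ a x (inverse l)"
    unfolding dQ_def by (rule cpartial_mult_left[OF h(2)]) simp
  finally show ?thesis using cpartial_f_Omega[OF assms] by simp
qed

lemma NP_Some:
  "NP x l $ Some A $ \<nu> = (if \<nu> = Some A then inverse l else 0)"
proof -
  have "NP x l $ Some A $ \<nu> = inverse l * cpartial \<nu> (\<lambda>w. w $ Some A) (w_res U Uh \<epsilon> f x l)"
    unfolding normal_patching_def patch_def
    by (simp, rule cpartial_mult_left[of _ UNIV]) (auto intro: holomorphic_vec_on_nth)
  then show ?thesis by (auto simp: cpartial_nth)
qed

lemma NP_None:
  assumes "l \<in> overlap U Uh"
  shows "NP x l $ None $ \<nu> = (case \<nu> of None \<Rightarrow> 1 | Some A \<Rightarrow> \<epsilon> * df A x l)"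
proof -
  let ?w = "w_res U Uh \<epsilon> f x l" and ?G = "\<lambda>w :: fibre_pt. \<chi> A. w $ Some A"
  have G: "holomorphic_vec_on (\<lambda>w. ?G w $ A) UNIV" for A
    by (simp add: holomorphic_vec_on_nth)
  have F: "holomorphic_vec_on (\<lambda>\<omega>. f \<omega> l) UNIV"
    by (rule jointly_holomorphic_on_vec[OF f_holomorphic assms])
  have FG: "holomorphic_vec_on (\<lambda>w. f (?G w) l) UNIV"
    using F unfolding holomorphic_vec_on_iff
    by (rule holo_compose[rotated]) (auto intro!: holo_vec holoc_nth)
  have Gw: "?G ?w = Omega x l"
    using w_res_eq[OF overlapD(2)[OF assms]] by (simp add: sec_simps(3))
  have "NP x l $ None $ \<nu> = cpartial \<nu> (\<lambda>w. w $ None + \<epsilon> * f (?G w) l) ?w"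
    by (simp add: normal_patching_def patch_def)
  also have "\<dots> = cpartial \<nu> (\<lambda>w. w $ None) ?w + cpartial \<nu> (\<lambda>w. \<epsilon> * f (?G w) l) ?w"
    by (rule cpartial_add[of _ UNIV]) (intro holomorphic_vec_on_nth holomorphic_vec_on_cmult FG UNIV_I)+
  also have "cpartial \<nu> (\<lambda>w. \<epsilon> * f (?G w) l) ?w = \<epsilon> * cpartial \<nu> (\<lambda>w. f (?G w) l) ?w"
    by (rule cpartial_mult_left[OF FG]) simp
  also have "cpartial \<nu> (\<lambda>w. f (?G w) l) ?w = (\<Sum>A\<in>UNIV. df A x l * (if Some A = \<nu> then 1 else 0))"
    by (subst cpartial_chain[OF F G]) (simp_all add: df_def cpartial_nth Gw)
  finally show ?thesis
    by (cases \<nu>) (auto simp: cpartial_nth if_distrib cong: if_cong)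
qed

lemma NP_mult_None:
  assumes "l \<in> overlap U Uh"
  shows "(NP x l *v s) $ None = s $ None + \<epsilon> * (\<Sum>A\<in>UNIV. df A x l * s $ Some A)"
  by (simp add: matrix_vector_mult_def sum_option NP_None[OF assms] sum_distrib_left mult.assoc)

lemma NP_mult_Some: "(NP x l *v s) $ Some A = inverse l * s $ Some A"
  by (simp add: matrix_vector_mult_def NP_Some if_distrib[of "\<lambda>c. c * _"] cong: if_cong)

lemma matrix_mult_nth_nth: "(M ** N) $ i $ j = (M *v column j N) $ i"
  by (simp add: matrix_matrix_mult_def matrix_vector_mult_def column_def)

lemma NP_dw:
  assumes "l \<in> overlap U Uh"
  shows "NP x l ** dw x l = dwh x (inverse l)"
  unfolding vec_eq_iff
proof (intro allI)
  fix \<mu> :: "2 option" and a :: moduli_ix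
  note U = overlapD(2)[OF assms]
  show "(NP x l ** dw x l) $ \<mu> $ a = dwh x (inverse l) $ \<mu> $ a"
  proof (cases \<mu>)
    case None
    have "(\<Sum>A\<in>UNIV. df A x l * dw x l $ Some A $ a) = dP a x l + inverse l * dQ a x (inverse l)"
      using split_d[OF assms, of x a] by (simp add: dw_Some[OF U])
    then show ?thesis
      unfolding None matrix_mult_nth_nth NP_mult_None[OF assms]
      by (simp add: column_def dw_None[OF U] dwh_None[OF overlapD(3)[OF assms]] algebra_simps)
  next
    case (Some A)
    then show ?thesis
      unfolding Some matrix_mult_nth_nth NP_mult_Some
      by (simp add: column_def dw_Some[OF U] dwh_Some[OF overlapD(1)[OF assms]])
  qed
qed

lemma dw_jointly: "jointly_holomorphic_on (\<lambda>x l. dw x l $ \<mu> $ a) (UNIV \<times> U)"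
  using jointly_holomorphic_on_cpartial[OF sec_jointly[of \<mu>] discs(1), of a]
  unfolding jointly_holomorphic_on_iff
  by (rule holo_transform_open) (auto simp: dw_eq intro!: open_Times discs)

lemma dwh_jointly: "jointly_holomorphic_on (\<lambda>x m. dwh x m $ \<mu> $ a) (UNIV \<times> Uh)"
  using jointly_holomorphic_on_cpartial[OF sech_jointly[of \<mu>] discs(2), of a]
  by (simp add: dwh_def)

lemma dw_mult_None:
  assumes "l \<in> U"
  shows "(dw x l *v v) $ None = v $ None - \<epsilon> * (\<Sum>a\<in>UNIV. (dP a x l - dP a x 0) * v $ a)"
proof -
  have "(dw x l *v v) $ None =
      (\<Sum>a\<in>UNIV. (if a = None then v $ a else 0) - \<epsilon> * ((dP a x l - dP a x 0) * v $ a))"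
    by (auto intro!: sum.cong simp: matrix_vector_mult_def dw_None[OF assms] algebra_simps)
  then show ?thesis
    by (simp only: sum_subtractf sum_distrib_left[symmetric]) simp
qed

lemma dw_mult_Some:
  "l \<in> U \<Longrightarrow> (dw x l *v v) $ Some A = v $ Some (A, 1) + l * v $ Some (A, 0)"
  by (simp add: matrix_vector_mult_def dw_Some dOmega_sum)

lemma dw_kernel:
  assumes "\<And>l. l \<in> U \<Longrightarrow> dw x l *v v = 0"
  shows "v = 0"
proof -
  obtain r s where rs: "0 < r" "r < s" "cball 0 s \<subseteq> U" "cball 0 (inverse r) \<subseteq> Uh"
    using covers_P1_radii[OF cover] by blast
  then have s: "of_real s \<in> U" "of_real s \<noteq> (0::complex)" by (auto simp: subset_iff)
  have N: "v $ None = 0"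
    using dw_mult_None[OF discs(3), of x v] assms[OF discs(3)] by simp
  have 1: "v $ Some (A, 1) = 0" for A
    using dw_mult_Some[OF discs(3), of x v A] assms[OF discs(3)] by simp
  have 0: "v $ Some (A, 0) = 0" for A
    using dw_mult_Some[OF s(1), of x v A] assms[OF s(1)] 1[of A] s(2) by simp
  have "v $ i = 0" for i
  proof (cases i)
    case (Some B)
    obtain A A' where "B = (A, A')" by force
    then show ?thesis using Some 0[of A] 1[of A] spinor_cases[of A'] by auto
  qed (simp add: N)
  then show ?thesis by (simp add: vec_eq_iff)
qed

lemma kodaira_iso_at: "kodaira_iso_at U Uh \<epsilon> f x"
  unfolding kodaira_iso_at_def bij_betw_def
proof
  let ?\<phi> = "\<lambda>v. restrict (\<lambda>l. dw x l *v v) U"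
  show "inj ?\<phi>"
  proof
    fix v v' assume eq: "?\<phi> v = ?\<phi> v'"
    have "dw x l *v (v - v') = 0" if "l \<in> U" for l
      using fun_cong[OF eq, of l] that by (simp add: matrix_vector_mult_diff_distrib)
    then show "v = v'" using dw_kernel by (metis eq_iff_diff_eq_0)
  qed
  show "range ?\<phi> = fst ` normal_sections U Uh \<epsilon> f x"
  proof (intro set_eqI iffI)
    fix s assume "s \<in> range ?\<phi>"
    then obtain v where s: "s = ?\<phi> v" by blast
    let ?sh = "restrict (\<lambda>m. dwh x m *v v) Uh"
    have "(\<lambda>l. s l $ \<mu>) holomorphic_on U" for \<mu>
    proof (rule holomorphic_transform)
      show "(\<lambda>l. \<Sum>a\<in>UNIV. dw x l $ \<mu> $ a * v $ a) holomorphic_on U"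
        by (intro holomorphic_intros jointly_holomorphic_on_slice[OF dw_jointly discs(1)])
    qed (simp add: s matrix_vector_mult_def)
    moreover have "(\<lambda>m. ?sh m $ \<mu>) holomorphic_on Uh" for \<mu>
    proof (rule holomorphic_transform)
      show "(\<lambda>m. \<Sum>a\<in>UNIV. dwh x m $ \<mu> $ a * v $ a) holomorphic_on Uh"
        by (intro holomorphic_intros jointly_holomorphic_on_slice[OF dwh_jointly discs(2)])
    qed (simp add: matrix_vector_mult_def)
    moreover have "?sh (inverse l) = NP x l *v s l" if "l \<in> overlap U Uh" for l
      using NP_dw[OF that, of x] overlapD[OF that] by (simp add: s matrix_vector_mul_assoc)
    moreover have "s \<in> extensional U" "?sh \<in> extensional Uh" by (auto simp: s)
    ultimately have "(s, ?sh) \<in> normal_sections U Uh \<epsilon> f x"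
      unfolding normal_sections_def by blast
    then show "s \<in> fst ` normal_sections U Uh \<epsilon> f x" by force
  next
    fix s assume "s \<in> fst ` normal_sections U Uh \<epsilon> f x"
    then obtain sh where sh: "(s, sh) \<in> normal_sections U Uh \<epsilon> f x" by force
    then have ext: "s \<in> extensional U"
      and hol: "\<And>\<mu>. (\<lambda>l. s l $ \<mu>) holomorphic_on U" "\<And>\<mu>. (\<lambda>m. sh m $ \<mu>) holomorphic_on Uh"
      and pt: "\<And>l. l \<in> overlap U Uh \<Longrightarrow> sh (inverse l) = NP x l *v s l"
      unfolding normal_sections_def by auto
    define v :: moduli_pt where "v = (\<chi> i. case i of None \<Rightarrow> s 0 $ None
      | Some (A, A') \<Rightarrow> if A' = 1 then s 0 $ Some A else deriv (\<lambda>l. s l $ Some A) 0)"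
    have SA: "s l $ Some A = (dw x l *v v) $ Some A" if "l \<in> U" for l A
      using glue_linear(1)[OF cover hol(1) hol(2)[of "Some A"] _ that] pt
      by (simp add: NP_mult_Some dw_mult_Some that v_def mult.commute)
    let ?p = "\<lambda>l. s l $ None + \<epsilon> * (\<Sum>a\<in>UNIV. dP a x l * v $ a)"
    let ?q = "\<lambda>m. sh m $ None - \<epsilon> * (\<Sum>a\<in>UNIV. m * dQ a x m * v $ a)"
    have hp: "?p holomorphic_on U"
      by (intro holomorphic_intros hol jointly_holomorphic_on_slice[OF dP_jointly discs(1)])
    have hq: "?q holomorphic_on Uh"
      by (intro holomorphic_intros hol jointly_holomorphic_on_slice[OF dQ_jointly discs(2)])
    have pq: "?p l = ?q (inverse l)" if l: "l \<in> overlap U Uh" for l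
    proof -
      have "(\<Sum>A\<in>UNIV. df A x l * s l $ Some A) = (\<Sum>A\<in>UNIV. \<Sum>a\<in>UNIV. df A x l * dOmega A a l * v $ a)"
        using overlapD(2)[OF l]
        by (simp add: SA matrix_vector_mult_def dw_Some sum_distrib_left mult.assoc)
      also have "\<dots> = (\<Sum>a\<in>UNIV. (\<Sum>A\<in>UNIV. df A x l * dOmega A a l) * v $ a)"
        by (subst sum.swap) (simp only: sum_distrib_right)
      also have "\<dots> = (\<Sum>a\<in>UNIV. dP a x l * v $ a) + (\<Sum>a\<in>UNIV. inverse l * dQ a x (inverse l) * v $ a)"
        by (simp only: split_d[OF l] distrib_right sum.distrib)
      finally show ?thesis
        using pt[OF l] by (simp add: NP_mult_None[OF l] algebra_simps)
    qed
    have SN: "s l $ None = (dw x l *v v) $ None" if "l \<in> U" for l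
    proof -
      have "?p l = ?p 0" by (rule glue_constant(1)[OF cover hp hq pq that])
      moreover have "v $ None = s 0 $ None" by (simp add: v_def)
      ultimately show ?thesis
        by (simp add: dw_mult_None[OF that] left_diff_distrib sum_subtractf algebra_simps)
    qed
    have "s l = dw x l *v v" if "l \<in> U" for l
      unfolding vec_eq_iff
    proof
      show "s l $ \<mu> = (dw x l *v v) $ \<mu>" for \<mu> by (cases \<mu>) (simp_all add: SN SA that)
    qed
    then have "s = ?\<phi> v"
      using ext by (intro extensionalityI[of _ U]) auto
    then show "s \<in> range ?\<phi>" by blast
  qed
qed

end

section \<open>Frames and Galilean structures\<close>

lemma matrix_inv_mult:
  assumes "invertible A"
  shows "A ** matrix_inv A = mat 1" "matrix_inv A ** A = mat 1"
  using someI_ex[OF assms[unfolded invertible_def]] unfolding matrix_inv_def by auto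

lemma matrix_inv_eqI:
  fixes A B :: "'a::field ^ 'n ^ 'n"
  assumes "B ** A = mat 1"
  shows "invertible A" "matrix_inv A = B"
proof -
  show inv: "invertible A" using assms invertible_left_inverse by blast
  have "matrix_inv A = (B ** A) ** matrix_inv A" by (simp add: assms)
  also have "\<dots> = B" by (simp add: matrix_inv_mult(1)[OF inv] flip: matrix_mul_assoc)
  finally show "matrix_inv A = B" .
qed

lemma matrix_vector_mult_axis: "(A :: 'a::semiring_1 ^ 'n ^ 'm) *v axis k 1 = column k A"
  by (simp add: vec_eq_iff matrix_vector_mult_def column_def axis_def if_distrib cong: if_cong)

lemma matrix_vector_mult_vector_scalar: "(A :: 'a::comm_semiring_1 ^ 'n ^ 'm) *v (c *s x) = c *s (A *v x)"
  by (simp add: vec_eq_iff matrix_vector_mult_def sum_distrib_left mult_ac)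

lemma holoc_det:
  fixes M :: "'a::real_normed_vector \<Rightarrow> complex ^ 'n ^ 'n"
  assumes "\<And>i j. holoc sA (\<lambda>x. M x $ i $ j) S"
  shows "holoc sA (\<lambda>x. det (M x)) S"
  unfolding det_def by (intro holoc_sum holoc_mult holoc_const holoc_prod assms)

lemma holoc_matrix_inv:
  fixes M :: "'a::real_normed_vector \<Rightarrow> complex ^ 'n ^ 'n"
  assumes M: "\<And>i j. holoc sA (\<lambda>x. M x $ i $ j) S" and inv: "\<And>x. x \<in> S \<Longrightarrow> invertible (M x)"
    and S: "open S"
  shows "holoc sA (\<lambda>x. matrix_inv (M x) $ k $ c) S"
proof -
  let ?N = "\<lambda>x. \<chi> i j. if j = k then axis c 1 $ i else M x $ i $ j"
  have N: "holoc sA (\<lambda>x. det (?N x)) S"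
  proof (rule holoc_det)
    show "holoc sA (\<lambda>x. ?N x $ i $ j) S" for i j
      by (cases "j = k") (simp_all add: holoc_const M)
  qed
  have "holoc sA (\<lambda>x. det (?N x) / det (M x)) S"
    by (rule holoc_divide[OF N holoc_det[OF M]]) (use inv invertible_det_nz in blast)
  then show ?thesis
  proof (rule holo_transform_open[OF _ S])
    fix x assume "x \<in> S"
    then have i: "invertible (M x)" and d: "det (M x) \<noteq> 0" using inv invertible_det_nz by auto
    have "M x *v (matrix_inv (M x) *v axis c 1) = axis c 1"
      by (simp add: matrix_vector_mul_assoc matrix_inv_mult[OF i])
    then have "matrix_inv (M x) *v axis c 1 = (\<chi> k. det (\<chi> i j. if j = k then axis c 1 $ i else M x $ i $ j) / det (M x))"
      using cramer[OF d] by blast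
    then have "(matrix_inv (M x) *v axis c 1) $ k = det (?N x) / det (M x)" by simp
    then show "det (?N x) / det (M x) = matrix_inv (M x) $ k $ c"
      by (simp add: matrix_vector_mult_axis column_def)
  qed
qed

definition spin_form :: "complex ^ moduli_ix ^ moduli_ix" where
  "spin_form = (\<chi> i j. case i of None \<Rightarrow> 0 | Some (A, A') \<Rightarrow>
     (case j of None \<Rightarrow> 0 | Some (B, B') \<Rightarrow> skew A B * skew A' B'))"

abbreviation "time_axis \<equiv> (axis None 1 :: moduli_pt)"

lemma skew_sym: "skew A B * skew A' B' = skew B A * skew B' A'"
  using spinor_cases[of A] spinor_cases[of B] spinor_cases[of A'] spinor_cases[of B']
  by (auto simp: skew_def)

lemma transpose_spin_form: "transpose spin_form = spin_form"
  by (auto simp: vec_eq_iff transpose_def spin_form_def skew_sym split: option.split prod.split)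

lemma spin_form_mult:
  "(spin_form *v z) $ None = 0"
  "(spin_form *v z) $ Some (A, A') = (\<Sum>B\<in>UNIV. \<Sum>B'\<in>UNIV. skew A B * skew A' B' * z $ Some (B, B'))"
  by (simp_all add: matrix_vector_mult_def spin_form_def sum_moduli_ix sum_spinor)

lemma spin_form_time_axis: "spin_form *v time_axis = 0"
  by (simp add: matrix_vector_mult_axis vec_eq_iff column_def spin_form_def split: option.split prod.split)

lemma spin_form_square: "spin_form *v (spin_form *v z) = z - z $ None *s time_axis"
  unfolding vec_eq_iff
proof
  fix i :: moduli_ix
  show "(spin_form *v (spin_form *v z)) $ i = (z - z $ None *s time_axis) $ i"
  proof (cases i)
    case None
    then show ?thesis by (simp add: spin_form_mult axis_def)
  next
    case (Some p)
    obtain A A' where p: "p = (A, A')" by force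
    show ?thesis
      using spinor_cases[of A] spinor_cases[of A'] unfolding Some p
      by (auto simp: spin_form_mult axis_def sum_spinor skew_def)
  qed
qed

lemma spin_form_kernel: "spin_form *v z = 0 \<longleftrightarrow> z = z $ None *s time_axis"
proof
  assume "spin_form *v z = 0"
  then show "z = z $ None *s time_axis" using spin_form_square[of z] by simp
next
  assume "z = z $ None *s time_axis"
  then show "spin_form *v z = 0"
    by (metis matrix_vector_mult_vector_scalar spin_form_time_axis vec.scale_zero_right)
qed

declare transpose_matrix_vector [simp del]

locale frame_matrix =
  fixes E :: "complex ^ moduli_ix ^ moduli_ix"
  assumes invertible: "invertible E"
begin

abbreviation "B \<equiv> matrix_inv E"

definition metric :: "complex ^ moduli_ix ^ moduli_ix" where
  "metric = transpose E ** spin_form ** E"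

definition cometric :: "complex ^ moduli_ix ^ moduli_ix" where
  "cometric = B ** spin_form ** transpose B"

lemma inv_vec: "E *v (B *v z) = z" "B *v (E *v z) = z"
  "transpose E *v (transpose B *v z) = z" "transpose B *v (transpose E *v z) = z"
  by (simp_all add: matrix_vector_mul_assoc matrix_inv_mult[OF invertible] flip: matrix_transpose_mul)

lemma metric_mult: "metric *v z = transpose E *v (spin_form *v (E *v z))"
  by (simp only: metric_def matrix_vector_mul_assoc matrix_mul_assoc)

lemma cometric_mult: "cometric *v z = B *v (spin_form *v (transpose B *v z))"
  by (simp only: cometric_def matrix_vector_mul_assoc matrix_mul_assoc)

lemma clock: "transpose E *v time_axis = E $ None"
  by (simp add: matrix_vector_mult_axis row_def vec_eq_iff)

lemma clock': "transpose B *v (E $ None) = time_axis"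
  by (simp add: inv_vec flip: clock)

lemma E_mult_None: "(E *v z) $ None = (\<Sum>a\<in>UNIV. E $ None $ a * z $ a)"
  by (simp add: matrix_vector_mult_def)

lemma rest_iff:
  "(\<Sum>a\<in>UNIV. E $ None $ a * u $ a) = 1 \<and> metric *v u = 0 \<longleftrightarrow> u = B *v time_axis"
proof
  assume u: "(\<Sum>a\<in>UNIV. E $ None $ a * u $ a) = 1 \<and> metric *v u = 0"
  then have "transpose B *v (transpose E *v (spin_form *v (E *v u))) = 0"
    by (simp add: metric_mult)
  then have "spin_form *v (E *v u) = 0" by (simp only: inv_vec)
  then have "E *v u = (E *v u) $ None *s time_axis" by (simp only: spin_form_kernel)
  moreover have "(E *v u) $ None = 1" using u by (simp add: E_mult_None)
  ultimately have "E *v u = time_axis" by simp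
  then show "u = B *v time_axis" by (metis inv_vec(2))
next
  assume u: "u = B *v time_axis"
  have Eu: "E *v u = time_axis" by (simp add: u inv_vec)
  then show "(\<Sum>a\<in>UNIV. E $ None $ a * u $ a) = 1 \<and> metric *v u = 0"
    unfolding metric_mult Eu E_mult_None[symmetric] spin_form_time_axis
    by (simp add: axis_def)
qed

lemma outer_mult: "(\<chi> a c. u $ a * E $ None $ c) *v z = (E *v z) $ None *s u"
  by (simp add: vec_eq_iff matrix_vector_mult_def sum_distrib_left mult_ac)

lemma cometric_iff:
  assumes u: "u = B *v time_axis"
  shows "h ** metric = mat 1 - (\<chi> a c. u $ a * E $ None $ c) \<and> h *v (E $ None) = 0 \<longleftrightarrow> h = cometric"
proof
  assume "h = cometric"
  then have h: "h *v z = B *v (spin_form *v (transpose B *v z))" for z by (simp add: cometric_mult)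
  have "(h ** metric) *v z = (mat 1 - (\<chi> a c. u $ a * E $ None $ c)) *v z" for z
    unfolding matrix_vector_mul_assoc[symmetric] h metric_mult inv_vec spin_form_square
      matrix_vector_mult_diff_rdistrib outer_mult u
    by (simp add: matrix_vector_mult_diff_distrib inv_vec matrix_vector_mult_vector_scalar)
  moreover have "h *v (E $ None) = 0"
    by (simp add: h clock' spin_form_time_axis)
  ultimately show "h ** metric = mat 1 - (\<chi> a c. u $ a * E $ None $ c) \<and> h *v (E $ None) = 0"
    by (simp add: matrix_eq)
next
  assume "h ** metric = mat 1 - (\<chi> a c. u $ a * E $ None $ c) \<and> h *v (E $ None) = 0"
  then have hg: "h *v (metric *v z) = z - (E *v z) $ None *s u" and h0: "h *v (E $ None) = 0" for z
    by (simp_all add: matrix_vector_mul_assoc matrix_vector_mult_diff_rdistrib outer_mult)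
  have "h *v y = cometric *v y" for y
  proof -
    define z where "z = transpose B *v y"
    define w where "w = B *v (spin_form *v z)"
    have "y = transpose E *v z" by (simp add: z_def inv_vec)
    also have "z = spin_form *v (E *v w) + z $ None *s time_axis"
      by (simp add: w_def inv_vec spin_form_square)
    finally have "y = metric *v w + z $ None *s (E $ None)"
      by (simp add: matrix_vector_right_distrib metric_mult matrix_vector_mult_vector_scalar clock)
    then have "h *v y = h *v (metric *v w)"
      by (simp add: matrix_vector_right_distrib matrix_vector_mult_vector_scalar h0)
    also have "\<dots> = w"
      by (simp add: hg w_def inv_vec spin_form_mult)
    finally show ?thesis by (simp add: cometric_mult w_def z_def)
  qed
  then show "h = cometric" by (simp add: matrix_eq)
qed

lemma transpose_cometric: "transpose cometric = cometric"
  by (simp add: cometric_def matrix_transpose_mul transpose_spin_form matrix_mul_assoc)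

lemma cometric_kernel: "{\<alpha>. cometric *v \<alpha> = 0} = range (\<lambda>c. c *s (E $ None))"
proof (intro set_eqI iffI)
  fix \<alpha> assume "\<alpha> \<in> {\<alpha>. cometric *v \<alpha> = 0}"
  then have "B *v (spin_form *v (transpose B *v \<alpha>)) = 0" by (simp add: cometric_mult)
  then have "spin_form *v (transpose B *v \<alpha>) = 0"
    by (metis inv_vec(1) matrix_vector_mult_0_right)
  then have "transpose B *v \<alpha> = (transpose B *v \<alpha>) $ None *s time_axis" by (simp only: spin_form_kernel)
  then have "transpose E *v (transpose B *v \<alpha>) = (transpose B *v \<alpha>) $ None *s (E $ None)"
    by (metis matrix_vector_mult_vector_scalar clock)
  then show "\<alpha> \<in> range (\<lambda>c. c *s (E $ None))" by (auto simp: inv_vec)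
next
  fix \<alpha> assume "\<alpha> \<in> range (\<lambda>c. c *s (E $ None))"
  then show "\<alpha> \<in> {\<alpha>. cometric *v \<alpha> = 0}"
    by (auto simp: matrix_vector_mult_vector_scalar cometric_mult clock' spin_form_time_axis)
qed

lemma rank_cometric: "rank cometric = 4"
proof -
  let ?T = "(\<lambda>j. axis (Some j) 1) ` UNIV :: moduli_pt set"
  have lin: "Vector_Spaces.linear (*s) (*s) ((*v) B)" by simp
  have injB: "inj ((*v) B)" by (rule injI) (metis inv_vec(1))
  have "?T \<subseteq> cart_basis" by (auto simp: cart_basis_def)
  then have "vec.independent ?T" using vec.independent_mono independent_cart_basis by blast
  then have ind: "vec.independent ((*v) B ` ?T)"
    using vec.linear_independent_injective_image[OF lin] injB by (meson inj_on_subset subset_UNIV)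
  have "card ((*v) B ` ?T) = card ?T"
    by (rule card_image) (use injB inj_on_subset in blast)
  also have "card ?T = card (UNIV :: (2 \<times> 2) set)"
    by (rule card_image) (auto simp: inj_on_def axis_eq_axis)
  also have "\<dots> = 4" by (simp add: card_cartesian_product flip: UNIV_Times_UNIV)
  finally have card: "card ((*v) B ` ?T) = 4" .
  have rows: "rows cometric = (\<lambda>i. cometric *v axis i 1) ` UNIV"
  proof -
    have "row i cometric = cometric *v axis i 1" for i
      by (metis matrix_vector_mult_axis row_transpose transpose_cometric)
    then show ?thesis unfolding rows_def by auto
  qed
  have "vec.span (rows cometric) = vec.span ((*v) B ` ?T)"
  proof (rule vec.span_eq[THEN iffD2], intro conjI subsetI)
    fix y assume "y \<in> rows cometric"
    then obtain i where "y = cometric *v axis i 1" using rows by auto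
    then obtain z where y: "y = B *v (spin_form *v z)" by (simp add: cometric_mult)
    have "spin_form *v z = (\<Sum>i\<in>UNIV. (spin_form *v z) $ i *s axis i 1)"
      by (simp add: basis_expansion)
    also have "\<dots> = (\<Sum>j\<in>UNIV. (spin_form *v z) $ Some j *s axis (Some j) 1)"
      by (simp add: sum_option spin_form_mult(1))
    finally have "y = B *v (\<Sum>j\<in>UNIV. (spin_form *v z) $ Some j *s axis (Some j) 1)"
      by (simp add: y)
    also have "\<dots> = (\<Sum>j\<in>UNIV. (spin_form *v z) $ Some j *s (B *v axis (Some j) 1))"
      by (simp add: vec.linear_sum[OF lin] matrix_vector_mult_vector_scalar)
    also have "\<dots> \<in> vec.span ((*v) B ` ?T)"
      by (intro vec.span_sum vec.span_scale vec.span_base) auto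
    finally show "y \<in> vec.span ((*v) B ` ?T)" .
  next
    fix y assume "y \<in> (*v) B ` ?T"
    then obtain j where y: "y = B *v axis (Some j) 1" by auto
    define z where "z = transpose E *v (spin_form *v axis (Some j) 1)"
    have "axis (Some j) 1 $ None = (0 :: complex)" by (simp add: axis_def)
    then have "cometric *v z = y"
      by (simp add: cometric_mult z_def inv_vec spin_form_square y)
    moreover have "cometric *v z = (\<Sum>i\<in>UNIV. z $ i *s (cometric *v axis i 1))"
      unfolding matrix_vector_mult_axis by (rule matrix_mult_sum)
    moreover have "\<dots> \<in> vec.span (rows cometric)"
      by (intro vec.span_sum vec.span_scale vec.span_base) (auto simp: rows)
    ultimately show "y \<in> vec.span (rows cometric)" by simp
  qed
  then have "vec.dim (rows cometric) = card ((*v) B ` ?T)"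
    by (rule vec.dim_eq_card[OF sym ind])
  then show ?thesis by (simp add: row_rank_def_gen card)
qed

end

lemma model_patching_mult:
  "(model_patching l ** M) $ None $ a = M $ None $ a"
  "(model_patching l ** M) $ Some A $ a = inverse l * M $ Some A $ a"
  by (simp_all add: matrix_matrix_mult_def model_patching_def if_distrib[of "\<lambda>c. c * _"] cong: if_cong)

context split_fourfold
begin

definition frame_of :: "(moduli_pt \<Rightarrow> complex \<Rightarrow> complex ^ (2 option) ^ (2 option)) \<Rightarrow>
    moduli_pt \<Rightarrow> complex \<Rightarrow> complex ^ moduli_ix ^ (2 option)" where
  "frame_of H x l = matrix_inv (H x l) ** dw x l"

definition clock_of where "clock_of H x = frame_of H x 0 $ None"

text \<open>The linear function \<open>e\<^bsup>A1'\<^esup> + e\<^bsup>A0'\<^esup> \<lambda>\<close> is recovered from its values at \<open>0\<close> and at one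
  other point \<open>l0\<close>, which makes the dependence on \<open>x\<close> visibly holomorphic.\<close>

definition "l0 = (SOME l. l \<in> U \<and> l \<noteq> 0)"

lemma l0: "l0 \<in> U" "l0 \<noteq> 0"
proof -
  obtain r s where rs: "0 < r" "r < s" "cball 0 s \<subseteq> U" "cball 0 (inverse r) \<subseteq> Uh"
    using covers_P1_radii[OF cover] by blast
  then have "of_real s \<in> U \<and> of_real s \<noteq> (0::complex)" by (auto simp: subset_iff)
  then have "l0 \<in> U \<and> l0 \<noteq> 0" unfolding l0_def by (rule someI)
  then show "l0 \<in> U" "l0 \<noteq> 0" by auto
qed

definition coframe_of :: "(moduli_pt \<Rightarrow> complex \<Rightarrow> complex ^ (2 option) ^ (2 option)) \<Rightarrow>
    2 \<Rightarrow> 2 \<Rightarrow> moduli_pt \<Rightarrow> moduli_pt" where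
  "coframe_of H A A' x = (if A' = 1 then frame_of H x 0 $ Some A
     else (1 / l0) *s (frame_of H x l0 $ Some A - frame_of H x 0 $ Some A))"

definition full_frame :: "(moduli_pt \<Rightarrow> complex \<Rightarrow> complex ^ (2 option) ^ (2 option)) \<Rightarrow>
    moduli_pt \<Rightarrow> complex ^ moduli_ix ^ moduli_ix" where
  "full_frame H x = (\<chi> i. case i of None \<Rightarrow> clock_of H x | Some (A, A') \<Rightarrow> coframe_of H A A' x)"

context
  fixes H Hh
  assumes split_H: "normal_splitting U Uh \<epsilon> f H Hh"
begin

lemma H_props: "\<And>\<mu> \<nu>. jointly_holomorphic_on (\<lambda>x l. H x l $ \<mu> $ \<nu>) (UNIV \<times> U)"
  "\<And>\<mu> \<nu>. jointly_holomorphic_on (\<lambda>x m. Hh x m $ \<mu> $ \<nu>) (UNIV \<times> Uh)"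
  "\<And>x l. l \<in> U \<Longrightarrow> invertible (H x l)" "\<And>x m. m \<in> Uh \<Longrightarrow> invertible (Hh x m)"
  "\<And>x l. l \<in> overlap U Uh \<Longrightarrow>
     NP x l = Hh x (inverse l) ** model_patching l ** matrix_inv (H x l)"
  using split_H unfolding normal_splitting_def by auto

lemma frame_of_jointly: "jointly_holomorphic_on (\<lambda>x l. frame_of H x l $ \<mu> $ a) (UNIV \<times> U)"
proof -
  have "holoc pair_scale (\<lambda>q. matrix_inv (H (fst q) (snd q)) $ \<mu> $ \<nu>) (UNIV \<times> U)" for \<nu>
    by (rule holoc_matrix_inv) (use H_props discs in \<open>auto simp: jointly_holomorphic_on_iff intro: open_Times\<close>)
  then show ?thesis
    using dw_jointly unfolding jointly_holomorphic_on_iff frame_of_def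
    by (simp add: matrix_matrix_mult_def holoc_sum holoc_mult)
qed

lemma frameh_jointly:
  "jointly_holomorphic_on (\<lambda>x m. (matrix_inv (Hh x m) ** dwh x m) $ \<mu> $ a) (UNIV \<times> Uh)"
proof -
  have "holoc pair_scale (\<lambda>q. matrix_inv (Hh (fst q) (snd q)) $ \<mu> $ \<nu>) (UNIV \<times> Uh)" for \<nu>
    by (rule holoc_matrix_inv) (use H_props discs in \<open>auto simp: jointly_holomorphic_on_iff intro: open_Times\<close>)
  then show ?thesis
    using dwh_jointly unfolding jointly_holomorphic_on_iff
    by (simp add: matrix_matrix_mult_def holoc_sum holoc_mult)
qed

lemma frame_patching:
  assumes l: "l \<in> overlap U Uh"
  shows "matrix_inv (Hh x (inverse l)) ** dwh x (inverse l) = model_patching l ** frame_of H x l"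
proof -
  have "dwh x (inverse l) = Hh x (inverse l) ** (model_patching l ** frame_of H x l)"
    unfolding NP_dw[OF l, symmetric] H_props(5)[OF l] frame_of_def by (simp add: matrix_mul_assoc)
  then show ?thesis
    using matrix_inv_mult(2)[OF H_props(4)[OF overlapD(3)[OF l]]]
    by (simp add: matrix_mul_assoc)
qed

lemma frame_of_None:
  assumes "l \<in> U"
  shows "frame_of H x l $ None = clock_of H x"
  unfolding vec_eq_iff
proof
  fix a
  let ?P = "\<lambda>l. frame_of H x l $ None $ a"
  let ?Q = "\<lambda>m. (matrix_inv (Hh x m) ** dwh x m) $ None $ a"
  have "?P l = ?Q (inverse l)" if "l \<in> overlap U Uh" for l
    by (simp add: frame_patching[OF that] model_patching_mult)
  from glue_constant(1)[OF cover jointly_holomorphic_on_slice[OF frame_of_jointly discs(1)]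
      jointly_holomorphic_on_slice[OF frameh_jointly discs(2)] this assms]
  show "frame_of H x l $ None $ a = clock_of H x $ a" by (simp add: clock_of_def)
qed

lemma frame_of_Some:
  assumes "l \<in> U"
  shows "frame_of H x l $ Some A = coframe_of H A 1 x + l *s coframe_of H A 0 x"
  unfolding vec_eq_iff
proof
  fix a
  let ?P = "\<lambda>l. frame_of H x l $ Some A $ a"
  let ?Q = "\<lambda>m. (matrix_inv (Hh x m) ** dwh x m) $ Some A $ a"
  have "inverse l * ?P l = ?Q (inverse l)" if "l \<in> overlap U Uh" for l
    by (simp add: frame_patching[OF that] model_patching_mult)
  note lin = glue_linear(1)[OF cover jointly_holomorphic_on_slice[OF frame_of_jointly discs(1)]
      jointly_holomorphic_on_slice[OF frameh_jointly discs(2)] this]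
  have "?P l0 = ?P 0 + deriv ?P 0 * l0" by (rule lin[OF _ l0(1)])
  then have "deriv ?P 0 = (?P l0 - ?P 0) / l0" using l0 by (simp add: field_simps)
  moreover have "?P l = ?P 0 + deriv ?P 0 * l" by (rule lin[OF _ assms])
  moreover have e1: "coframe_of H A 1 x $ a = ?P 0" by (simp add: coframe_of_def)
  moreover have e0: "coframe_of H A 0 x $ a = (?P l0 - ?P 0) / l0"
    by (simp add: coframe_of_def diff_divide_distrib)
  ultimately show "frame_of H x l $ Some A $ a = (coframe_of H A 1 x + l *s coframe_of H A 0 x) $ a"
    by (simp add: e0 e1 mult.commute)
qed

lemma frame_components_iff:
  "frame_components U Uh \<epsilon> f H \<theta> e \<longleftrightarrow> \<theta> = clock_of H \<and> e = coframe_of H"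
proof
  assume "\<theta> = clock_of H \<and> e = coframe_of H"
  then show "frame_components U Uh \<epsilon> f H \<theta> e"
    unfolding frame_components_def Let_def
    by (simp add: frame_of_None frame_of_Some flip: frame_of_def)
next
  assume "frame_components U Uh \<epsilon> f H \<theta> e"
  then have fc: "frame_of H x l $ None = \<theta> x" "frame_of H x l $ Some A = e A 1 x + l *s e A 0 x"
    if "l \<in> U" for x l A
    using that unfolding frame_components_def Let_def frame_of_def by auto
  have "\<theta> = clock_of H"
    using fc(1)[OF discs(3)] by (auto simp: clock_of_def)
  moreover have 1: "e A 1 x = coframe_of H A 1 x" for A x
    using fc(2)[OF discs(3), of x A] by (simp add: coframe_of_def)
  moreover have 0: "e A 0 x = coframe_of H A 0 x" for A x
  proof -
    have "l0 *s e A 0 x = l0 *s coframe_of H A 0 x"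
      using fc(2)[OF l0(1), of x A] frame_of_Some[OF l0(1), of x A] 1[of A x]
      by (metis add_left_imp_eq)
    then show ?thesis using l0(2) by (simp add: vec_eq_iff)
  qed
  ultimately show "\<theta> = clock_of H \<and> e = coframe_of H"
  proof -
    have "e A A' x = coframe_of H A A' x" for A A' x
      using 0 1 spinor_cases[of A'] by auto
    then have "e = coframe_of H" by (intro ext)
    with \<open>\<theta> = clock_of H\<close> show ?thesis by simp
  qed
qed

lemma invertible_full_frame: "invertible (full_frame H x)"
  unfolding invertible_left_inverse matrix_left_invertible_ker
proof (intro allI impI)
  fix v assume v: "full_frame H x *v v = 0"
  have row: "(\<Sum>a\<in>UNIV. full_frame H x $ i $ a * v $ a) = 0" for i
    using arg_cong[OF v, of "\<lambda>w. w $ i"] by (simp add: matrix_vector_mult_def)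
  have "dw x l *v v = 0" if l: "l \<in> U" for l
  proof -
    have "frame_of H x l *v v = 0"
      unfolding vec_eq_iff
    proof
      fix \<mu> :: "2 option"
      show "(frame_of H x l *v v) $ \<mu> = (0 :: fibre_pt) $ \<mu>"
      proof (cases \<mu>)
        case None
        then show ?thesis
          using row[of None] by (simp add: matrix_vector_mult_def frame_of_None[OF l] full_frame_def)
      next
        case (Some A)
        have "(frame_of H x l *v v) $ Some A =
            (\<Sum>a\<in>UNIV. full_frame H x $ Some (A, 1) $ a * v $ a) +
            l * (\<Sum>a\<in>UNIV. full_frame H x $ Some (A, 0) $ a * v $ a)"
          by (simp add: matrix_vector_mult_def frame_of_Some[OF l] full_frame_def
              sum.distrib sum_distrib_left distrib_right mult.assoc)
        then show ?thesis using row by (simp add: Some)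
      qed
    qed
    then have "H x l *v (frame_of H x l *v v) = 0" by simp
    then show ?thesis
      by (simp add: frame_of_def matrix_vector_mul_assoc matrix_mul_assoc matrix_inv_mult[OF H_props(3)[OF l]])
  qed
  then show "v = 0" by (rule dw_kernel)
qed

interpretation fm: frame_matrix "full_frame H x" for x
  by standard (rule invertible_full_frame)

lemma covariant_metric_coframe: "covariant_metric (coframe_of H) x = fm.metric x"
proof -
  have "fm.metric x $ a $ b = covariant_metric (coframe_of H) x $ a $ b" for a b
  proof -
    have "fm.metric x $ a $ b = (\<Sum>j\<in>UNIV. (\<Sum>i\<in>UNIV. full_frame H x $ i $ a * spin_form $ i $ j) * full_frame H x $ j $ b)"
      by (simp add: fm.metric_def matrix_matrix_mult_def transpose_def)
    also have "\<dots> = covariant_metric (coframe_of H) x $ a $ b"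
      by (simp add: sum_moduli_ix sum_spinor spin_form_def full_frame_def covariant_metric_def skew_def)
    finally show ?thesis .
  qed
  then show ?thesis by (simp add: vec_eq_iff)
qed

lemma full_frame_None: "full_frame H x $ None = clock_of H x"
  by (simp add: full_frame_def)

lemma frame_induces_iff: "frame_induces U Uh \<epsilon> f H h \<theta> \<longleftrightarrow> \<theta> = clock_of H \<and> h = fm.cometric"
proof -
  have rest: "rest_field (clock_of H) (covariant_metric (coframe_of H)) u \<longleftrightarrow>
      u = (\<lambda>x. matrix_inv (full_frame H x) *v time_axis)" for u
    unfolding rest_field_def covariant_metric_coframe fun_eq_iff
    using fm.rest_iff by (simp add: full_frame_None)
  have inv: "projective_inverse (clock_of H) (\<lambda>x. matrix_inv (full_frame H x) *v time_axis)
      (covariant_metric (coframe_of H)) h \<longleftrightarrow> h = fm.cometric" for h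
    unfolding projective_inverse_def covariant_metric_coframe fun_eq_iff
    using fm.cometric_iff[OF refl] by (simp add: full_frame_None)
  show ?thesis
    unfolding frame_induces_def frame_components_iff by (auto simp: rest inv)
qed

lemma holoc_full_frame: "holoc (*s) (\<lambda>x. full_frame H x $ i $ a) UNIV"
proof -
  have fr: "holoc (*s) (\<lambda>x. frame_of H x l $ \<mu> $ a) UNIV" if "l \<in> U" for l \<mu>
    using jointly_holomorphic_on_vec[OF frame_of_jointly that] by (simp add: holomorphic_vec_on_iff)
  show ?thesis
  proof (cases i)
    case None
    then show ?thesis by (simp add: full_frame_def clock_of_def fr discs)
  next
    case (Some p)
    obtain A A' where "p = (A, A')" by force
    with Some show ?thesis
      using spinor_cases[of A']
      by (auto simp: full_frame_def coframe_of_def intro!: fr discs l0 holoc_cmult holoc_diff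
          simp del: times_divide_eq_left)
  qed
qed

lemma galilean_cometric: "galilean_structure fm.cometric (clock_of H)"
  unfolding galilean_structure_def
proof (intro conjI allI)
  have inv: "holoc (*s) (\<lambda>x. matrix_inv (full_frame H x) $ i $ j) UNIV" for i j
    by (rule holoc_matrix_inv[OF holoc_full_frame invertible_full_frame]) simp
  show "holomorphic_vec_on (\<lambda>x. fm.cometric x $ a $ b) UNIV" for a b
    unfolding holomorphic_vec_on_iff fm.cometric_def
    by (simp add: matrix_matrix_mult_def transpose_def)
       (intro holoc_sum holoc_mult holoc_const inv)
  show "holomorphic_vec_on (\<lambda>x. clock_of H x $ a) UNIV" for a
    using holoc_full_frame[of None a] by (simp add: holomorphic_vec_on_iff full_frame_def)
  show "transpose (fm.cometric x) = fm.cometric x" "rank (fm.cometric x) = 4"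
    "{\<alpha>. fm.cometric x *v \<alpha> = 0} = range (\<lambda>c. c *s clock_of H x)" for x
    using fm.transpose_cometric fm.rank_cometric fm.cometric_kernel[of x]
    by (simp_all add: full_frame_None)
qed

end

lemma frame_induces_galilean:
  assumes "normal_splitting U Uh \<epsilon> f H Hh"
  shows "\<exists>!(h, \<theta>). frame_induces U Uh \<epsilon> f H h \<theta>"
    and "frame_induces U Uh \<epsilon> f H h \<theta> \<Longrightarrow> galilean_structure h \<theta>"
    and "frame_induces U Uh \<epsilon> f H h \<theta> \<Longrightarrow> \<theta> = clock_of H"
proof -
  show "\<exists>!(h, \<theta>). frame_induces U Uh \<epsilon> f H h \<theta>"
    by (auto simp: frame_induces_iff[OF assms])
  show "frame_induces U Uh \<epsilon> f H h \<theta> \<Longrightarrow> galilean_structure h \<theta>"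
    using galilean_cometric[OF assms] by (simp add: frame_induces_iff[OF assms])
  show "frame_induces U Uh \<epsilon> f H h \<theta> \<Longrightarrow> \<theta> = clock_of H"
    by (simp add: frame_induces_iff[OF assms])
qed

end

section \<open>The torsion of the clock\<close>

definition shear :: "(2 \<Rightarrow> complex) \<Rightarrow> complex ^ (2 option) ^ (2 option)" where
  "shear c = (\<chi> \<mu> \<nu>. if \<mu> = \<nu> then 1 else (case \<mu> of None \<Rightarrow> (case \<nu> of None \<Rightarrow> 1 | Some A \<Rightarrow> c A) | Some _ \<Rightarrow> 0))"

lemma shear_mult:
  "(shear c ** M) $ None $ a = M $ None $ a + (\<Sum>A\<in>UNIV. c A * M $ Some A $ a)"
  "(shear c ** M) $ Some A $ a = M $ Some A $ a"
  by (simp_all add: matrix_matrix_mult_def shear_def sum_option if_distrib[of "\<lambda>c. c * _"] cong: if_cong)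

lemma shear_nth: "shear c $ None $ None = 1" "shear c $ None $ Some A = c A" "shear c $ Some A $ None = 0"
  "shear c $ Some A $ Some B = (if A = B then 1 else 0)"
  by (simp_all add: shear_def)

lemma shear_inverse: "shear (\<lambda>A. - c A) ** shear c = mat 1"
  unfolding vec_eq_iff
proof (intro allI)
  fix \<mu> \<nu> :: "2 option"
  show "(shear (\<lambda>A. - c A) ** shear c) $ \<mu> $ \<nu> = mat 1 $ \<mu> $ \<nu>"
    by (cases \<mu>; cases \<nu>) (auto simp: shear_mult shear_nth mat_def if_distrib cong: if_cong)
qed

lemma invertible_shear: "invertible (shear c)"
  using matrix_inv_eqI(1)[OF shear_inverse] .

lemma matrix_inv_shear: "matrix_inv (shear c) = shear (\<lambda>A. - c A)"
  using matrix_inv_eqI(2)[OF shear_inverse] .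

context split_fourfold
begin

definition "H0 x l = shear (\<lambda>A. - (\<epsilon> * P' A x l))"
definition "Hh0 x m = shear (\<lambda>A. \<epsilon> * Q' A x m)"

lemma splitting0: "normal_splitting U Uh \<epsilon> f H0 Hh0"
  unfolding normal_splitting_def
proof (intro conjI allI ballI)
  show "jointly_holomorphic_on (\<lambda>x l. H0 x l $ \<mu> $ \<nu>) (UNIV \<times> U)" for \<mu> \<nu>
    using holoc_cmult[OF P'[unfolded jointly_holomorphic_on_iff], of "- \<epsilon>"]
    by (cases \<mu>; cases \<nu>) (simp_all add: H0_def shear_nth jointly_holomorphic_on_iff holoc_const)
  show "jointly_holomorphic_on (\<lambda>x m. Hh0 x m $ \<mu> $ \<nu>) (UNIV \<times> Uh)" for \<mu> \<nu>
    using holoc_cmult[OF Q'[unfolded jointly_holomorphic_on_iff], of \<epsilon>]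
    by (cases \<mu>; cases \<nu>) (simp_all add: Hh0_def shear_nth jointly_holomorphic_on_iff holoc_const)
  show "invertible (H0 x l)" "invertible (Hh0 x m)" for x l m
    by (simp_all add: H0_def Hh0_def invertible_shear)
  fix x l assume l: "l \<in> overlap U Uh"
  show "NP x l = Hh0 x (inverse l) ** model_patching l ** matrix_inv (H0 x l)"
    unfolding vec_eq_iff matrix_mul_assoc[symmetric]
  proof (intro allI)
    fix \<mu> \<nu> :: "2 option"
    show "NP x l $ \<mu> $ \<nu> = (Hh0 x (inverse l) ** (model_patching l ** matrix_inv (H0 x l))) $ \<mu> $ \<nu>"
      by (cases \<mu>; cases \<nu>)
         (auto simp: Hh0_def H0_def matrix_inv_shear shear_mult shear_nth model_patching_mult
           NP_None[OF l] NP_Some split'[OF l] if_distrib algebra_simps cong: if_cong)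
  qed
qed

lemma clock0: "clock_of H0 x $ b = (if b = None then 1 else 0) +
    \<epsilon> * (\<Sum>A\<in>UNIV. P' A x 0 * (if b = Some (A, 1) then 1 else 0))"
  by (simp add: clock_of_def frame_of_def H0_def matrix_inv_shear shear_mult dw_None[OF discs(3)]
      dw_Some[OF discs(3)] dOmega_def sum_distrib_left mult.assoc)

definition dP' :: "moduli_ix \<Rightarrow> 2 \<Rightarrow> moduli_pt \<Rightarrow> complex \<Rightarrow> complex" where
  "dP' a A x l = cpartial a (\<lambda>y. P' A y l) x"

definition dQ' :: "moduli_ix \<Rightarrow> 2 \<Rightarrow> moduli_pt \<Rightarrow> complex \<Rightarrow> complex" where
  "dQ' a A x m = cpartial a (\<lambda>y. Q' A y m) x"

lemma ext_deriv_clock0: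
  "ext_deriv (clock_of H0) x $ a $ b = \<epsilon> * (\<Sum>A\<in>UNIV.
     dP' a A x 0 * (if b = Some (A, 1) then 1 else 0) - dP' b A x 0 * (if a = Some (A, 1) then 1 else 0))"
proof -
  have h: "holomorphic_vec_on (\<lambda>y. P' A y 0) UNIV" for A
    by (rule jointly_holomorphic_on_vec[OF P' discs(3)])
  have hc: "holomorphic_vec_on (\<lambda>_. z) UNIV" for z
    by (simp add: holomorphic_vec_on_iff holoc_const)
  define k where "k b A = \<epsilon> * (if b = Some (A, 1) then 1 else 0)" for b :: moduli_ix and A :: 2
  have "cpartial a (\<lambda>y. clock_of H0 y $ b) x = \<epsilon> * (\<Sum>A\<in>UNIV. dP' a A x 0 * (if b = Some (A, 1) then 1 else 0))"
    for a b
  proof -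
    have m: "cpartial a (\<lambda>y. k b A * P' A y 0) x = k b A * dP' a A x 0" for A
      unfolding dP'_def by (rule cpartial_mult_left[OF h]) simp
    have "cpartial a (\<lambda>y. clock_of H0 y $ b) x =
        cpartial a (\<lambda>y. (if b = None then 1 else 0) + (k b 0 * P' 0 y 0 + k b 1 * P' 1 y 0)) x"
      by (rule cpartial_cong) (simp add: clock0 sum_spinor k_def algebra_simps)
    also have "\<dots> = cpartial a (\<lambda>y. if b = None then 1 else 0) x + cpartial a (\<lambda>y. k b 0 * P' 0 y 0 + k b 1 * P' 1 y 0) x"
      by (rule cpartial_add[of _ UNIV])
         (intro hc holomorphic_vec_on_cmult holomorphic_vec_on_add h UNIV_I)+
    also have "cpartial a (\<lambda>y. k b 0 * P' 0 y 0 + k b 1 * P' 1 y 0) x =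
        cpartial a (\<lambda>y. k b 0 * P' 0 y 0) x + cpartial a (\<lambda>y. k b 1 * P' 1 y 0) x"
      by (rule cpartial_add[of _ UNIV]) (auto intro!: holomorphic_vec_on_cmult h)
    finally show ?thesis unfolding m by (simp add: sum_spinor k_def algebra_simps)
  qed
  then show ?thesis
    by (simp add: ext_deriv_def sum_subtractf right_diff_distrib)
qed

definition d2f :: "2 \<Rightarrow> 2 \<Rightarrow> moduli_pt \<Rightarrow> complex \<Rightarrow> complex" where
  "d2f A B x l = cpartial A (cpartial B (\<lambda>\<omega>. f \<omega> l)) (Omega x l)"

lemma split_d2:
  assumes l: "l \<in> overlap U Uh"
  shows "(\<Sum>B\<in>UNIV. d2f A B x l * dOmega B a l) = dP' a A x l + inverse l * dQ' a A x (inverse l)"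
proof -
  have h: "holomorphic_vec_on (\<lambda>y. P' A y l) UNIV" "holomorphic_vec_on (\<lambda>y. Q' A y (inverse l)) UNIV"
    by (rule jointly_holomorphic_on_vec[OF P'] jointly_holomorphic_on_vec[OF Q']; use overlapD[OF l] in simp)+
  have f: "holomorphic_vec_on (\<lambda>\<omega>. f \<omega> l) UNIV"
    by (rule jointly_holomorphic_on_vec[OF f_holomorphic l])
  have "cpartial a (\<lambda>y. df A y l) x = (\<Sum>B\<in>UNIV. cpartial B (cpartial A (\<lambda>\<omega>. f \<omega> l)) (Omega x l) * dOmega B a l)"
    unfolding df_def
    by (subst cpartial_chain[OF holomorphic_vec_on_cpartial[OF f open_UNIV] holomorphic_vec_on_Omega UNIV_I UNIV_I])
       (simp_all add: cpartial_Omega)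
  also have "\<dots> = (\<Sum>B\<in>UNIV. d2f A B x l * dOmega B a l)"
    unfolding d2f_def by (simp add: cpartial_commute[OF f])
  finally have 1: "cpartial a (\<lambda>y. df A y l) x = (\<Sum>B\<in>UNIV. d2f A B x l * dOmega B a l)" .
  have "cpartial a (\<lambda>y. df A y l) x = cpartial a (\<lambda>y. P' A y l + inverse l * Q' A y (inverse l)) x"
    by (rule cpartial_cong) (simp add: split'[OF l] mult.commute)
  also have "\<dots> = dP' a A x l + cpartial a (\<lambda>y. inverse l * Q' A y (inverse l)) x"
    unfolding dP'_def by (rule cpartial_add[of _ UNIV]) (intro holomorphic_vec_on_cmult h UNIV_I)+
  also have "cpartial a (\<lambda>y. inverse l * Q' A y (inverse l)) x = inverse l * dQ' a A x (inverse l)"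
    unfolding dQ'_def by (rule cpartial_mult_left[OF h(2)]) simp
  finally show ?thesis using 1 by simp
qed

lemma dP'_integral:
  assumes c: "encircles_zero_once (overlap U Uh) c"
  shows "((\<lambda>l. (\<Sum>B\<in>UNIV. d2f A B x l * dOmega B a l) * inverse l) has_contour_integral
    2 * pi * \<i> * dP' a A x 0) c"
proof (rule has_contour_integral_Laurent[OF cover _ _ c])
  show "dP' a A x holomorphic_on U"
    unfolding dP'_def by (rule jointly_holomorphic_on_slice[OF jointly_holomorphic_on_cpartial[OF P' discs(1)] discs(1)])
  show "dQ' a A x holomorphic_on Uh"
    unfolding dQ'_def by (rule jointly_holomorphic_on_slice[OF jointly_holomorphic_on_cpartial[OF Q' discs(2)] discs(2)])
  show "(\<Sum>B\<in>UNIV. d2f A B x l * dOmega B a l) * inverse l =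
      dP' a A x l * inverse l + dQ' a A x (inverse l) * (inverse l)\<^sup>2" if "l \<in> overlap U Uh" for l
    unfolding split_d2[OF that] by (simp add: power2_eq_square algebra_simps)
qed

lemma homog_cpartial:
  fixes \<pi> :: "complex ^ 2"
  assumes l: "l \<in> overlap U Uh" and \<pi>: "\<pi> $ 1 \<noteq> 0" "\<pi> $ 0 / \<pi> $ 1 = l"
  shows "cpartial A (cpartial B (\<lambda>\<omega>. homog f \<omega> \<pi>)) (omega_res x \<pi>) * (\<pi> $ 1)\<^sup>2 = d2f A B x l"
proof -
  define k where "k = inverse (\<pi> $ 1)"
  have k: "k \<noteq> 0" using \<pi> by (simp add: k_def)
  have f: "holomorphic_vec_on (\<lambda>\<omega>. f \<omega> l) UNIV"
    by (rule jointly_holomorphic_on_vec[OF f_holomorphic l])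
  have sc: "cpartial B (\<lambda>\<omega>. F (k *s \<omega>)) \<omega> = k * cpartial B F (k *s \<omega>)"
    if F: "holomorphic_vec_on F UNIV" for F B and \<omega> :: "complex ^ 2"
  proof -
    have n: "holomorphic_vec_on (\<lambda>\<omega>. (k *s \<omega>) $ i) UNIV" for i :: 2
      by (simp add: holomorphic_vec_on_cmult holomorphic_vec_on_nth)
    have p: "cpartial B (\<lambda>\<omega>. (k *s \<omega>) $ i) \<omega> = k * (if i = B then 1 else 0)" for i :: 2
      unfolding vector_smult_component
      by (subst cpartial_mult_left[of _ UNIV]) (auto intro: holomorphic_vec_on_nth simp: cpartial_nth)
    have "cpartial B (\<lambda>\<omega>. F (k *s \<omega>)) \<omega> = (\<Sum>i\<in>UNIV. cpartial i F (k *s \<omega>) * (k * (if i = B then 1 else 0)))"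
      unfolding cpartial_chain[OF F n UNIV_I UNIV_I] p ..
    then show ?thesis
      by (simp add: if_distrib cong: if_cong)
  qed
  have hom: "homog f \<omega> \<pi> = f (k *s \<omega>) l" for \<omega>
  proof -
    have "(\<chi> A. \<omega> $ A / \<pi> $ 1) = k *s \<omega>" by (simp add: vec_eq_iff k_def field_simps)
    then show ?thesis by (simp add: homog_def \<pi>(2))
  qed
  have res: "k *s omega_res x \<pi> = Omega x l"
    using \<pi> by (simp add: vec_eq_iff omega_res_def Omega_def k_def sum_spinor field_simps flip: \<pi>(2))
  have hB: "holomorphic_vec_on (cpartial B (\<lambda>\<omega>. f \<omega> l)) UNIV"
    by (rule holomorphic_vec_on_cpartial[OF f open_UNIV])
  have hBk: "holomorphic_vec_on (\<lambda>\<omega>. cpartial B (\<lambda>\<omega>. f \<omega> l) (k *s \<omega>)) UNIV"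
    using hB unfolding holomorphic_vec_on_iff
    by (rule holo_compose[rotated, where F = "\<lambda>\<omega>. k *s \<omega>"])
       (auto intro!: holo_vec holoc_cmult holoc_nth)
  have "cpartial B (\<lambda>\<omega>. homog f \<omega> \<pi>) = (\<lambda>\<omega>. k * cpartial B (\<lambda>\<omega>. f \<omega> l) (k *s \<omega>))"
    by (rule ext) (simp only: hom sc[OF f])
  then have "cpartial A (cpartial B (\<lambda>\<omega>. homog f \<omega> \<pi>)) (omega_res x \<pi>) =
      k * cpartial A (\<lambda>\<omega>. cpartial B (\<lambda>\<omega>. f \<omega> l) (k *s \<omega>)) (omega_res x \<pi>)"
    by (simp add: cpartial_mult_left[OF hBk])
  also have "\<dots> = k * (k * d2f A B x l)"
    by (simp only: sc[OF hB] res d2f_def)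
  finally show ?thesis
    using \<pi>(1) by (simp add: k_def power2_eq_square field_simps)
qed

lemma torsion_coeff_eq:
  assumes c: "encircles_zero_once (overlap U Uh) c" and \<pi>: "homogeneous_lift (overlap U Uh) \<pi>"
  shows "torsion_coeff f c \<pi> x A B B' = dP' (Some (B, B')) A x 0"
proof -
  have "((\<lambda>l. cpartial A (cpartial B (\<lambda>\<omega>. homog f \<omega> (\<pi> l))) (omega_res x (\<pi> l)) *
       (\<pi> l $ B' / \<pi> l $ 0) * (\<pi> l $ 1)\<^sup>2) has_contour_integral 2 * pi * \<i> * dP' (Some (B, B')) A x 0) c"
  proof (rule has_contour_integral_eq[OF dP'_integral[OF c]])
    fix l assume "l \<in> path_image c"
    then have l: "l \<in> overlap U Uh" using c unfolding encircles_zero_once_def by blast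
    then have p: "\<pi> l $ 1 \<noteq> 0" "\<pi> l $ 0 / \<pi> l $ 1 = l" using \<pi> unfolding homogeneous_lift_def by auto
    have "\<pi> l $ 0 = l * \<pi> l $ 1" using p by (simp add: field_simps)
    then have r: "\<pi> l $ B' / \<pi> l $ 0 = dOmega B (Some (B, B')) l * inverse l"
      using spinor_cases[of B'] p(1) overlapD(1)[OF l] by (auto simp: dOmega_def field_simps)
    have s: "(\<Sum>C\<in>UNIV. d2f A C x l * dOmega C (Some (B, B')) l) = d2f A B x l * dOmega B (Some (B, B')) l"
      using spinor_cases[of B] by (auto simp: sum_spinor dOmega_def)
    show "(\<Sum>C\<in>UNIV. d2f A C x l * dOmega C (Some (B, B')) l) * inverse l =
        cpartial A (cpartial B (\<lambda>\<omega>. homog f \<omega> (\<pi> l))) (omega_res x (\<pi> l)) *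
         (\<pi> l $ B' / \<pi> l $ 0) * (\<pi> l $ 1)\<^sup>2"
      unfolding r s homog_cpartial[OF l p, of A B x, symmetric] by (simp only: mult_ac)
  qed
  from contour_integral_unique[OF this] show ?thesis by (simp add: torsion_coeff_def)
qed

lemma dP'_None:
  assumes c: "encircles_zero_once (overlap U Uh) c"
  shows "dP' None A x 0 = 0"
proof -
  have "((\<lambda>l. 0) has_contour_integral 2 * pi * \<i> * dP' None A x 0) c"
    using dP'_integral[OF c, of A x None] by (simp add: dOmega_def)
  from has_contour_integral_unique[OF this has_contour_integral_0] show ?thesis by simp
qed

lemma torsion0:
  assumes c: "encircles_zero_once (overlap U Uh) c" and \<pi>: "homogeneous_lift (overlap U Uh) \<pi>"
  shows "ext_deriv (clock_of H0) x $ a $ b =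
    \<epsilon> * (\<Sum>A\<in>UNIV. \<Sum>B\<in>UNIV. \<Sum>B'\<in>UNIV.
       torsion_coeff f c \<pi> x A B B' * wedge (dx B B') (dx A 1) $ a $ b)"
proof -
  have dP'_sum: "(\<Sum>B\<in>UNIV. \<Sum>B'\<in>UNIV. dP' (Some (B, B')) A x 0 * dx B B' $ a) = dP' a A x 0" for A a
  proof (cases a)
    case None
    then show ?thesis by (simp add: dx_def axis_def dP'_None[OF c])
  next
    case (Some p)
    obtain C C' where "p = (C, C')" by force
    with Some show ?thesis
      using spinor_cases[of C] spinor_cases[of C'] by (auto simp: dx_def axis_def sum_spinor)
  qed
  have "(\<Sum>B\<in>UNIV. \<Sum>B'\<in>UNIV. torsion_coeff f c \<pi> x A B B' * wedge (dx B B') (dx A 1) $ a $ b) =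
      dP' a A x 0 * dx A 1 $ b - dP' b A x 0 * dx A 1 $ a" for A
  proof -
    have "(\<Sum>B\<in>UNIV. \<Sum>B'\<in>UNIV. torsion_coeff f c \<pi> x A B B' * wedge (dx B B') (dx A 1) $ a $ b) =
        (\<Sum>B\<in>UNIV. \<Sum>B'\<in>UNIV. dP' (Some (B, B')) A x 0 * dx B B' $ a) * dx A 1 $ b -
        (\<Sum>B\<in>UNIV. \<Sum>B'\<in>UNIV. dP' (Some (B, B')) A x 0 * dx B B' $ b) * dx A 1 $ a"
      by (simp add: torsion_coeff_eq[OF c \<pi>] wedge_def sum_spinor algebra_simps)
    then show ?thesis by (simp only: dP'_sum)
  qed
  then show ?thesis
    unfolding ext_deriv_clock0 by (simp add: dx_def axis_def)
qed

lemma expansion: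
  "\<exists>\<gamma> :: int \<Rightarrow> complex.
     (\<forall>l\<in>overlap U Uh. ((\<lambda>n. \<gamma> n * l powi n) has_sum f (\<chi> A. w_res U Uh \<epsilon> f x l $ Some A) l) UNIV) \<and>
     (\<forall>l\<in>U. (\<lambda>n. \<gamma> n * l powi n) summable_on {1..} \<and>
        w_res U Uh \<epsilon> f x l $ None = x $ None - \<epsilon> * (\<Sum>\<^sub>\<infinity>n\<in>{1..}. \<gamma> n * l powi n))"
proof -
  obtain \<gamma> :: "int \<Rightarrow> complex" where
    \<gamma>: "\<And>l. l \<in> overlap U Uh \<Longrightarrow> ((\<lambda>n. \<gamma> n * l powi n) has_sum P x l + Q x (inverse l) * inverse l) UNIV"
      "\<And>l. l \<in> U \<Longrightarrow> ((\<lambda>n. \<gamma> n * l powi n) has_sum P x l - P x 0) {1..}"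
    using Laurent_series[OF cover jointly_holomorphic_on_slice[OF P discs(1), of x]
        jointly_holomorphic_on_slice[OF Q discs(2), of x]] by blast
  have "((\<lambda>n. \<gamma> n * l powi n) has_sum f (\<chi> A. w_res U Uh \<epsilon> f x l $ Some A) l) UNIV"
    if l: "l \<in> overlap U Uh" for l
    using \<gamma>(1)[OF l] split[OF l, of x] by (simp add: w_res_eq[OF overlapD(2)[OF l]] sec_simps(3))
  moreover have "(\<lambda>n. \<gamma> n * l powi n) summable_on {1..}"
    "w_res U Uh \<epsilon> f x l $ None = x $ None - \<epsilon> * (\<Sum>\<^sub>\<infinity>n\<in>{1..}. \<gamma> n * l powi n)"
    if l: "l \<in> U" for l
    using \<gamma>(2)[OF l] by (auto simp: w_res_eq[OF l] sec_simps(1) infsumI summable_on_def)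
  ultimately show ?thesis by blast
qed

lemma w_res_jointly: "jointly_holomorphic_on (\<lambda>x l. w_res U Uh \<epsilon> f x l $ \<mu>) (UNIV \<times> U)"
  using sec_jointly[of \<mu>] unfolding jointly_holomorphic_on_iff
  by (rule holo_transform_open) (auto simp: w_res_eq intro!: open_Times discs)

lemma wh_res_jointly: "jointly_holomorphic_on (\<lambda>x m. wh_res U Uh \<epsilon> f x m $ \<mu>) (UNIV \<times> Uh)"
  using sech_jointly[of \<mu>] unfolding jointly_holomorphic_on_iff
  by (rule holo_transform_open) (auto simp: wh_res_eq intro!: open_Times discs)

end

lemma (in patched_fourfold) splitting_exists:
  obtains P Q P' Q' where "split_fourfold U Uh f P Q P' Q'"
proof -
  obtain P Q where PQ: "jointly_holomorphic_on P (UNIV \<times> U)" "jointly_holomorphic_on Q (UNIV \<times> Uh)"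
    "\<And>x l. l \<in> overlap U Uh \<Longrightarrow> f (Omega x l) l = P x l + Q x (inverse l) * inverse l"
    by (rule Laurent_splitting[OF cover jointly_f_Omega]) (rule that)
  have "\<exists>P Q. jointly_holomorphic_on P (UNIV \<times> U) \<and> jointly_holomorphic_on Q (UNIV \<times> Uh) \<and>
    (\<forall>x. \<forall>l\<in>overlap U Uh. df A x l = P x l + Q x (inverse l) * inverse l)" for A
    by (rule Laurent_splitting[OF cover jointly_df[of A]]) blast
  then obtain P' Q' where "\<And>A. jointly_holomorphic_on (P' A) (UNIV \<times> U)" "\<And>A. jointly_holomorphic_on (Q' A) (UNIV \<times> Uh)"
    "\<And>A x l. l \<in> overlap U Uh \<Longrightarrow> df A x l = P' A x l + Q' A x (inverse l) * inverse l"
    by metis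
  with PQ have "split_fourfold U Uh f P Q P' Q'" by unfold_locales
  then show thesis by (rule that)
qed

theorem theorem5p2:
  fixes U Uh :: "complex set" and \<epsilon> :: complex and f :: "complex ^ 2 \<Rightarrow> complex \<Rightarrow> complex"
  assumes cover: "covers_P1 U Uh"
    and f_holomorphic: "jointly_holomorphic_on f (UNIV \<times> overlap U Uh)"
  shows
    \<comment> \<open>the moduli space is a complex five-manifold with coordinates \<open>(t, x\<^bsup>AA'\<^esup>)\<close>\<close>
    "complex_manifold (global_sections U Uh \<epsilon> f) {(global_sections U Uh \<epsilon> f, moduli_coords)} \<and>
     bij_betw moduli_coords (global_sections U Uh \<epsilon> f) UNIV \<and>
     (\<forall>\<mu>. jointly_holomorphic_on (\<lambda>x l. w_res U Uh \<epsilon> f x l $ \<mu>) (UNIV \<times> U)) \<and>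
     (\<forall>\<mu>. jointly_holomorphic_on (\<lambda>x m. wh_res U Uh \<epsilon> f x m $ \<mu>) (UNIV \<times> Uh)) \<and>
     (\<forall>x. kodaira_iso_at U Uh \<epsilon> f x) \<and>
     (\<forall>x. \<forall>l\<in>U. \<forall>A. w_res U Uh \<epsilon> f x l $ Some A = x $ Some (A, 1) + x $ Some (A, 0) * l) \<and>
     (\<forall>x. \<exists>\<gamma> :: int \<Rightarrow> complex.
        (\<forall>l\<in>overlap U Uh. ((\<lambda>n. \<gamma> n * l powi n) has_sum f (\<chi> A. w_res U Uh \<epsilon> f x l $ Some A) l) UNIV) \<and>
        (\<forall>l\<in>U. (\<lambda>n. \<gamma> n * l powi n) summable_on {1..} \<and>
           w_res U Uh \<epsilon> f x l $ None = x $ None - \<epsilon> * (\<Sum>\<^sub>\<infinity>n\<in>{1..}. \<gamma> n * l powi n))) \<and>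
    \<comment> \<open>every frame section induces a Galilean structure\<close>
     (\<forall>H Hh. normal_splitting U Uh \<epsilon> f H Hh \<longrightarrow>
        (\<exists>!(h, \<theta>). frame_induces U Uh \<epsilon> f H h \<theta>) \<and>
        (\<forall>h \<theta>. frame_induces U Uh \<epsilon> f H h \<theta> \<longrightarrow> galilean_structure h \<theta>)) \<and>
    \<comment> \<open>the normal bundles split, and one of the resulting clocks has the stated torsion\<close>
     (\<exists>H Hh h \<theta>. normal_splitting U Uh \<epsilon> f H Hh \<and> frame_induces U Uh \<epsilon> f H h \<theta> \<and>
        (\<forall>c \<pi>. encircles_zero_once (overlap U Uh) c \<longrightarrow> homogeneous_lift (overlap U Uh) \<pi> \<longrightarrow>
           (\<forall>x a b. ext_deriv \<theta> x $ a $ b =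
              \<epsilon> * (\<Sum>A\<in>UNIV. \<Sum>B\<in>UNIV. \<Sum>B'\<in>UNIV.
                 torsion_coeff f c \<pi> x A B B' * wedge (dx B B') (dx A 1) $ a $ b))))"
proof -
  interpret patched_fourfold U Uh \<epsilon> f
    by unfold_locales (rule cover, rule f_holomorphic)
  obtain P Q P' Q' where split: "split_fourfold U Uh f P Q P' Q'" by (rule splitting_exists)
  interpret split_fourfold U Uh \<epsilon> f P Q P' Q' by (rule split)
  obtain h \<theta> where h: "frame_induces U Uh \<epsilon> f H0 h \<theta>"
    using frame_induces_galilean(1)[OF splitting0] by blast
  have "\<theta> = clock_of H0" by (rule frame_induces_galilean(3)[OF splitting0 h])
  with splitting0 h torsion0
  have torsion: "\<exists>H Hh h \<theta>. normal_splitting U Uh \<epsilon> f H Hh \<and> frame_induces U Uh \<epsilon> f H h \<theta> \<and>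
        (\<forall>c \<pi>. encircles_zero_once (overlap U Uh) c \<longrightarrow> homogeneous_lift (overlap U Uh) \<pi> \<longrightarrow>
           (\<forall>x a b. ext_deriv \<theta> x $ a $ b =
              \<epsilon> * (\<Sum>A\<in>UNIV. \<Sum>B\<in>UNIV. \<Sum>B'\<in>UNIV.
                 torsion_coeff f c \<pi> x A B B' * wedge (dx B B') (dx A 1) $ a $ b)))"
    by blast
  show ?thesis
    using complex_manifold_global_sections bij_moduli_coords w_res_jointly wh_res_jointly kodaira_iso_at expansion torsion
      frame_induces_galilean(1,2)
    by (intro conjI) (simp_all add: w_res_eq sec_simps(2))
qed

end
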